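(* Let $R$ be a ring, let $G$ be a finitely generated amenable group, let $R\ast G$ be a fixed crossed product of $R$ with $G$, and let $L\colon R\text{-}\mathrm{Mod}\to\mathbb R_{\geq 0}\cup\{\infty\}$ be a length function compatible with $R\ast G$. Then the algebraic $L$-entropy $\mathrm{ent}_L\colon \mathrm{lFin}_L(R\ast G)\to\mathbb R_{\geq0}\cup\{\infty\}$ satisfies the following properties: (1) $\mathrm{ent}_L$ is a length function; (2) $\mathrm{ent}_L((R\ast G)\otimes_R K)=L(K)$ for every left $R$-module $K$ with $L(K)<\infty$; (3) for every left $R$-module $K$ with $L(K)<\infty$ and every $R\ast G$-submodule $N\leq (R\ast G)\otimes_R K$, one has $\mathrm{ent}_L({}_{R\ast G}N)=0$ if and only if $L({}_RN)=0$.
   Context: Rings are associative and unital; $R\text{-}\mathrm{Mod}$ is the category of left $R$-modules. Length functions: let $\mathcal C$ be a class of left modules over a ring, closed under submodules and quotients (and isomorphisms). An invariant $L\colon\mathcal C\to\mathbb R_{\ge0}\cup\{\infty\}$ is a map taking equal values on isomorphic modules. It is additive if $L(0)=0$ and $L(B)=L(A)+L(C)$ for every short exact sequence $0\to A\to B\to C\to0$ with all terms in $\mathcal C$. It is upper continuous if $L(X)=\sup_{\alpha}L(X_\alpha)$ whenever $X\in\mathcal C$ is the union of a directed (nonempty) family $\{X_\alpha\}$ of submodules. A length function is an additive, upper continuous invariant. Crossed product: given maps $\sigma\colon G\to \mathrm{Aut}_{\mathrm{ring}}(R)$ and $\rho\colon G\times G\to U(R)$ (units of $R$), writing $r^{\sigma(g)}$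 for the image of $r$ under $\sigma(g)$ and $r^{\sigma(g)\sigma(h)}=(r^{\sigma(g)})^{\sigma(h)}$, such that for all $r\in R$, $g,g_1,g_2,g_3\in G$: (i) $\rho(g_1,g_2)\rho(g_1g_2,g_3)=\rho(g_2,g_3)^{\sigma(g_1)}\rho(g_1,g_2g_3)$; (ii) $r^{\sigma(g_2)\sigma(g_1)}=\rho(g_1,g_2)\,r^{\sigma(g_1g_2)}\rho(g_1,g_2)^{-1}$; (iii) $\rho(g,e)=\rho(e,g)=1$, $\sigma(e)=\mathrm{id}$; the crossed product $R\ast G$ is the set of finite formal sums $\sum_{g\in G} r_g\underline g$ with componentwise addition and multiplication given bilinearly by $(r\underline g)(s\underline h)=r s^{\sigma(g)}\rho(g,h)\,\underline{gh}$. It contains $R$ via $r\mapsto r\underline e$, so each left $R\ast G$-module is a left $R$-module. Compatibility: for a ring automorphism $\phi$ of $R$ let $F_\phi\colon R\text{-}\mathrm{Mod}\to R\text{-}\mathrm{Mod}$ be restriction of scalars along $\phi$. $L$ is compatible with $R\ast G$ if $L(F_{\sigma(g)}(M))=L(M)$ for all $g\in G$ and all left $R$-modules $M$. Amenability: for $A,C\subseteq G$ put $\partial_C(A)=\{x\in G: xC\cap A\neq\emptyset\}\setminus\{x\in G: xC\subseteq A\}$. A F\o lner sequence of $G$ is a sequence $\{F_n\}_{n\in\mathbb N}$ of nonempty finite subsets of $G$ with $\lim_n|\partial_C(F_n)|/|F_n|=0$ for every finite $C\subseteq G$. A finitely generated group is amenable iff it has a F\o lner sequence. Entropy: for a left $R\ast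 G$-module $M$ let $\mathrm{Fin}_L(M)=\{{}_RK\le M: L(K)<\infty\}$ (a set of $R$-submodules). $\mathrm{lFin}_L(R\ast G)$ is the class of left $R\ast G$-modules $M$ such that $L(K)<\infty$ for every finitely generated $R$-submodule $K\leq M$. For $M\in\mathrm{lFin}_L(R\ast G)$, $K\in\mathrm{Fin}_L(M)$ and $F\subseteq G$ put $T_F(K)=\sum_{g\in F}\underline gK$ (an $R$-submodule). Define $\mathrm{ent}_L(M,K)=\lim_{n\to\infty}L(T_{F_n}(K))/|F_n|$ for a F\o lner sequence $\{F_n\}$ (the limit exists and is independent of the F\o lner sequence), and $\mathrm{ent}_L(M)=\sup\{\mathrm{ent}_L(M,K):K\in\mathrm{Fin}_L(M)\}$. *)

theory Defs
  imports "HOL-Algebra.Algebra" "HOL-Library.Extended_Nonnegative_Real"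
begin

section \<open>Left modules\<close>

text \<open>The library's locale \<^locale>\<open>module\<close> is restricted to commutative rings. We keep its
  record type, and also its \<^locale>\<open>submodule\<close>, which does not use commutativity.\<close>

locale left_module = R?: ring R + M?: abelian_group M
  for R :: "('r, 'c) ring_scheme" and M :: "('r, 'm, 'e) module_scheme" (structure) +
  assumes smult_closed [simp, intro]:
      "\<lbrakk>a \<in> carrier R; x \<in> carrier M\<rbrakk> \<Longrightarrow> a \<odot>\<^bsub>M\<^esub> x \<in> carrier M"
    and smult_l_distr:
      "\<lbrakk>a \<in> carrier R; b \<in> carrier R; x \<in> carrier M\<rbrakk> \<Longrightarrow>
        (a \<oplus>\<^bsub>R\<^esub> b) \<odot>\<^bsub>M\<^esub> x = a \<odot>\<^bsub>M\<^esub> x \<oplus>\<^bsub>M\<^esub> b \<odot>\<^bsub>M\<^esub> x"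
    and smult_r_distr:
      "\<lbrakk>a \<in> carrier R; x \<in> carrier M; y \<in> carrier M\<rbrakk> \<Longrightarrow>
        a \<odot>\<^bsub>M\<^esub> (x \<oplus>\<^bsub>M\<^esub> y) = a \<odot>\<^bsub>M\<^esub> x \<oplus>\<^bsub>M\<^esub> a \<odot>\<^bsub>M\<^esub> y"
    and smult_assoc:
      "\<lbrakk>a \<in> carrier R; b \<in> carrier R; x \<in> carrier M\<rbrakk> \<Longrightarrow>
        (a \<otimes>\<^bsub>R\<^esub> b) \<odot>\<^bsub>M\<^esub> x = a \<odot>\<^bsub>M\<^esub> (b \<odot>\<^bsub>M\<^esub> x)"
    and smult_one [simp]: "x \<in> carrier M \<Longrightarrow> \<one>\<^bsub>R\<^esub> \<odot>\<^bsub>M\<^esub> x = x"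

definition mod_hom :: "('r, 'c) ring_scheme \<Rightarrow> ('r, 'm) module \<Rightarrow> ('r, 'n) module \<Rightarrow> ('m \<Rightarrow> 'n) set" where
  "mod_hom R M N = {f \<in> carrier M \<rightarrow> carrier N.
     (\<forall>x\<in>carrier M. \<forall>y\<in>carrier M. f (x \<oplus>\<^bsub>M\<^esub> y) = f x \<oplus>\<^bsub>N\<^esub> f y) \<and>
     (\<forall>a\<in>carrier R. \<forall>x\<in>carrier M. f (a \<odot>\<^bsub>M\<^esub> x) = a \<odot>\<^bsub>N\<^esub> f x)}"

definition mod_isomorphic :: "('r, 'c) ring_scheme \<Rightarrow> ('r, 'm) module \<Rightarrow> ('r, 'n) module \<Rightarrow> bool" where
  "mod_isomorphic R M N \<longleftrightarrow> (\<exists>f\<in>mod_hom R M N. bij_betw f (carrier M) (carrier N))"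

definition short_exact ::
  "('r, 'c) ring_scheme \<Rightarrow> ('r, 'm) module \<Rightarrow> ('m \<Rightarrow> 'm) \<Rightarrow> ('r, 'm) module \<Rightarrow> ('m \<Rightarrow> 'm) \<Rightarrow> ('r, 'm) module \<Rightarrow> bool" where
  "short_exact R A f B g C \<longleftrightarrow>
     f \<in> mod_hom R A B \<and> g \<in> mod_hom R B C \<and>
     inj_on f (carrier A) \<and> g ` carrier B = carrier C \<and>
     f ` carrier A = {b \<in> carrier B. g b = \<zero>\<^bsub>C\<^esub>}"

abbreviation sub_mod :: "('r, 'm) module \<Rightarrow> 'm set \<Rightarrow> ('r, 'm) module" where
  "sub_mod M K \<equiv> M\<lparr>carrier := K\<rparr>"

definition mod_span :: "('r, 'c) ring_scheme \<Rightarrow> ('r, 'm) module \<Rightarrow> 'm set \<Rightarrow> 'm set" where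
  "mod_span R M S = \<Inter>{N. submodule N R M \<and> S \<subseteq> N}"

definition fg_submodule :: "'m set \<Rightarrow> ('r, 'c) ring_scheme \<Rightarrow> ('r, 'm) module \<Rightarrow> bool" where
  "fg_submodule K R M \<longleftrightarrow> (\<exists>S. finite S \<and> S \<subseteq> carrier M \<and> K = mod_span R M S)"

definition restrict_scalars :: "('r \<Rightarrow> 's) \<Rightarrow> ('s, 'm) module \<Rightarrow> ('r, 'm) module" where
  "restrict_scalars \<phi> M =
     \<lparr>carrier = carrier M, monoid.mult = monoid.mult M, one = one M, ring.zero = ring.zero M, ring.add = ring.add M,
      smult = (\<lambda>r x. \<phi> r \<odot>\<^bsub>M\<^esub> x)\<rparr>"


section \<open>Length functions\<close>

text \<open>The type \<open>'m\<close> plays the role of the universe: the category \<open>R-Mod\<close> is rendered as the class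
  of all left \<open>R\<close>-modules whose underlying set is a subset of \<open>'m\<close>. As the quotient of a module by
  a submodule need not literally have elements in \<open>'m\<close>, submodules and quotients are taken up to
  isomorphism, i.e. as sources of injective and targets of surjective homomorphisms.\<close>

definition R_Mod :: "('r, 'c) ring_scheme \<Rightarrow> ('r, 'm) module set" where
  "R_Mod R = {M. left_module R M}"

definition sub_quot_closed :: "('r, 'c) ring_scheme \<Rightarrow> ('r, 'm) module set \<Rightarrow> bool" where
  "sub_quot_closed R \<C> \<longleftrightarrow>
     (\<forall>B\<in>\<C>. \<forall>A\<in>R_Mod R. \<forall>f\<in>mod_hom R A B. inj_on f (carrier A) \<longrightarrow> A \<in> \<C>) \<and>
     (\<forall>B\<in>\<C>. \<forall>C\<in>R_Mod R. \<forall>g\<in>mod_hom R B C. g ` carrier B = carrier C \<longrightarrow> C \<in> \<C>)"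

definition invariant_on ::
  "('r, 'c) ring_scheme \<Rightarrow> ('r, 'm) module set \<Rightarrow> (('r, 'm) module \<Rightarrow> ennreal) \<Rightarrow> bool" where
  "invariant_on R \<C> L \<longleftrightarrow> (\<forall>M\<in>\<C>. \<forall>N\<in>\<C>. mod_isomorphic R M N \<longrightarrow> L M = L N)"

definition additive_on ::
  "('r, 'c) ring_scheme \<Rightarrow> ('r, 'm) module set \<Rightarrow> (('r, 'm) module \<Rightarrow> ennreal) \<Rightarrow> bool" where
  "additive_on R \<C> L \<longleftrightarrow>
     (\<forall>Z\<in>\<C>. carrier Z = {\<zero>\<^bsub>Z\<^esub>} \<longrightarrow> L Z = 0) \<and>
     (\<forall>A\<in>\<C>. \<forall>B\<in>\<C>. \<forall>C\<in>\<C>. \<forall>f g. short_exact R A f B g C \<longrightarrow> L B = L A + L C)"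

definition upper_continuous_on ::
  "('r, 'c) ring_scheme \<Rightarrow> ('r, 'm) module set \<Rightarrow> (('r, 'm) module \<Rightarrow> ennreal) \<Rightarrow> bool" where
  "upper_continuous_on R \<C> L \<longleftrightarrow>
     (\<forall>M\<in>\<C>. \<forall>\<D>. \<D> \<noteq> {} \<and> (\<forall>Y\<in>\<D>. submodule Y R M) \<and>
        (\<forall>Y\<in>\<D>. \<forall>Z\<in>\<D>. \<exists>W\<in>\<D>. Y \<subseteq> W \<and> Z \<subseteq> W) \<and> \<Union>\<D> = carrier M
        \<longrightarrow> L M = (SUP Y\<in>\<D>. L (sub_mod M Y)))"

definition length_function ::
  "('r, 'c) ring_scheme \<Rightarrow> ('r, 'm) module set \<Rightarrow> (('r, 'm) module \<Rightarrow> ennreal) \<Rightarrow> bool" where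
  "length_function R \<C> L \<longleftrightarrow>
     \<C> \<subseteq> R_Mod R \<and> sub_quot_closed R \<C> \<and>
     invariant_on R \<C> L \<and> additive_on R \<C> L \<and> upper_continuous_on R \<C> L"


section \<open>Crossed products\<close>

locale crossed_system = R?: ring R + G?: group G
  for R :: "('r, 'c) ring_scheme" and G :: "('g, 'd) monoid_scheme" +
  fixes \<sigma> :: "'g \<Rightarrow> 'r \<Rightarrow> 'r" and \<rho> :: "'g \<Rightarrow> 'g \<Rightarrow> 'r"
  assumes sigma_aut: "g \<in> carrier G \<Longrightarrow> \<sigma> g \<in> ring_iso R R"
    and rho_unit: "\<lbrakk>g \<in> carrier G; h \<in> carrier G\<rbrakk> \<Longrightarrow> \<rho> g h \<in> Units R"
    and cocycle:
      "\<lbrakk>g1 \<in> carrier G; g2 \<in> carrier G; g3 \<in> carrier G\<rbrakk> \<Longrightarrow>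
        \<rho> g1 g2 \<otimes>\<^bsub>R\<^esub> \<rho> (g1 \<otimes>\<^bsub>G\<^esub> g2) g3 = \<sigma> g1 (\<rho> g2 g3) \<otimes>\<^bsub>R\<^esub> \<rho> g1 (g2 \<otimes>\<^bsub>G\<^esub> g3)"
    and twist:
      "\<lbrakk>g1 \<in> carrier G; g2 \<in> carrier G; r \<in> carrier R\<rbrakk> \<Longrightarrow>
        \<sigma> g1 (\<sigma> g2 r) = \<rho> g1 g2 \<otimes>\<^bsub>R\<^esub> \<sigma> (g1 \<otimes>\<^bsub>G\<^esub> g2) r \<otimes>\<^bsub>R\<^esub> inv\<^bsub>R\<^esub> (\<rho> g1 g2)"
    and rho_one_right: "g \<in> carrier G \<Longrightarrow> \<rho> g \<one>\<^bsub>G\<^esub> = \<one>\<^bsub>R\<^esub>"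
    and rho_one_left: "g \<in> carrier G \<Longrightarrow> \<rho> \<one>\<^bsub>G\<^esub> g = \<one>\<^bsub>R\<^esub>"
    and sigma_one: "r \<in> carrier R \<Longrightarrow> \<sigma> \<one>\<^bsub>G\<^esub> r = r"

text \<open>\<open>cp_monom R g r\<close> is the formal sum \<open>r g\<close>; a formal sum is its coefficient function.\<close>

definition cp_monom :: "('r, 'c) ring_scheme \<Rightarrow> 'g \<Rightarrow> 'r \<Rightarrow> 'g \<Rightarrow> 'r" where
  "cp_monom R g r = (\<lambda>h. if h = g then r else \<zero>\<^bsub>R\<^esub>)"

definition cp_supp :: "('r, 'c) ring_scheme \<Rightarrow> ('g \<Rightarrow> 'r) \<Rightarrow> 'g set" where
  "cp_supp R a = {g. a g \<noteq> \<zero>\<^bsub>R\<^esub>}"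

definition crossed_product ::
  "('r, 'c) ring_scheme \<Rightarrow> ('g, 'd) monoid_scheme \<Rightarrow> ('g \<Rightarrow> 'r \<Rightarrow> 'r) \<Rightarrow> ('g \<Rightarrow> 'g \<Rightarrow> 'r) \<Rightarrow> ('g \<Rightarrow> 'r) ring" where
  "crossed_product R G \<sigma> \<rho> =
     \<lparr>carrier = {a. range a \<subseteq> carrier R \<and> finite (cp_supp R a) \<and> cp_supp R a \<subseteq> carrier G},
      monoid.mult = (\<lambda>a b x. finsum R (\<lambda>(g, h). a g \<otimes>\<^bsub>R\<^esub> \<sigma> g (b h) \<otimes>\<^bsub>R\<^esub> \<rho> g h)
                        {(g, h). g \<in> cp_supp R a \<and> h \<in> cp_supp R b \<and> g \<otimes>\<^bsub>G\<^esub> h = x}),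
      one = cp_monom R \<one>\<^bsub>G\<^esub> \<one>\<^bsub>R\<^esub>,
      ring.zero = (\<lambda>_. \<zero>\<^bsub>R\<^esub>),
      ring.add = (\<lambda>a b x. a x \<oplus>\<^bsub>R\<^esub> b x)\<rparr>"

abbreviation base_mod ::
  "('r, 'c) ring_scheme \<Rightarrow> ('g, 'd) monoid_scheme \<Rightarrow> ('g \<Rightarrow> 'r, 'm) module \<Rightarrow> ('r, 'm) module" where
  "base_mod R G M \<equiv> restrict_scalars (cp_monom R \<one>\<^bsub>G\<^esub>) M"

definition compatible ::
  "('r, 'c) ring_scheme \<Rightarrow> ('g, 'd) monoid_scheme \<Rightarrow> ('g \<Rightarrow> 'r \<Rightarrow> 'r) \<Rightarrow> (('r, 'm) module \<Rightarrow> ennreal) \<Rightarrow> bool" where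
  "compatible R G \<sigma> L \<longleftrightarrow>
     (\<forall>g\<in>carrier G. \<forall>M\<in>R_Mod R. L (restrict_scalars (\<sigma> g) M) = L M)"


section \<open>Extension of scalars\<close>

text \<open>For a ring homomorphism \<open>\<iota>\<close> from \<open>R\<close> to \<open>S\<close>, the tensor product of the right \<open>R\<close>-module \<open>S\<close>
  (with \<open>s r = s \<iota>(r)\<close>) and a left \<open>R\<close>-module \<open>K\<close>: the free abelian group on the pairs
  \<open>(s, k)\<close> modulo the subgroup generated by the balancing relations. In the scalar
  multiplication, \<open>C\<close> is a coset, and adding the subgroup of relations to its image under \<open>(t, k) \<mapsto> (s t, k)\<close> by the
  yields the full coset containing that image.\<close>

definition tensor_relations ::
  "('s, 'd) ring_scheme \<Rightarrow> ('r \<Rightarrow> 's) \<Rightarrow> ('r, 'c) ring_scheme \<Rightarrow> ('r, 'm) module \<Rightarrow> ('s \<times> 'm \<Rightarrow>\<^sub>0 int) set" where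
  "tensor_relations S \<iota> R K =
     {frag_of (s \<oplus>\<^bsub>S\<^esub> t, k) - frag_of (s, k) - frag_of (t, k) | s t k.
        s \<in> carrier S \<and> t \<in> carrier S \<and> k \<in> carrier K} \<union>
     {frag_of (s, k \<oplus>\<^bsub>K\<^esub> l) - frag_of (s, k) - frag_of (s, l) | s k l.
        s \<in> carrier S \<and> k \<in> carrier K \<and> l \<in> carrier K} \<union>
     {frag_of (s \<otimes>\<^bsub>S\<^esub> \<iota> r, k) - frag_of (s, r \<odot>\<^bsub>K\<^esub> k) | s r k.
        s \<in> carrier S \<and> r \<in> carrier R \<and> k \<in> carrier K}"

definition tensor ::
  "('s, 'd) ring_scheme \<Rightarrow> ('r \<Rightarrow> 's) \<Rightarrow> ('r, 'c) ring_scheme \<Rightarrow> ('r, 'm) module \<Rightarrow>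
    ('s, ('s \<times> 'm \<Rightarrow>\<^sub>0 int) set) module" where
  "tensor S \<iota> R K =
     (let A = free_Abelian_group (carrier S \<times> carrier K);
          N = generate A (tensor_relations S \<iota> R K);
          Q = A Mod N
      in \<lparr>carrier = carrier Q, monoid.mult = monoid.mult Q, one = one Q, ring.zero = one Q, ring.add = monoid.mult Q,
          smult = (\<lambda>s C. N <#>\<^bsub>A\<^esub> (frag_extend (\<lambda>(t, k). frag_of (s \<otimes>\<^bsub>S\<^esub> t, k)) ` C))\<rparr>)"

text \<open>\<open>T\<close> is a copy of \<open>(R * G) \<otimes>\<^sub>R K\<close> with elements in the type \<open>'n\<close>. If \<open>K\<close> has elements in
  an infinite type \<open>'m\<close> and \<open>G\<close> is countable, then the tensor product, being generated by the
  \<open>g \<otimes> k\<close>, has at most as many elements as \<open>'m\<close>, so that a copy exists for \<open>'n = 'm\<close>.\<close>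

definition is_induced_module ::
  "('r, 'c) ring_scheme \<Rightarrow> ('g, 'd) monoid_scheme \<Rightarrow> ('g \<Rightarrow> 'r \<Rightarrow> 'r) \<Rightarrow> ('g \<Rightarrow> 'g \<Rightarrow> 'r) \<Rightarrow>
    ('r, 'm) module \<Rightarrow> ('g \<Rightarrow> 'r, 'n) module \<Rightarrow> bool" where
  "is_induced_module R G \<sigma> \<rho> K T \<longleftrightarrow>
     left_module (crossed_product R G \<sigma> \<rho>) T \<and>
     mod_isomorphic (crossed_product R G \<sigma> \<rho>) T
       (tensor (crossed_product R G \<sigma> \<rho>) (cp_monom R \<one>\<^bsub>G\<^esub>) R K)"


section \<open>Amenability\<close>

definition fin_gen_group :: "('g, 'd) monoid_scheme \<Rightarrow> bool" where
  "fin_gen_group G \<longleftrightarrow> group G \<and> (\<exists>S. finite S \<and> S \<subseteq> carrier G \<and> generate G S = carrier G)"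

definition boundary :: "('g, 'd) monoid_scheme \<Rightarrow> 'g set \<Rightarrow> 'g set \<Rightarrow> 'g set" where
  "boundary G C A =
     {x \<in> carrier G. (x <#\<^bsub>G\<^esub> C) \<inter> A \<noteq> {}} - {x \<in> carrier G. x <#\<^bsub>G\<^esub> C \<subseteq> A}"

definition folner_sequence :: "('g, 'd) monoid_scheme \<Rightarrow> (nat \<Rightarrow> 'g set) \<Rightarrow> bool" where
  "folner_sequence G F \<longleftrightarrow>
     (\<forall>n. F n \<noteq> {} \<and> finite (F n) \<and> F n \<subseteq> carrier G) \<and>
     (\<forall>C. finite C \<and> C \<subseteq> carrier G \<longrightarrow>
        (\<lambda>n. real (card (boundary G C (F n))) / real (card (F n))) \<longlonglongrightarrow> 0)"

text \<open>Amenability is used for finitely generated groups only.\<close>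

definition amenable :: "('g, 'd) monoid_scheme \<Rightarrow> bool" where
  "amenable G \<longleftrightarrow> (\<exists>F. folner_sequence G F)"


section \<open>Algebraic entropy\<close>

definition Fin_L ::
  "('r, 'c) ring_scheme \<Rightarrow> ('g, 'd) monoid_scheme \<Rightarrow> (('r, 'm) module \<Rightarrow> ennreal) \<Rightarrow>
    ('g \<Rightarrow> 'r, 'm) module \<Rightarrow> 'm set set" where
  "Fin_L R G L M =
     {K. submodule K R (base_mod R G M) \<and> L (sub_mod (base_mod R G M) K) < \<infinity>}"

definition lFin_L ::
  "('r, 'c) ring_scheme \<Rightarrow> ('g, 'd) monoid_scheme \<Rightarrow> ('g \<Rightarrow> 'r \<Rightarrow> 'r) \<Rightarrow> ('g \<Rightarrow> 'g \<Rightarrow> 'r) \<Rightarrow>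
    (('r, 'm) module \<Rightarrow> ennreal) \<Rightarrow> ('g \<Rightarrow> 'r, 'm) module set" where
  "lFin_L R G \<sigma> \<rho> L =
     {M \<in> R_Mod (crossed_product R G \<sigma> \<rho>).
        \<forall>K. fg_submodule K R (base_mod R G M) \<longrightarrow> L (sub_mod (base_mod R G M) K) < \<infinity>}"

definition T_sum ::
  "('r, 'c) ring_scheme \<Rightarrow> ('g \<Rightarrow> 'r, 'm) module \<Rightarrow> 'g set \<Rightarrow> 'm set \<Rightarrow> 'm set" where
  "T_sum R M F K =
     {\<Oplus>\<^bsub>M\<^esub>g\<in>E. cp_monom R g \<one>\<^bsub>R\<^esub> \<odot>\<^bsub>M\<^esub> k g | E k. finite E \<and> E \<subseteq> F \<and> k \<in> E \<rightarrow> K}"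

text \<open>The common limit along all Folner sequences.\<close>

definition ent_at ::
  "('r, 'c) ring_scheme \<Rightarrow> ('g, 'd) monoid_scheme \<Rightarrow> (('r, 'm) module \<Rightarrow> ennreal) \<Rightarrow>
    ('g \<Rightarrow> 'r, 'm) module \<Rightarrow> 'm set \<Rightarrow> ennreal" where
  "ent_at R G L M K =
     (THE l. \<forall>F. folner_sequence G F \<longrightarrow>
        (\<lambda>n. L (sub_mod (base_mod R G M) (T_sum R M (F n) K)) / of_nat (card (F n))) \<longlonglongrightarrow> l)"

definition ent ::
  "('r, 'c) ring_scheme \<Rightarrow> ('g, 'd) monoid_scheme \<Rightarrow> (('r, 'm) module \<Rightarrow> ennreal) \<Rightarrow>
    ('g \<Rightarrow> 'r, 'm) module \<Rightarrow> ennreal" where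
  "ent R G L M = (SUP K\<in>Fin_L R G L M. ent_at R G L M K)"

end

theory Submission
  imports Defs
begin

text \<open>
  Additivity of \<open>L\<close> gives the modular law \<open>L(A + B) + L(A \<inter> B) = L(A) + L(B)\<close> (\<open>len_modular\<close>), and the
  proof rests on it. As \<open>T_F K + T_F' K\<close> is the submodule \<open>T_(F \<union> F') K\<close>, the function
  \<open>F \<mapsto> L(T_F K)\<close> is submodular; as \<open>k \<mapsto> g k\<close> is bijective and \<open>\<sigma>(g)\<close>-semilinear, compatibility
  makes it invariant under left translations (\<open>len_act\<close>, \<open>act_T\<close>). Shearer's inequality
  (\<open>submodular_exact_cover\<close>), applied to the intersections of \<open>F\<close> with the translates of a finite set
  \<open>E\<close>, then bounds \<open>card E * L(T_F K)\<close> by \<open>L(T_E K)\<close> times the number of translates that meet \<open>F\<close>,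
  and along a Folner sequence this number is asymptotically \<open>card F\<close>. Therefore the limit
  that defines the entropy at \<open>K\<close> exists and is the infimum of \<open>L(T_E K) / card E\<close> over all nonempty
  finite \<open>E\<close> (\<open>folner_limit\<close>), so that many inequalities can be verified for one finite set at a time.

  Let \<open>0 \<rightarrow> A \<rightarrow> B \<rightarrow> C \<rightarrow> 0\<close> be exact. The entropy of \<open>B\<close> is at least the sum of the others because
  finitely generated submodules of \<open>C\<close> lift to submodules of \<open>B\<close> of finite length
  (\<open>ent_additive_ge\<close>). For the other inequality fix \<open>K\<close> in \<open>B\<close> and \<open>E\<close>, and put \<open>K1 = T_E K \<inter> A\<close>.
  Shearer's inequality for \<open>S \<mapsto> L((T_S K + T_F K1) / T_F K1)\<close> shows that \<open>L(T_F K)\<close> exceeds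
  \<open>L(T_F K1)\<close> by little more than \<open>card F / card E\<close> times the length of \<open>T_E\<close> of the image of \<open>K\<close>
  in \<open>C\<close> (\<open>ent_real_subadditive\<close>). Here \<open>K1\<close> contributes at most the entropy of \<open>A\<close>, and the infimum over \<open>E\<close> of
  the remaining terms is at most the entropy of \<open>C\<close>. Upper continuity holds because shrinking \<open>K\<close> by length
  \<open>\<epsilon>\<close> shrinks its entropy by at most \<open>\<epsilon>\<close> (\<open>ent_real_increment\<close>).

  An induced module is the direct sum of the translates \<open>g (1 \<otimes> K)\<close>
  (\<open>induced_module_coordinates\<close>). So \<open>T_F (1 \<otimes> K)\<close> has length \<open>card F * L(K)\<close>, and \<open>1 \<otimes> K\<close> has entropy
  \<open>L(K)\<close>. Any submodule of finite length lies up to \<open>\<epsilon>\<close> in some \<open>T_E (1 \<otimes> K)\<close>, which has no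
  more entropy than \<open>1 \<otimes> K\<close> (\<open>ent_real_T_le\<close>). If a submodule \<open>N\<close> has positive length, it
  contains a finitely generated \<open>H\<close> of positive length, which lies in some \<open>T_E (1 \<otimes> K)\<close>. Every finite \<open>F\<close>
  has a subset \<open>S\<close> with at least \<open>card F / (card E)\<^sup>2\<close> elements \<open>x\<close> for which the translates
  \<open>x E\<close> are disjoint (\<open>packing\<close>). The submodules \<open>x H\<close> for \<open>x \<in> S\<close> are then independent, and the
  entropy of \<open>N\<close> is at least \<open>L(H) / (card E)\<^sup>2 > 0\<close> (\<open>ent_real_lower_bound\<close>).
\<close>

section \<open>Submodules, quotients and homomorphisms of left modules\<close>

text \<open>A record is a module as soon as some map from a module onto it preserves the operations: each
  axiom is the image of the same axiom. Quotients are obtained in this way.\<close>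

lemma left_module_image:
  fixes V Q :: "('r, 'm) module"
  assumes V: "left_module R V"
    and carr: "carrier Q = g ` carrier V"
    and zero: "g \<zero>\<^bsub>V\<^esub> = \<zero>\<^bsub>Q\<^esub>"
    and add: "\<And>x y. x \<in> carrier V \<Longrightarrow> y \<in> carrier V \<Longrightarrow> g (x \<oplus>\<^bsub>V\<^esub> y) = g x \<oplus>\<^bsub>Q\<^esub> g y"
    and smult: "\<And>a x. a \<in> carrier R \<Longrightarrow> x \<in> carrier V \<Longrightarrow> g (a \<odot>\<^bsub>V\<^esub> x) = a \<odot>\<^bsub>Q\<^esub> g x"
  shows "left_module R Q"
proof -
  interpret V: left_module R V by fact
  show ?thesis
  proof (intro left_module.intro left_module_axioms.intro abelian_groupI)
    show "ring R" by (rule V.R.ring_axioms)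
    show "x \<oplus>\<^bsub>Q\<^esub> y \<in> carrier Q" if "x \<in> carrier Q" "y \<in> carrier Q" for x y
      using that add by (auto simp: carr) (metis V.M.add.m_closed add imageI)
    show "\<zero>\<^bsub>Q\<^esub> \<in> carrier Q" by (auto simp: carr simp flip: zero)
    show "x \<oplus>\<^bsub>Q\<^esub> y \<oplus>\<^bsub>Q\<^esub> z = x \<oplus>\<^bsub>Q\<^esub> (y \<oplus>\<^bsub>Q\<^esub> z)"
      if "x \<in> carrier Q" "y \<in> carrier Q" "z \<in> carrier Q" for x y z
      using that by (auto simp: carr V.M.add.m_assoc simp flip: add)
    show "x \<oplus>\<^bsub>Q\<^esub> y = y \<oplus>\<^bsub>Q\<^esub> x" if "x \<in> carrier Q" "y \<in> carrier Q" for x y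
      using that by (auto simp: carr V.M.add.m_comm simp flip: add)
    show "\<zero>\<^bsub>Q\<^esub> \<oplus>\<^bsub>Q\<^esub> x = x" if "x \<in> carrier Q" for x
      using that by (auto simp: carr simp flip: add zero)
    show "\<exists>y\<in>carrier Q. y \<oplus>\<^bsub>Q\<^esub> x = \<zero>\<^bsub>Q\<^esub>" if x: "x \<in> carrier Q" for x
    proof -
      obtain u where u: "u \<in> carrier V" "x = g u" using x carr by auto
      have "g (\<ominus>\<^bsub>V\<^esub> u) \<oplus>\<^bsub>Q\<^esub> x = \<zero>\<^bsub>Q\<^esub>"
        using u by (simp add: V.M.l_neg flip: add zero)
      then show ?thesis using u carr by auto
    qed
    show "a \<odot>\<^bsub>Q\<^esub> x \<in> carrier Q" if "a \<in> carrier R" "x \<in> carrier Q" for a x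
      using that by (auto simp: carr simp flip: smult)
    show "(a \<oplus>\<^bsub>R\<^esub> b) \<odot>\<^bsub>Q\<^esub> x = a \<odot>\<^bsub>Q\<^esub> x \<oplus>\<^bsub>Q\<^esub> b \<odot>\<^bsub>Q\<^esub> x"
      if "a \<in> carrier R" "b \<in> carrier R" "x \<in> carrier Q" for a b x
      using that by (auto simp: carr V.smult_l_distr simp flip: smult add)
    show "a \<odot>\<^bsub>Q\<^esub> (x \<oplus>\<^bsub>Q\<^esub> y) = a \<odot>\<^bsub>Q\<^esub> x \<oplus>\<^bsub>Q\<^esub> a \<odot>\<^bsub>Q\<^esub> y"
      if "a \<in> carrier R" "x \<in> carrier Q" "y \<in> carrier Q" for a x y
      using that by (auto simp: carr V.smult_r_distr simp flip: smult add)
    show "(a \<otimes>\<^bsub>R\<^esub> b) \<odot>\<^bsub>Q\<^esub> x = a \<odot>\<^bsub>Q\<^esub> (b \<odot>\<^bsub>Q\<^esub> x)"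
      if "a \<in> carrier R" "b \<in> carrier R" "x \<in> carrier Q" for a b x
      using that by (auto simp: carr V.smult_assoc simp flip: smult)
    show "\<one>\<^bsub>R\<^esub> \<odot>\<^bsub>Q\<^esub> x = x" if "x \<in> carrier Q" for x
      using that by (auto simp: carr simp flip: smult)
  qed
qed

text \<open>Spans and homomorphisms are defined for module records without further fields, so the
  general facts about submodules are developed for these.\<close>

locale lmodule = left_module R M
  for R :: "('r, 'c) ring_scheme" and M :: "('r, 'm) module" (structure)
begin

lemma smult_zero_right [simp]: "a \<in> carrier R \<Longrightarrow> a \<odot>\<^bsub>M\<^esub> \<zero>\<^bsub>M\<^esub> = \<zero>\<^bsub>M\<^esub>"
  by (metis M.add.l_cancel_one M.r_zero M.zero_closed smult_closed smult_r_distr)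

lemma smult_zero_left [simp]: "x \<in> carrier M \<Longrightarrow> \<zero>\<^bsub>R\<^esub> \<odot>\<^bsub>M\<^esub> x = \<zero>\<^bsub>M\<^esub>"
  by (metis M.add.l_cancel_one R.r_zero R.zero_closed smult_closed smult_l_distr)

lemma neg_zero: "\<ominus>\<^bsub>M\<^esub> \<zero>\<^bsub>M\<^esub> = \<zero>\<^bsub>M\<^esub>"
  by (simp add: M.minus_equality)

lemma smult_minus_one: "x \<in> carrier M \<Longrightarrow> (\<ominus>\<^bsub>R\<^esub> \<one>\<^bsub>R\<^esub>) \<odot>\<^bsub>M\<^esub> x = \<ominus>\<^bsub>M\<^esub> x"
proof -
  assume x: "x \<in> carrier M"
  have "(\<ominus>\<^bsub>R\<^esub> \<one>\<^bsub>R\<^esub>) \<odot>\<^bsub>M\<^esub> x \<oplus>\<^bsub>M\<^esub> x = (\<ominus>\<^bsub>R\<^esub> \<one>\<^bsub>R\<^esub> \<oplus>\<^bsub>R\<^esub> \<one>\<^bsub>R\<^esub>) \<odot>\<^bsub>M\<^esub> x"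
    using x by (simp add: smult_l_distr)
  also have "\<dots> = \<zero>\<^bsub>M\<^esub>" using x by (simp add: R.l_neg)
  finally show ?thesis using x by (simp add: M.minus_equality)
qed

lemma submoduleI:
  assumes "H \<subseteq> carrier M" "\<zero>\<^bsub>M\<^esub> \<in> H"
    and "\<And>x y. x \<in> H \<Longrightarrow> y \<in> H \<Longrightarrow> x \<oplus>\<^bsub>M\<^esub> y \<in> H"
    and sm: "\<And>a x. a \<in> carrier R \<Longrightarrow> x \<in> H \<Longrightarrow> a \<odot>\<^bsub>M\<^esub> x \<in> H"
  shows "submodule H R M"
proof (intro submodule.intro subgroup.intro submodule_axioms.intro)
  show "inv\<^bsub>add_monoid M\<^esub> x \<in> H" if "x \<in> H" for x
  proof -
    have "x \<in> carrier M" using that assms by auto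
    then have "\<ominus>\<^bsub>M\<^esub> x \<in> H" using sm[of "\<ominus>\<^bsub>R\<^esub> \<one>\<^bsub>R\<^esub>" x] that by (simp add: smult_minus_one)
    then show ?thesis by (simp add: a_inv_def)
  qed
qed (use assms in auto)

lemma submoduleD:
  assumes "submodule H R M"
  shows "H \<subseteq> carrier M" "\<zero>\<^bsub>M\<^esub> \<in> H"
    "\<And>x y. x \<in> H \<Longrightarrow> y \<in> H \<Longrightarrow> x \<oplus>\<^bsub>M\<^esub> y \<in> H"
    "\<And>a x. a \<in> carrier R \<Longrightarrow> x \<in> H \<Longrightarrow> a \<odot>\<^bsub>M\<^esub> x \<in> H"
    "\<And>x. x \<in> H \<Longrightarrow> \<ominus>\<^bsub>M\<^esub> x \<in> H"
    "\<And>x y. x \<in> H \<Longrightarrow> y \<in> H \<Longrightarrow> x \<ominus>\<^bsub>M\<^esub> y \<in> H"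
proof -
  interpret H: submodule H R M by fact
  show 1: "H \<subseteq> carrier M" "\<zero>\<^bsub>M\<^esub> \<in> H" using H.subset H.one_closed by auto
  show 2: "x \<oplus>\<^bsub>M\<^esub> y \<in> H" if "x \<in> H" "y \<in> H" for x y using H.m_closed that by auto
  show "a \<odot>\<^bsub>M\<^esub> x \<in> H" if "a \<in> carrier R" "x \<in> H" for a x using that by auto
  show 3: "\<ominus>\<^bsub>M\<^esub> x \<in> H" if "x \<in> H" for x using H.m_inv_closed that by (simp add: a_inv_def)
  show "x \<ominus>\<^bsub>M\<^esub> y \<in> H" if "x \<in> H" "y \<in> H" for x y
    using 2 3 that by (simp add: a_minus_def)
qed

lemma submodule_zero: "submodule {\<zero>\<^bsub>M\<^esub>} R M"
  by (rule submoduleI) auto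

lemma submodule_carrier: "submodule (carrier M) R M"
  by (rule submoduleI) auto

lemma submodule_Int:
  assumes A: "submodule A R M" and B: "submodule B R M"
  shows "submodule (A \<inter> B) R M"
  by (rule submoduleI) (use submoduleD(1-4)[OF A] submoduleD(1-4)[OF B] in auto)

lemma submodule_Inter:
  assumes "\<D> \<noteq> {}" "\<And>A. A \<in> \<D> \<Longrightarrow> submodule A R M"
  shows "submodule (\<Inter>\<D>) R M"
proof (rule submoduleI)
  show "\<Inter>\<D> \<subseteq> carrier M" using assms submoduleD(1) by blast
  show "\<zero>\<^bsub>M\<^esub> \<in> \<Inter>\<D>" using assms submoduleD(2) by blast
  show "x \<oplus>\<^bsub>M\<^esub> y \<in> \<Inter>\<D>" if "x \<in> \<Inter>\<D>" "y \<in> \<Inter>\<D>" for x y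
    using that assms(2) submoduleD(3) by blast
  show "a \<odot>\<^bsub>M\<^esub> x \<in> \<Inter>\<D>" if "a \<in> carrier R" "x \<in> \<Inter>\<D>" for a x
    using that assms(2) submoduleD(4) by blast
qed

lemma submodule_directed_Union:
  assumes "\<D> \<noteq> {}" "\<And>A. A \<in> \<D> \<Longrightarrow> submodule A R M"
    and "\<And>A B. A \<in> \<D> \<Longrightarrow> B \<in> \<D> \<Longrightarrow> \<exists>C\<in>\<D>. A \<subseteq> C \<and> B \<subseteq> C"
  shows "submodule (\<Union>\<D>) R M"
proof (rule submoduleI)
  show "\<Union>\<D> \<subseteq> carrier M" using assms(2) submoduleD(1) by blast
  show "\<zero>\<^bsub>M\<^esub> \<in> \<Union>\<D>" using assms(1,2) submoduleD(2) by blast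
  show "x \<oplus>\<^bsub>M\<^esub> y \<in> \<Union>\<D>" if xy: "x \<in> \<Union>\<D>" "y \<in> \<Union>\<D>" for x y
  proof -
    obtain A B where "A \<in> \<D>" "B \<in> \<D>" "x \<in> A" "y \<in> B" using xy by auto
    then obtain C where "C \<in> \<D>" "x \<in> C" "y \<in> C" using assms(3) by blast
    then show ?thesis using assms(2) submoduleD(3) by blast
  qed
  show "a \<odot>\<^bsub>M\<^esub> x \<in> \<Union>\<D>" if "a \<in> carrier R" "x \<in> \<Union>\<D>" for a x
    using that assms(2) submoduleD(4) by blast
qed

lemma set_add_iff: "z \<in> A <+>\<^bsub>M\<^esub> B \<longleftrightarrow> (\<exists>x\<in>A. \<exists>y\<in>B. z = x \<oplus>\<^bsub>M\<^esub> y)"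
  by (auto simp: set_add_def')

lemma submodule_add:
  assumes A: "submodule A R M" and B: "submodule B R M"
  shows "submodule (A <+>\<^bsub>M\<^esub> B) R M"
proof (rule submoduleI)
  note A = submoduleD[OF A] and B = submoduleD[OF B]
  show "A <+>\<^bsub>M\<^esub> B \<subseteq> carrier M" using A(1) B(1) by (force simp: set_add_iff)
  show "\<zero>\<^bsub>M\<^esub> \<in> A <+>\<^bsub>M\<^esub> B" using A(2) B(2) M.l_zero[of "\<zero>\<^bsub>M\<^esub>"]
    unfolding set_add_iff by (metis M.zero_closed)
  show "x \<oplus>\<^bsub>M\<^esub> y \<in> A <+>\<^bsub>M\<^esub> B" if "x \<in> A <+>\<^bsub>M\<^esub> B" "y \<in> A <+>\<^bsub>M\<^esub> B" for x y
  proof -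
    obtain a b a' b' where *: "a \<in> A" "b \<in> B" "a' \<in> A" "b' \<in> B"
      "x = a \<oplus>\<^bsub>M\<^esub> b" "y = a' \<oplus>\<^bsub>M\<^esub> b'" using \<open>x \<in> _\<close> \<open>y \<in> _\<close> unfolding set_add_iff by blast
    then have "x \<oplus>\<^bsub>M\<^esub> y = (a \<oplus>\<^bsub>M\<^esub> a') \<oplus>\<^bsub>M\<^esub> (b \<oplus>\<^bsub>M\<^esub> b')"
      using A(1) B(1) by (simp add: subset_iff M.a_ac)
    then show ?thesis using * A(3) B(3) unfolding set_add_iff by blast
  qed
  show "a \<odot>\<^bsub>M\<^esub> x \<in> A <+>\<^bsub>M\<^esub> B" if a: "a \<in> carrier R" and x: "x \<in> A <+>\<^bsub>M\<^esub> B" for a x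
  proof -
    obtain u v where *: "u \<in> A" "v \<in> B" "x = u \<oplus>\<^bsub>M\<^esub> v" using x unfolding set_add_iff by blast
    then have "a \<odot>\<^bsub>M\<^esub> x = a \<odot>\<^bsub>M\<^esub> u \<oplus>\<^bsub>M\<^esub> a \<odot>\<^bsub>M\<^esub> v"
      using A(1) B(1) a by (simp add: subset_iff smult_r_distr)
    then show ?thesis using * A(4) B(4) a unfolding set_add_iff by blast
  qed
qed

lemma set_add_upper:
  assumes A: "submodule A R M" and B: "submodule B R M"
  shows "A \<subseteq> A <+>\<^bsub>M\<^esub> B" "B \<subseteq> A <+>\<^bsub>M\<^esub> B"
proof -
  note A = submoduleD[OF A] and B = submoduleD[OF B]
  show "A \<subseteq> A <+>\<^bsub>M\<^esub> B"
  proof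
    fix x assume "x \<in> A"
    then show "x \<in> A <+>\<^bsub>M\<^esub> B"
      using A(1) B(2) M.r_zero[of x] unfolding set_add_iff by (metis subsetD)
  qed
  show "B \<subseteq> A <+>\<^bsub>M\<^esub> B"
  proof
    fix x assume "x \<in> B"
    then show "x \<in> A <+>\<^bsub>M\<^esub> B"
      using B(1) A(2) M.l_zero[of x] unfolding set_add_iff by (metis subsetD)
  qed
qed

lemma set_add_least:
  assumes "submodule C R M" "A \<subseteq> C" "B \<subseteq> C"
  shows "A <+>\<^bsub>M\<^esub> B \<subseteq> C"
  using assms submoduleD(3)[OF assms(1)] unfolding subset_iff set_add_iff by blast

lemma set_add_mono: "A \<subseteq> A' \<Longrightarrow> B \<subseteq> B' \<Longrightarrow> A <+>\<^bsub>M\<^esub> B \<subseteq> A' <+>\<^bsub>M\<^esub> B'"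
  unfolding subset_iff set_add_iff by blast

lemma submodule_span: "S \<subseteq> carrier M \<Longrightarrow> submodule (mod_span R M S) R M"
  unfolding mod_span_def using submodule_carrier by (intro submodule_Inter) auto

lemma span_superset: "S \<subseteq> mod_span R M S"
  unfolding mod_span_def by auto

lemma span_least: "submodule N R M \<Longrightarrow> S \<subseteq> N \<Longrightarrow> mod_span R M S \<subseteq> N"
  unfolding mod_span_def by auto

lemma span_mono: "S \<subseteq> S' \<Longrightarrow> mod_span R M S \<subseteq> mod_span R M S'"
  unfolding mod_span_def by auto

lemma fg_submodule_submodule: "fg_submodule K R M \<Longrightarrow> submodule K R M"
  unfolding fg_submodule_def using submodule_span by auto

lemma left_module_sub_mod:
  assumes H: "submodule H R M"
  shows "left_module R (M\<lparr>carrier := H\<rparr>)"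
proof -
  interpret H: submodule H R M by fact
  note D = submoduleD[OF H]
  have am: "abelian_monoid (M\<lparr>carrier := H\<rparr>)"
    using comm_monoid.submonoid_is_comm_monoid[OF M.a_comm_monoid
        H.subgroup_is_submonoid]
    by (simp add: abelian_monoid_def)
  have cg: "comm_group (add_monoid (M\<lparr>carrier := H\<rparr>))"
    using H.subgroup_is_group[OF M.a_group] am
    by (simp add: comm_group_def abelian_monoid_def)
  show ?thesis
    by (intro left_module.intro left_module_axioms.intro abelian_group.intro
        abelian_group_axioms.intro R.ring_axioms am cg)
      (use D(1) in \<open>auto simp: smult_l_distr smult_r_distr smult_assoc subset_iff\<close>)
qed

lemma submodule_of_sub_mod:
  assumes H: "submodule H R M"
  shows "submodule A R (M\<lparr>carrier := H\<rparr>) \<longleftrightarrow> submodule A R M \<and> A \<subseteq> H"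
proof -
  interpret S: lmodule R "M\<lparr>carrier := H\<rparr>" using left_module_sub_mod[OF H] by (simp add: lmodule_def)
  show ?thesis
  proof
    assume A: "submodule A R (M\<lparr>carrier := H\<rparr>)"
    note D = S.submoduleD[OF A]
    have "submodule A R M"
      by (rule submoduleI) (use D submoduleD(1)[OF H] in auto)
    then show "submodule A R M \<and> A \<subseteq> H" using D(1) by auto
  next
    assume A: "submodule A R M \<and> A \<subseteq> H"
    then have A': "submodule A R M" by simp
    show "submodule A R (M\<lparr>carrier := H\<rparr>)"
      by (rule S.submoduleI) (use A submoduleD(1-4)[OF A'] in auto)
  qed
qed

end

text \<open>With cosets represented by chosen elements, the quotient has its elements in the type of \<open>V\<close>, so
  that a length function on modules over that type applies to it.\<close>

lemma quotient_module_exists: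
  fixes V :: "('r, 'm) module"
  assumes V: "left_module R V" and A: "submodule A R V"
  obtains Q :: "('r, 'm) module" and q where "left_module R Q" "q \<in> mod_hom R V Q"
    "q ` carrier V = carrier Q" "{x \<in> carrier V. q x = \<zero>\<^bsub>Q\<^esub>} = A"
proof -
  interpret V: lmodule R V using V by (simp add: lmodule_def)
  note A = V.submoduleD[OF A]
  define q where "q x = (SOME y. y \<in> carrier V \<and> y \<ominus>\<^bsub>V\<^esub> x \<in> A)" for x
  have q: "q x \<in> carrier V" "q x \<ominus>\<^bsub>V\<^esub> x \<in> A" if "x \<in> carrier V" for x
  proof -
    have "x \<in> carrier V \<and> x \<ominus>\<^bsub>V\<^esub> x \<in> A" using that A(2) by (simp add: V.M.minus_eq V.M.r_neg)
    then show "q x \<in> carrier V" "q x \<ominus>\<^bsub>V\<^esub> x \<in> A" unfolding q_def by (metis (mono_tags, lifting) someI_ex)+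
  qed
  have cong: "q x = q y" if "x \<in> carrier V" "y \<in> carrier V" "x \<ominus>\<^bsub>V\<^esub> y \<in> A" for x y
  proof -
    have "z \<ominus>\<^bsub>V\<^esub> x \<in> A \<longleftrightarrow> z \<ominus>\<^bsub>V\<^esub> y \<in> A" if z: "z \<in> carrier V" for z
    proof
      assume "z \<ominus>\<^bsub>V\<^esub> x \<in> A"
      then have "(z \<ominus>\<^bsub>V\<^esub> x) \<oplus>\<^bsub>V\<^esub> (x \<ominus>\<^bsub>V\<^esub> y) \<in> A" using that A(3) \<open>x \<ominus>\<^bsub>V\<^esub> y \<in> A\<close> by blast
      moreover have "(z \<ominus>\<^bsub>V\<^esub> x) \<oplus>\<^bsub>V\<^esub> (x \<ominus>\<^bsub>V\<^esub> y) = z \<ominus>\<^bsub>V\<^esub> y"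
        using z \<open>x \<in> carrier V\<close> \<open>y \<in> carrier V\<close>
        by (simp add: V.M.minus_eq V.M.a_assoc) (simp add: V.M.r_neg2 V.M.r_neg1)
      ultimately show "z \<ominus>\<^bsub>V\<^esub> y \<in> A" by simp
    next
      assume "z \<ominus>\<^bsub>V\<^esub> y \<in> A"
      then have "(z \<ominus>\<^bsub>V\<^esub> y) \<ominus>\<^bsub>V\<^esub> (x \<ominus>\<^bsub>V\<^esub> y) \<in> A" using that A(6) \<open>x \<ominus>\<^bsub>V\<^esub> y \<in> A\<close> by blast
      moreover have "(z \<ominus>\<^bsub>V\<^esub> y) \<ominus>\<^bsub>V\<^esub> (x \<ominus>\<^bsub>V\<^esub> y) = z \<ominus>\<^bsub>V\<^esub> x"
        using z \<open>x \<in> carrier V\<close> \<open>y \<in> carrier V\<close>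
        by (simp add: V.M.minus_eq V.M.minus_add V.M.a_assoc V.M.a_comm[of "\<ominus>\<^bsub>V\<^esub> x" y])
          (simp add: V.M.r_neg1)
      ultimately show "z \<ominus>\<^bsub>V\<^esub> x \<in> A" by simp
    qed
    then have "(\<lambda>z. z \<in> carrier V \<and> z \<ominus>\<^bsub>V\<^esub> x \<in> A) = (\<lambda>z. z \<in> carrier V \<and> z \<ominus>\<^bsub>V\<^esub> y \<in> A)" by auto
    then show ?thesis unfolding q_def by simp
  qed
  define Q :: "('r, 'm) module" where
    "Q = \<lparr>carrier = q ` carrier V, monoid.mult = monoid.mult V, one = one V,
      ring.zero = q \<zero>\<^bsub>V\<^esub>, ring.add = (\<lambda>x y. q (x \<oplus>\<^bsub>V\<^esub> y)), smult = (\<lambda>a x. q (a \<odot>\<^bsub>V\<^esub> x))\<rparr>"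
  have add: "q (x \<oplus>\<^bsub>V\<^esub> y) = q (q x \<oplus>\<^bsub>V\<^esub> q y)" if x: "x \<in> carrier V" and y: "y \<in> carrier V" for x y
  proof -
    have "(q x \<ominus>\<^bsub>V\<^esub> x) \<oplus>\<^bsub>V\<^esub> (q y \<ominus>\<^bsub>V\<^esub> y) \<in> A" using q x y A(3) by blast
    moreover have "(q x \<ominus>\<^bsub>V\<^esub> x) \<oplus>\<^bsub>V\<^esub> (q y \<ominus>\<^bsub>V\<^esub> y) = (q x \<oplus>\<^bsub>V\<^esub> q y) \<ominus>\<^bsub>V\<^esub> (x \<oplus>\<^bsub>V\<^esub> y)"
      using x y q(1)[OF x] q(1)[OF y] by (simp add: V.M.minus_eq V.M.minus_add V.M.a_ac)
    ultimately have "q (q x \<oplus>\<^bsub>V\<^esub> q y) = q (x \<oplus>\<^bsub>V\<^esub> y)"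
      using x y q by (intro cong) auto
    then show ?thesis by simp
  qed
  have smult: "q (a \<odot>\<^bsub>V\<^esub> x) = q (a \<odot>\<^bsub>V\<^esub> q x)" if x: "x \<in> carrier V" and a: "a \<in> carrier R" for x a
  proof -
    have "a \<odot>\<^bsub>V\<^esub> (q x \<ominus>\<^bsub>V\<^esub> x) \<in> A" using q x a A(4) by blast
    moreover have "a \<odot>\<^bsub>V\<^esub> (\<ominus>\<^bsub>V\<^esub> x) = \<ominus>\<^bsub>V\<^esub> (a \<odot>\<^bsub>V\<^esub> x)"
      using x a by (metis V.M.add.inv_closed V.M.l_neg V.M.minus_equality V.smult_closed V.smult_r_distr V.smult_zero_right)
    then have "a \<odot>\<^bsub>V\<^esub> (q x \<ominus>\<^bsub>V\<^esub> x) = a \<odot>\<^bsub>V\<^esub> q x \<ominus>\<^bsub>V\<^esub> a \<odot>\<^bsub>V\<^esub> x"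
      using x a q(1)[OF x] by (simp add: V.M.minus_eq V.smult_r_distr)
    ultimately have "q (a \<odot>\<^bsub>V\<^esub> q x) = q (a \<odot>\<^bsub>V\<^esub> x)"
      using x a q by (intro cong) auto
    then show ?thesis by simp
  qed
  have "left_module R Q"
    by (rule left_module_image[OF V, of Q q]) (use add smult in \<open>auto simp: Q_def\<close>)
  moreover have "q \<in> mod_hom R V Q"
    using add smult by (auto simp: mod_hom_def Q_def)
  moreover have "q ` carrier V = carrier Q" by (simp add: Q_def)
  moreover have "{x \<in> carrier V. q x = \<zero>\<^bsub>Q\<^esub>} = A"
  proof (intro subset_antisym subsetI)
    fix x assume "x \<in> {x \<in> carrier V. q x = \<zero>\<^bsub>Q\<^esub>}"
    then have x: "x \<in> carrier V" "q x = q \<zero>\<^bsub>V\<^esub>" by (auto simp: Q_def)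
    have "q x \<ominus>\<^bsub>V\<^esub> \<zero>\<^bsub>V\<^esub> \<in> A" using q(2)[of "\<zero>\<^bsub>V\<^esub>"] x by simp
    then have "q x \<in> A" using q(1)[OF x(1)] by (simp add: V.M.minus_eq V.neg_zero)
    then have "q x \<ominus>\<^bsub>V\<^esub> (q x \<ominus>\<^bsub>V\<^esub> x) \<in> A" using A(6) q(2) x(1) by blast
    then show "x \<in> A" using x(1) q(1)[OF x(1)]
      by (simp add: V.M.minus_eq V.M.minus_add V.M.r_neg2)
  next
    fix x assume x: "x \<in> A"
    then have "x \<in> carrier V" using A(1) by auto
    then show "x \<in> {x \<in> carrier V. q x = \<zero>\<^bsub>Q\<^esub>}"
      using cong[of x "\<zero>\<^bsub>V\<^esub>"] x by (simp add: Q_def V.M.minus_eq V.neg_zero)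
  qed
  ultimately show ?thesis by (rule that)
qed

locale left_module_hom = V: lmodule R V + W: lmodule R W
  for R :: "('r, 'c) ring_scheme" and V :: "('r, 'm) module" and W :: "('r, 'n) module" +
  fixes f :: "'m \<Rightarrow> 'n"
  assumes hom: "f \<in> mod_hom R V W"
begin

lemma closed [simp, intro]: "x \<in> carrier V \<Longrightarrow> f x \<in> carrier W"
  and add: "x \<in> carrier V \<Longrightarrow> y \<in> carrier V \<Longrightarrow> f (x \<oplus>\<^bsub>V\<^esub> y) = f x \<oplus>\<^bsub>W\<^esub> f y"
  and smult: "a \<in> carrier R \<Longrightarrow> x \<in> carrier V \<Longrightarrow> f (a \<odot>\<^bsub>V\<^esub> x) = a \<odot>\<^bsub>W\<^esub> f x"
  using hom by (auto simp: mod_hom_def)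

lemma zero [simp]: "f \<zero>\<^bsub>V\<^esub> = \<zero>\<^bsub>W\<^esub>"
  using smult[of "\<zero>\<^bsub>R\<^esub>" "\<zero>\<^bsub>V\<^esub>"] by simp

lemma submodule_image: assumes K: "submodule K R V" shows "submodule (f ` K) R W"
proof (rule W.submoduleI)
  note K = V.submoduleD[OF K]
  show "f ` K \<subseteq> carrier W" using K(1) by auto
  show "\<zero>\<^bsub>W\<^esub> \<in> f ` K" using K(2) zero by (metis imageI)
  show "x \<oplus>\<^bsub>W\<^esub> y \<in> f ` K" if xy: "x \<in> f ` K" "y \<in> f ` K" for x y
  proof -
    obtain u v where "u \<in> K" "v \<in> K" "x = f u" "y = f v" using xy by blast
    moreover from this have "f (u \<oplus>\<^bsub>V\<^esub> v) = x \<oplus>\<^bsub>W\<^esub> y" using K(1) add by auto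
    ultimately show ?thesis using K(3) by (metis imageI)
  qed
  show "a \<odot>\<^bsub>W\<^esub> x \<in> f ` K" if a: "a \<in> carrier R" and x: "x \<in> f ` K" for a x
  proof -
    obtain u where "u \<in> K" "x = f u" using x by blast
    moreover from this have "f (a \<odot>\<^bsub>V\<^esub> u) = a \<odot>\<^bsub>W\<^esub> x" using K(1) a smult by auto
    ultimately show ?thesis using K(4) a by (metis imageI)
  qed
qed

lemma submodule_preimage: assumes N: "submodule N R W" shows "submodule {x \<in> carrier V. f x \<in> N} R V"
  by (rule V.submoduleI) (use W.submoduleD[OF N] add smult in auto)

lemma submodule_kernel: "submodule {x \<in> carrier V. f x = \<zero>\<^bsub>W\<^esub>} R V"
  using submodule_preimage[OF W.submodule_zero] by simp

lemma span_image:
  assumes S: "S \<subseteq> carrier V"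
  shows "f ` mod_span R V S = mod_span R W (f ` S)"
proof
  have S': "f ` S \<subseteq> carrier W" using S by auto
  have "mod_span R V S \<subseteq> {x \<in> carrier V. f x \<in> mod_span R W (f ` S)}"
    using S W.span_superset[of "f ` S"] by (intro V.span_least submodule_preimage W.submodule_span S') auto
  then show "f ` mod_span R V S \<subseteq> mod_span R W (f ` S)" by auto
  show "mod_span R W (f ` S) \<subseteq> f ` mod_span R V S"
    using V.span_superset[of S] by (intro W.span_least submodule_image V.submodule_span S) auto
qed

lemma restrict_hom:
  assumes "submodule K R V" "submodule N R W" "f ` K \<subseteq> N"
  shows "f \<in> mod_hom R (sub_mod V K) (sub_mod W N)"
  using assms(3) V.submoduleD(1)[OF assms(1)] hom by (auto simp: mod_hom_def subset_iff)

end

section \<open>Lengths of submodules\<close>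

locale length_on_modules = R?: ring R
  for R :: "('r, 'c) ring_scheme" +
  fixes L :: "('r, 'm) module \<Rightarrow> ennreal"
  assumes length_L: "length_function R (R_Mod R) L"
begin

abbreviation len :: "('r, 'm) module \<Rightarrow> 'm set \<Rightarrow> ennreal" where
  "len V K \<equiv> L (sub_mod V K)"

text \<open>All estimates take place below submodules of finite length, where real numbers avoid the
  subtraction problems of extended numbers.\<close>

definition rlen :: "('r, 'm) module \<Rightarrow> 'm set \<Rightarrow> real" where
  "rlen V K = enn2real (len V K)"

definition fin_len :: "('r, 'm) module \<Rightarrow> 'm set \<Rightarrow> bool" where
  "fin_len V K \<longleftrightarrow> submodule K R V \<and> len V K < \<infinity>"

lemma rlen_nonneg [simp]: "0 \<le> rlen V K"
  by (simp add: rlen_def)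

lemma ennreal_rlen: "fin_len V K \<Longrightarrow> ennreal (rlen V K) = len V K"
  by (simp add: fin_len_def rlen_def)

lemma fin_lenD: "fin_len V K \<Longrightarrow> submodule K R V"
  by (simp add: fin_len_def)

text \<open>Additivity enters the proof through the restriction of a homomorphism to a submodule \<open>K\<close>,
  which splits the length of \<open>K\<close> into those of its kernel and its image.\<close>

lemma len_exact:
  fixes V W :: "('r, 'm) module"
  assumes "left_module R V" "left_module R W" "f \<in> mod_hom R V W" "submodule K R V"
  shows "len V K = len V {x \<in> K. f x = \<zero>\<^bsub>W\<^esub>} + len W (f ` K)"
proof -
  interpret f: left_module_hom R V W f
    using assms by (simp add: left_module_hom_def left_module_hom_axioms_def lmodule_def)
  have "{x \<in> K. f x = \<zero>\<^bsub>W\<^esub>} = K \<inter> {x \<in> carrier V. f x = \<zero>\<^bsub>W\<^esub>}"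
    using f.V.submoduleD(1)[OF assms(4)] by auto
  then have ker: "submodule {x \<in> K. f x = \<zero>\<^bsub>W\<^esub>} R V"
    using f.V.submodule_Int[OF assms(4) f.submodule_kernel] by simp
  have im: "submodule (f ` K) R W" by (rule f.submodule_image) fact
  have "short_exact R (sub_mod V {x \<in> K. f x = \<zero>\<^bsub>W\<^esub>}) id (sub_mod V K) f (sub_mod W (f ` K))"
    using f.restrict_hom[OF assms(4) im subset_refl] f.V.submoduleD(1)[OF assms(4)]
    by (auto simp: short_exact_def mod_hom_def)
  moreover have "sub_mod V {x \<in> K. f x = \<zero>\<^bsub>W\<^esub>} \<in> R_Mod R" "sub_mod V K \<in> R_Mod R" "sub_mod W (f ` K) \<in> R_Mod R"
    using f.V.left_module_sub_mod ker assms(4) f.W.left_module_sub_mod im by (auto simp: R_Mod_def)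
  ultimately show ?thesis
    using length_L unfolding length_function_def additive_on_def by blast
qed

lemma len_zero:
  assumes "left_module R V"
  shows "len V {\<zero>\<^bsub>V\<^esub>} = 0"
proof -
  interpret V: lmodule R V using assms by (simp add: lmodule_def)
  have "sub_mod V {\<zero>\<^bsub>V\<^esub>} \<in> R_Mod R"
    using V.left_module_sub_mod[OF V.submodule_zero] by (simp add: R_Mod_def)
  then show ?thesis
    using length_L unfolding length_function_def additive_on_def by simp
qed

lemma len_image_inj:
  fixes V W :: "('r, 'm) module"
  assumes "left_module R V" "left_module R W" "f \<in> mod_hom R V W" "submodule K R V" "inj_on f K"
  shows "len W (f ` K) = len V K"
proof -
  interpret f: left_module_hom R V W f
    using assms by (simp add: left_module_hom_def left_module_hom_axioms_def lmodule_def)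
  have "{x \<in> K. f x = \<zero>\<^bsub>W\<^esub>} = {\<zero>\<^bsub>V\<^esub>}"
  proof (intro subset_antisym subsetI)
    fix x assume "x \<in> {x \<in> K. f x = \<zero>\<^bsub>W\<^esub>}"
    then have "x \<in> K" "f x = f \<zero>\<^bsub>V\<^esub>" by simp_all
    then show "x \<in> {\<zero>\<^bsub>V\<^esub>}"
      using inj_onD[OF assms(5), of x "\<zero>\<^bsub>V\<^esub>"] f.V.submoduleD(2)[OF assms(4)] by simp
  qed (use f.V.submoduleD(2)[OF assms(4)] in simp)
  then show ?thesis using len_exact[OF assms(1-4)] len_zero[OF assms(1)] by simp
qed

lemma len_image_le:
  fixes V W :: "('r, 'm) module"
  assumes "left_module R V" "left_module R W" "f \<in> mod_hom R V W" "submodule K R V"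
  shows "len W (f ` K) \<le> len V K"
  using len_exact[OF assms] by simp

lemma len_mono:
  assumes V: "left_module R V" and A: "submodule A R V" and B: "submodule B R V" and "A \<subseteq> B"
  shows "len V A \<le> len V B"
proof -
  interpret V: lmodule R V using V by (simp add: lmodule_def)
  obtain Q :: "('r, 'm) module" and q where Q: "left_module R Q" "q \<in> mod_hom R V Q"
    "q ` carrier V = carrier Q" "{x \<in> carrier V. q x = \<zero>\<^bsub>Q\<^esub>} = A"
    by (rule quotient_module_exists[OF V A])
  have "{x \<in> B. q x = \<zero>\<^bsub>Q\<^esub>} = A"
    using Q(4) \<open>A \<subseteq> B\<close> V.submoduleD(1)[OF B] by auto
  then show ?thesis using len_exact[OF V Q(1,2) B] by simp
qed

text \<open>The quotient \<open>(A + B) / B\<close> is isomorphic to \<open>A / (A \<inter> B)\<close>.\<close>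

lemma len_modular:
  assumes V: "left_module R V" and A: "submodule A R V" and B: "submodule B R V"
  shows "len V (A <+>\<^bsub>V\<^esub> B) + len V (A \<inter> B) = len V A + len V B"
proof -
  interpret V: lmodule R V using V by (simp add: lmodule_def)
  obtain Q :: "('r, 'm) module" and q where Q: "left_module R Q" "q \<in> mod_hom R V Q"
    "q ` carrier V = carrier Q" "{x \<in> carrier V. q x = \<zero>\<^bsub>Q\<^esub>} = B"
    by (rule quotient_module_exists[OF V B])
  interpret q: left_module_hom R V Q q
    using Q V by (simp add: left_module_hom_def left_module_hom_axioms_def lmodule_def)
  have sub: "submodule (A <+>\<^bsub>V\<^esub> B) R V" by (rule V.submodule_add[OF A B])
  have kerA: "{x \<in> A. q x = \<zero>\<^bsub>Q\<^esub>} = A \<inter> B"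
    using Q(4) V.submoduleD(1)[OF A] by auto
  have kerAB: "{x \<in> A <+>\<^bsub>V\<^esub> B. q x = \<zero>\<^bsub>Q\<^esub>} = B"
    using Q(4) V.submoduleD(1)[OF sub] V.set_add_upper(2)[OF A B] by auto
  have im: "q ` (A <+>\<^bsub>V\<^esub> B) = q ` A"
  proof
    show "q ` (A <+>\<^bsub>V\<^esub> B) \<subseteq> q ` A"
    proof clarify
      fix z assume "z \<in> A <+>\<^bsub>V\<^esub> B"
      then obtain a b where ab: "a \<in> A" "b \<in> B" "z = a \<oplus>\<^bsub>V\<^esub> b" unfolding V.set_add_iff by blast
      then have c: "a \<in> carrier V" "b \<in> carrier V" "q b = \<zero>\<^bsub>Q\<^esub>"
        using V.submoduleD(1)[OF A] Q(4) by auto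
      then have "q z = q a" using ab by (simp add: q.add)
      then show "q z \<in> q ` A" using ab by simp
    qed
    show "q ` A \<subseteq> q ` (A <+>\<^bsub>V\<^esub> B)" using V.set_add_upper(1)[OF A B] by auto
  qed
  show ?thesis
    using len_exact[OF V Q(1,2) sub] len_exact[OF V Q(1,2) A]
    unfolding kerA kerAB im by (simp add: ac_simps)
qed

lemma len_directed_Union:
  assumes V: "left_module R V" and "\<D> \<noteq> {}" "\<And>Y. Y \<in> \<D> \<Longrightarrow> submodule Y R V"
    "\<And>Y Z. Y \<in> \<D> \<Longrightarrow> Z \<in> \<D> \<Longrightarrow> \<exists>W\<in>\<D>. Y \<subseteq> W \<and> Z \<subseteq> W"
  shows "len V (\<Union>\<D>) = (SUP Y\<in>\<D>. len V Y)"
proof -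
  interpret V: lmodule R V using V by (simp add: lmodule_def)
  have sub: "submodule (\<Union>\<D>) R V" by (rule V.submodule_directed_Union[OF assms(2-4)])
  then have "sub_mod V (\<Union>\<D>) \<in> R_Mod R" using V.left_module_sub_mod by (simp add: R_Mod_def)
  moreover have "\<forall>Y\<in>\<D>. submodule Y R (sub_mod V (\<Union>\<D>))"
    using assms(3) V.submodule_of_sub_mod[OF sub] by auto
  moreover have "upper_continuous_on R (R_Mod R) L"
    using length_L by (simp add: length_function_def)
  ultimately have "L (sub_mod V (\<Union>\<D>)) = (SUP Y\<in>\<D>. L (sub_mod (sub_mod V (\<Union>\<D>)) Y))"
    unfolding upper_continuous_on_def
    by (elim ballE[of _ _ "sub_mod V (\<Union>\<D>)"] allE[of _ \<D>] impE) (use assms(2,4) in auto)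
  then show ?thesis by simp
qed

lemma len_Int_directed_Union:
  assumes V: "left_module R V" and K: "submodule K R V"
    and D: "\<D> \<noteq> {}" "\<And>Y. Y \<in> \<D> \<Longrightarrow> submodule Y R V"
      "\<And>Y Z. Y \<in> \<D> \<Longrightarrow> Z \<in> \<D> \<Longrightarrow> \<exists>W\<in>\<D>. Y \<subseteq> W \<and> Z \<subseteq> W"
    and "K \<subseteq> \<Union>\<D>"
  shows "len V K = (SUP Y\<in>\<D>. len V (K \<inter> Y))"
proof -
  interpret V: lmodule R V using V by (simp add: lmodule_def)
  have "len V (\<Union>((\<inter>) K ` \<D>)) = (SUP Y\<in>(\<inter>) K ` \<D>. len V Y)"
  proof (rule len_directed_Union[OF V])
    show "(\<inter>) K ` \<D> \<noteq> {}" using D(1) by simp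
    show "submodule Y R V" if "Y \<in> (\<inter>) K ` \<D>" for Y
      using that D(2) V.submodule_Int[OF K] by auto
    show "\<exists>W\<in>(\<inter>) K ` \<D>. Y \<subseteq> W \<and> Z \<subseteq> W" if YZ: "Y \<in> (\<inter>) K ` \<D>" "Z \<in> (\<inter>) K ` \<D>" for Y Z
    proof -
      obtain Y' Z' where "Y' \<in> \<D>" "Z' \<in> \<D>" "Y = K \<inter> Y'" "Z = K \<inter> Z'" using YZ by auto
      then show ?thesis using D(3)[of Y' Z'] by auto
    qed
  qed
  moreover have "\<Union>((\<inter>) K ` \<D>) = K" using \<open>K \<subseteq> \<Union>\<D>\<close> by auto
  ultimately show ?thesis by (simp add: image_image)
qed

text \<open>This family presents \<open>K\<close> as a directed union, to which upper continuity applies.\<close>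

lemma directed_fg:
  assumes V: "left_module R V" and K: "submodule K R V"
  defines "\<D> \<equiv> {N. fg_submodule N R V \<and> N \<subseteq> K}"
  shows "\<D> \<noteq> {}" "\<And>Y. Y \<in> \<D> \<Longrightarrow> submodule Y R V"
    "\<And>Y Z. Y \<in> \<D> \<Longrightarrow> Z \<in> \<D> \<Longrightarrow> \<exists>W\<in>\<D>. Y \<subseteq> W \<and> Z \<subseteq> W"
    "K = \<Union>\<D>"
proof -
  interpret V: lmodule R V using V by (simp add: lmodule_def)
  note KD = V.submoduleD[OF K]
  have fg: "mod_span R V S \<in> \<D>" if "finite S" "S \<subseteq> K" for S
    using that KD(1) V.span_least[OF K, of S] by (auto simp: \<D>_def fg_submodule_def)
  show "\<D> \<noteq> {}" using fg[of "{}"] by auto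
  show "submodule Y R V" if "Y \<in> \<D>" for Y
    using that V.fg_submodule_submodule by (auto simp: \<D>_def)
  show "\<exists>W\<in>\<D>. Y \<subseteq> W \<and> Z \<subseteq> W" if YZ: "Y \<in> \<D>" "Z \<in> \<D>" for Y Z
  proof -
    obtain S T where "finite S" "Y = mod_span R V S" "finite T" "Z = mod_span R V T"
      using YZ by (auto simp: \<D>_def fg_submodule_def)
    moreover from this have "S \<subseteq> K" "T \<subseteq> K"
      using YZ V.span_superset[of S] V.span_superset[of T] by (auto simp: \<D>_def)
    ultimately show ?thesis
      using fg[of "S \<union> T"] V.span_mono[of S "S \<union> T"] V.span_mono[of T "S \<union> T"] by auto
  qed
  have "x \<in> \<Union>\<D>" if "x \<in> K" for x
    using fg[of "{x}"] V.span_superset[of "{x}"] that by auto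
  then show "K = \<Union>\<D>" by (auto simp: \<D>_def)
qed

lemma len_fg:
  assumes V: "left_module R V" and K: "submodule K R V"
  shows "len V K = (SUP N\<in>{N. fg_submodule N R V \<and> N \<subseteq> K}. len V N)"
proof -
  note D = directed_fg[OF V K]
  have "len V (\<Union>{N. fg_submodule N R V \<and> N \<subseteq> K}) = (SUP N\<in>{N. fg_submodule N R V \<and> N \<subseteq> K}. len V N)"
    by (rule len_directed_Union[OF V]) (fact D)+
  then show ?thesis using D(4) by simp
qed

lemma enn2real_add: "a < \<infinity> \<Longrightarrow> b < \<infinity> \<Longrightarrow> enn2real (a + b) = enn2real a + enn2real b"
  for a b :: ennreal
  by (cases a; cases b) (auto simp flip: ennreal_plus)

lemma SUP_approx_real:
  fixes f :: "'x \<Rightarrow> ennreal"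
  assumes "(SUP y\<in>D. f y) < \<infinity>" "D \<noteq> {}" "0 < \<epsilon>"
  obtains y where "y \<in> D" "enn2real (SUP y\<in>D. f y) \<le> enn2real (f y) + \<epsilon>"
proof -
  have "\<exists>y\<in>D. (SUP y\<in>D. f y) < f y + ennreal \<epsilon>"
    by (rule SUP_approx_ennreal[OF \<open>0 < \<epsilon>\<close> \<open>D \<noteq> {}\<close> refl]) (use assms(1) in \<open>metis order_less_irrefl\<close>)
  then obtain y where y: "y \<in> D" "(SUP y\<in>D. f y) < f y + ennreal \<epsilon>" by blast
  have fin: "f y < \<infinity>" using SUP_upper[OF y(1), of f] assms(1) by (auto intro: le_less_trans)
  have "enn2real (SUP y\<in>D. f y) \<le> enn2real (f y + ennreal \<epsilon>)"
    using y(2) fin by (intro enn2real_mono) (auto simp: less_top)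
  also have "\<dots> = enn2real (f y) + \<epsilon>"
    using fin assms(3) by (subst enn2real_add) auto
  finally show ?thesis using that y(1) by blast
qed

lemma fin_len_subset:
  assumes V: "left_module R V" and "fin_len V B" "submodule A R V" "A \<subseteq> B"
  shows "fin_len V A"
  using len_mono[OF V assms(3) fin_lenD[OF assms(2)] assms(4)] assms(2,3)
  by (auto simp: fin_len_def intro: le_less_trans)

lemma fin_len_zero: assumes V: "left_module R V" shows "fin_len V {\<zero>\<^bsub>V\<^esub>}"
proof -
  interpret V: lmodule R V using V by (simp add: lmodule_def)
  show ?thesis using len_zero[OF V] V.submodule_zero by (simp add: fin_len_def)
qed

lemma rlen_zero: "left_module R V \<Longrightarrow> rlen V {\<zero>\<^bsub>V\<^esub>} = 0"
  by (simp add: rlen_def len_zero)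

lemma rlen_mono:
  assumes "left_module R V" "submodule A R V" "fin_len V B" "A \<subseteq> B"
  shows "rlen V A \<le> rlen V B"
  unfolding rlen_def using len_mono[of V A B] assms by (intro enn2real_mono) (auto simp: fin_len_def)

lemma fin_len_Int:
  assumes "left_module R V" "fin_len V A" "submodule B R V"
  shows "fin_len V (A \<inter> B)"
  using assms fin_len_subset[of V A "A \<inter> B"] lmodule.submodule_Int[of R V A B]
  by (auto simp: fin_len_def lmodule_def)

lemma fin_len_add:
  assumes "left_module R V" "fin_len V A" "fin_len V B"
  shows "fin_len V (A <+>\<^bsub>V\<^esub> B)"
proof -
  have "len V (A <+>\<^bsub>V\<^esub> B) \<le> len V A + len V B"
    using len_modular[OF assms(1) fin_lenD[OF assms(2)] fin_lenD[OF assms(3)]] by (metis add_increasing2 order_refl zero_le)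
  also have "\<dots> < \<infinity>" using assms by (simp add: fin_len_def)
  finally show ?thesis
    using assms lmodule.submodule_add[of R V A B] by (auto simp: fin_len_def lmodule_def)
qed

lemma rlen_modular:
  assumes "left_module R V" "fin_len V A" "fin_len V B"
  shows "rlen V (A <+>\<^bsub>V\<^esub> B) + rlen V (A \<inter> B) = rlen V A + rlen V B"
proof -
  have "ennreal (rlen V (A <+>\<^bsub>V\<^esub> B) + rlen V (A \<inter> B)) = ennreal (rlen V A + rlen V B)"
    using len_modular[OF assms(1) fin_lenD[OF assms(2)] fin_lenD[OF assms(3)]] assms
    by (simp add: ennreal_rlen fin_len_add fin_len_Int fin_lenD)
  then show ?thesis by (subst (asm) ennreal_inj) auto
qed

lemma rlen_add_le:
  assumes "left_module R V" "fin_len V A" "fin_len V B"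
  shows "rlen V (A <+>\<^bsub>V\<^esub> B) \<le> rlen V A + rlen V B"
  using rlen_modular[OF assms] rlen_nonneg[of V "A \<inter> B"] by linarith

lemma rlen_submodular:
  assumes V: "left_module R V" and "fin_len V A" "fin_len V B"
    and "submodule C R V" "C \<subseteq> A \<inter> B" "submodule D R V" "D \<subseteq> A <+>\<^bsub>V\<^esub> B"
  shows "rlen V D + rlen V C \<le> rlen V A + rlen V B"
proof -
  have "rlen V C \<le> rlen V (A \<inter> B)"
    using assms fin_len_Int[OF V] by (intro rlen_mono) (auto simp: fin_lenD)
  moreover have "rlen V D \<le> rlen V (A <+>\<^bsub>V\<^esub> B)"
    using assms fin_len_add[OF V] by (intro rlen_mono) auto
  ultimately show ?thesis using rlen_modular[OF assms(1-3)] by linarith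
qed

text \<open>Enlarging both summands enlarges the sum by at most the two increments: the intersection
  only grows.\<close>

lemma rlen_add_increment:
  assumes V: "left_module R V" and A: "submodule A R V" "fin_len V A'" "A \<subseteq> A'"
    and B: "submodule B R V" "fin_len V B'" "B \<subseteq> B'"
  shows "rlen V (A' <+>\<^bsub>V\<^esub> B') - rlen V (A <+>\<^bsub>V\<^esub> B)
    \<le> (rlen V A' - rlen V A) + (rlen V B' - rlen V B)"
proof -
  have "fin_len V A" "fin_len V B" using fin_len_subset[OF V] A B by auto
  moreover have "rlen V (A \<inter> B) \<le> rlen V (A' \<inter> B')"
    using fin_len_Int[OF V A(2), of B'] fin_len_Int[OF V \<open>fin_len V A\<close>, of B] A B
    by (intro rlen_mono[OF V]) (auto simp: fin_lenD)
  ultimately show ?thesis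
    using rlen_modular[OF V, of A B] rlen_modular[OF V A(2) B(2)] by linarith
qed

lemma fin_len_image:
  fixes V W :: "('r, 'm) module"
  assumes "left_module R V" "left_module R W" "f \<in> mod_hom R V W" "fin_len V K"
  shows "fin_len W (f ` K)"
proof -
  interpret f: left_module_hom R V W f
    using assms by (simp add: left_module_hom_def left_module_hom_axioms_def lmodule_def)
  show ?thesis
    using len_image_le[OF assms(1-3) fin_lenD[OF assms(4)]] f.submodule_image[OF fin_lenD[OF assms(4)]] assms(4)
    by (auto simp: fin_len_def intro: le_less_trans)
qed

lemma rlen_exact:
  fixes V W :: "('r, 'm) module"
  assumes "left_module R V" "left_module R W" "f \<in> mod_hom R V W" "fin_len V K"
  shows "rlen V K = rlen V {x \<in> K. f x = \<zero>\<^bsub>W\<^esub>} + rlen W (f ` K)"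
proof -
  have "len V K = len V {x \<in> K. f x = \<zero>\<^bsub>W\<^esub>} + len W (f ` K)"
    using len_exact[OF assms(1-3)] assms(4) by (simp add: fin_len_def)
  moreover from this have "len V {x \<in> K. f x = \<zero>\<^bsub>W\<^esub>} < \<infinity>" "len W (f ` K) < \<infinity>"
    using assms(4) by (auto simp: fin_len_def)
  ultimately show ?thesis by (simp add: rlen_def enn2real_add)
qed

lemma rlen_approx_directed:
  assumes V: "left_module R V" and K: "fin_len V K"
    and D: "\<D> \<noteq> {}" "\<And>Y. Y \<in> \<D> \<Longrightarrow> submodule Y R V"
      "\<And>Y Z. Y \<in> \<D> \<Longrightarrow> Z \<in> \<D> \<Longrightarrow> \<exists>W\<in>\<D>. Y \<subseteq> W \<and> Z \<subseteq> W"
    and "K \<subseteq> \<Union>\<D>" and "0 < \<epsilon>"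
  obtains Y where "Y \<in> \<D>" "rlen V K \<le> rlen V (K \<inter> Y) + \<epsilon>"
proof -
  have eq: "len V K = (SUP Y\<in>\<D>. len V (K \<inter> Y))"
    by (rule len_Int_directed_Union[OF V fin_lenD[OF K]]) (fact assms)+
  then have "(SUP Y\<in>\<D>. len V (K \<inter> Y)) < \<infinity>" using K by (simp add: fin_len_def)
  from SUP_approx_real[OF this D(1) \<open>0 < \<epsilon>\<close>] show ?thesis
    using that eq unfolding rlen_def by metis
qed

end

section \<open>Modules over a crossed product\<close>

lemma restrict_scalars_simps [simp]:
  "carrier (restrict_scalars \<phi> M) = carrier M"
  "ring.add (restrict_scalars \<phi> M) = ring.add M"
  "ring.zero (restrict_scalars \<phi> M) = ring.zero M"
  "module.smult (restrict_scalars \<phi> M) a x = \<phi> a \<odot>\<^bsub>M\<^esub> x"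
  by (simp_all add: restrict_scalars_def)

lemma left_module_restrict_scalars:
  assumes "ring R" "left_module S M" "\<phi> \<in> ring_hom R S"
  shows "left_module R (restrict_scalars \<phi> M)"
proof -
  interpret R: ring R by fact
  interpret M: left_module S M by fact
  note h = ring_hom_memE[OF assms(3)]
  show ?thesis
    by (intro left_module.intro left_module_axioms.intro abelian_groupI R.ring_axioms)
      (auto simp: h M.smult_l_distr M.smult_r_distr M.smult_assoc M.M.a_assoc
        intro: M.M.a_comm M.M.l_neg bexI[of _ "\<ominus>\<^bsub>M\<^esub> _"])
qed

context crossed_system
begin

abbreviation RG :: "('g \<Rightarrow> 'r) ring" where
  "RG \<equiv> crossed_product R G \<sigma> \<rho>"

abbreviation act :: "('g \<Rightarrow> 'r, 'x) module \<Rightarrow> 'g \<Rightarrow> 'x \<Rightarrow> 'x" where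
  "act M g x \<equiv> cp_monom R g \<one>\<^bsub>R\<^esub> \<odot>\<^bsub>M\<^esub> x"

abbreviation base :: "('g \<Rightarrow> 'r, 'x) module \<Rightarrow> ('r, 'x) module" where
  "base M \<equiv> base_mod R G M"

lemma sigma_hom: "g \<in> carrier G \<Longrightarrow> \<sigma> g \<in> ring_hom R R"
  using sigma_aut by (simp add: ring_iso_def)

lemma sigma_closed [simp, intro]: "g \<in> carrier G \<Longrightarrow> r \<in> carrier R \<Longrightarrow> \<sigma> g r \<in> carrier R"
  using ring_hom_memE(1)[OF sigma_hom] by auto

lemma sigma_one_eq [simp]: "g \<in> carrier G \<Longrightarrow> \<sigma> g \<one>\<^bsub>R\<^esub> = \<one>\<^bsub>R\<^esub>"
  using ring_hom_memE(4)[OF sigma_hom] by auto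

lemma sigma_zero_eq [simp]: "g \<in> carrier G \<Longrightarrow> \<sigma> g \<zero>\<^bsub>R\<^esub> = \<zero>\<^bsub>R\<^esub>"
  using ring_hom_zero[OF sigma_hom R.ring_axioms R.ring_axioms] by auto

lemma sigma_surj:
  assumes "g \<in> carrier G" "r \<in> carrier R"
  shows "\<exists>s\<in>carrier R. \<sigma> g s = r"
proof -
  have "r \<in> \<sigma> g ` carrier R" using sigma_aut assms unfolding ring_iso_def bij_betw_def by blast
  then show ?thesis by blast
qed

lemma rho_closed [simp, intro]: "g \<in> carrier G \<Longrightarrow> h \<in> carrier G \<Longrightarrow> \<rho> g h \<in> carrier R"
  using rho_unit R.Units_closed by auto

lemma rho_inv:
  assumes "g \<in> carrier G" "h \<in> carrier G"
  obtains u where "u \<in> carrier R" "u \<otimes>\<^bsub>R\<^esub> \<rho> g h = \<one>\<^bsub>R\<^esub>" "\<rho> g h \<otimes>\<^bsub>R\<^esub> u = \<one>\<^bsub>R\<^esub>"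
  using rho_unit[OF assms] that unfolding Units_def by auto

lemma cp_monom_closed [simp, intro]:
  assumes "g \<in> carrier G" "r \<in> carrier R"
  shows "cp_monom R g r \<in> carrier RG"
proof -
  have "cp_supp R (cp_monom R g r) \<subseteq> {g}" by (auto simp: cp_supp_def cp_monom_def)
  then show ?thesis
    using assms finite_subset[of _ "{g}"] by (auto simp: crossed_product_def cp_monom_def)
qed

lemma cp_monom_mult:
  assumes g: "g \<in> carrier G" and h: "h \<in> carrier G" and r: "r \<in> carrier R" and s: "s \<in> carrier R"
  shows "cp_monom R g r \<otimes>\<^bsub>RG\<^esub> cp_monom R h s = cp_monom R (g \<otimes>\<^bsub>G\<^esub> h) (r \<otimes>\<^bsub>R\<^esub> \<sigma> g s \<otimes>\<^bsub>R\<^esub> \<rho> g h)"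
proof (rule ext)
  fix x
  let ?P = "{(g', h'). g' \<in> cp_supp R (cp_monom R g r) \<and> h' \<in> cp_supp R (cp_monom R h s) \<and> g' \<otimes>\<^bsub>G\<^esub> h' = x}"
  have eq: "(cp_monom R g r \<otimes>\<^bsub>RG\<^esub> cp_monom R h s) x =
    finsum R (\<lambda>(g', h'). cp_monom R g r g' \<otimes>\<^bsub>R\<^esub> \<sigma> g' (cp_monom R h s h') \<otimes>\<^bsub>R\<^esub> \<rho> g' h') ?P"
    by (simp add: crossed_product_def)
  show "(cp_monom R g r \<otimes>\<^bsub>RG\<^esub> cp_monom R h s) x = cp_monom R (g \<otimes>\<^bsub>G\<^esub> h) (r \<otimes>\<^bsub>R\<^esub> \<sigma> g s \<otimes>\<^bsub>R\<^esub> \<rho> g h) x"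
  proof (cases "r = \<zero>\<^bsub>R\<^esub> \<or> s = \<zero>\<^bsub>R\<^esub> \<or> g \<otimes>\<^bsub>G\<^esub> h \<noteq> x")
    case True
    then have "?P = {}" by (auto simp: cp_supp_def cp_monom_def split: if_splits)
    then have "(cp_monom R g r \<otimes>\<^bsub>RG\<^esub> cp_monom R h s) x = \<zero>\<^bsub>R\<^esub>" unfolding eq by (simp only: R.finsum_empty)
    moreover have "cp_monom R (g \<otimes>\<^bsub>G\<^esub> h) (r \<otimes>\<^bsub>R\<^esub> \<sigma> g s \<otimes>\<^bsub>R\<^esub> \<rho> g h) x = \<zero>\<^bsub>R\<^esub>"
      using True g h r s by (auto simp: cp_monom_def)
    ultimately show ?thesis by simp
  next
    case False
    then have "?P = {(g, h)}" by (auto simp: cp_supp_def cp_monom_def split: if_splits)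
    moreover have "finsum R (\<lambda>(g', h'). cp_monom R g r g' \<otimes>\<^bsub>R\<^esub> \<sigma> g' (cp_monom R h s h') \<otimes>\<^bsub>R\<^esub> \<rho> g' h') {(g, h)}
      = r \<otimes>\<^bsub>R\<^esub> \<sigma> g s \<otimes>\<^bsub>R\<^esub> \<rho> g h"
      using g h r s by (simp add: cp_monom_def)
    ultimately show ?thesis using False unfolding eq by (simp add: cp_monom_def)
  qed
qed

lemma cp_monom_add:
  "r \<in> carrier R \<Longrightarrow> s \<in> carrier R \<Longrightarrow> cp_monom R g r \<oplus>\<^bsub>RG\<^esub> cp_monom R g s = cp_monom R g (r \<oplus>\<^bsub>R\<^esub> s)"
  by (auto simp: crossed_product_def cp_monom_def)

lemma cp_one: "\<one>\<^bsub>RG\<^esub> = cp_monom R \<one>\<^bsub>G\<^esub> \<one>\<^bsub>R\<^esub>"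
  by (simp add: crossed_product_def)

lemma cp_monom_hom: "cp_monom R \<one>\<^bsub>G\<^esub> \<in> ring_hom R RG"
  by (rule ring_hom_memI) (simp_all add: cp_monom_mult cp_monom_add cp_one rho_one_left sigma_one)

lemma monom_eq_scalar_act:
  "g \<in> carrier G \<Longrightarrow> r \<in> carrier R \<Longrightarrow>
    cp_monom R g r = cp_monom R \<one>\<^bsub>G\<^esub> r \<otimes>\<^bsub>RG\<^esub> cp_monom R g \<one>\<^bsub>R\<^esub>"
  by (simp add: cp_monom_mult sigma_one rho_one_left)

lemma base_hom: "f \<in> mod_hom RG M N \<Longrightarrow> f \<in> mod_hom R (base M) (base N)"
  by (simp add: mod_hom_def)

lemma hom_act: "f \<in> mod_hom RG M N \<Longrightarrow> g \<in> carrier G \<Longrightarrow> x \<in> carrier M \<Longrightarrow> f (act M g x) = act N g (f x)"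
  by (simp add: mod_hom_def)

end

locale crossed_module = crossed_system R G \<sigma> \<rho> + M: lmodule "crossed_product R G \<sigma> \<rho>" M
  for R :: "('r, 'c) ring_scheme" and G :: "('g, 'd) monoid_scheme"
    and \<sigma> :: "'g \<Rightarrow> 'r \<Rightarrow> 'r" and \<rho> :: "'g \<Rightarrow> 'g \<Rightarrow> 'r"
    and M :: "('g \<Rightarrow> 'r, 'm) module"
begin

abbreviation B :: "('r, 'm) module" where "B \<equiv> base M"

lemma left_module_base: "left_module R B"
  by (rule left_module_restrict_scalars[OF R.ring_axioms M.left_module_axioms cp_monom_hom])

sublocale B: lmodule R "base_mod R G M"
  using left_module_base by (simp add: lmodule_def)

lemma act_closed [simp, intro]: "g \<in> carrier G \<Longrightarrow> x \<in> carrier M \<Longrightarrow> act M g x \<in> carrier M"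
  by simp

lemma act_add: "g \<in> carrier G \<Longrightarrow> x \<in> carrier M \<Longrightarrow> y \<in> carrier M \<Longrightarrow>
    act M g (x \<oplus>\<^bsub>M\<^esub> y) = act M g x \<oplus>\<^bsub>M\<^esub> act M g y"
  by (simp add: M.smult_r_distr)

lemma act_zero [simp]: "g \<in> carrier G \<Longrightarrow> act M g \<zero>\<^bsub>M\<^esub> = \<zero>\<^bsub>M\<^esub>"
  by simp

lemma act_one [simp]: "x \<in> carrier M \<Longrightarrow> act M \<one>\<^bsub>G\<^esub> x = x"
  by (simp flip: cp_one)

lemma act_smult: "g \<in> carrier G \<Longrightarrow> r \<in> carrier R \<Longrightarrow> x \<in> carrier M \<Longrightarrow>
    act M g (r \<odot>\<^bsub>B\<^esub> x) = \<sigma> g r \<odot>\<^bsub>B\<^esub> act M g x"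
  by (simp add: cp_monom_mult rho_one_right rho_one_left sigma_one flip: M.smult_assoc)

lemma act_act: "g \<in> carrier G \<Longrightarrow> h \<in> carrier G \<Longrightarrow> x \<in> carrier M \<Longrightarrow>
    act M g (act M h x) = \<rho> g h \<odot>\<^bsub>B\<^esub> act M (g \<otimes>\<^bsub>G\<^esub> h) x"
  by (simp add: cp_monom_mult rho_one_left sigma_one flip: M.smult_assoc)

text \<open>Applying \<open>g\<close> and then \<open>g\<^sup>-\<^sup>1\<close> multiplies by \<open>\<rho>(g\<^sup>-\<^sup>1, g)\<close>, which is a unit.\<close>

lemma act_inj:
  assumes g: "g \<in> carrier G"
  shows "inj_on (act M g) (carrier M)"
proof (rule inj_onI)
  fix x y assume x: "x \<in> carrier M" and y: "y \<in> carrier M" and eq: "act M g x = act M g y"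
  let ?h = "inv\<^bsub>G\<^esub> g"
  obtain u where u: "u \<in> carrier R" "u \<otimes>\<^bsub>R\<^esub> \<rho> ?h g = \<one>\<^bsub>R\<^esub>" using rho_inv[of ?h g] g by auto
  have *: "u \<odot>\<^bsub>B\<^esub> act M ?h (act M g z) = z" if z: "z \<in> carrier M" for z
  proof -
    have "u \<odot>\<^bsub>B\<^esub> act M ?h (act M g z) = u \<odot>\<^bsub>B\<^esub> (\<rho> ?h g \<odot>\<^bsub>B\<^esub> z)"
      using act_act[of ?h g z] g z by simp
    also have "\<dots> = (u \<otimes>\<^bsub>R\<^esub> \<rho> ?h g) \<odot>\<^bsub>B\<^esub> z"
      using g z u by (subst B.smult_assoc) auto
    finally show ?thesis using u z B.smult_one[of z] by simp
  qed
  show "x = y" using *[OF x] *[OF y] eq by simp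
qed

lemma submodule_act:
  assumes g: "g \<in> carrier G" and K: "submodule K R B"
  shows "submodule (act M g ` K) R B"
proof (rule B.submoduleI)
  note KD = B.submoduleD[OF K, simplified]
  show "act M g ` K \<subseteq> carrier B" using g KD(1) by auto
  show "\<zero>\<^bsub>B\<^esub> \<in> act M g ` K" using g KD(2) by (metis act_zero imageI restrict_scalars_simps(3))
  show "x \<oplus>\<^bsub>B\<^esub> y \<in> act M g ` K" if "x \<in> act M g ` K" "y \<in> act M g ` K" for x y
    using that g KD(1,3) by (force simp: act_add subset_iff simp flip: act_add)
  show "a \<odot>\<^bsub>B\<^esub> x \<in> act M g ` K" if a: "a \<in> carrier R" and x: "x \<in> act M g ` K" for a x
  proof -
    obtain k where k: "k \<in> K" "x = act M g k" using x by blast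
    \<comment> \<open>\<open>a g = g b\<close> for the preimage \<open>b\<close> of \<open>a\<close> under \<open>\<sigma> g\<close>\<close>
    obtain b where b: "b \<in> carrier R" "\<sigma> g b = a" using sigma_surj[OF g a] by blast
    have "a \<odot>\<^bsub>B\<^esub> x = act M g (b \<odot>\<^bsub>B\<^esub> k)" using act_smult[OF g b(1), of k] b k KD(1) by auto
    then show ?thesis using B.submoduleD(4)[OF K b(1) k(1)] by blast
  qed
qed

lemma submodule_act_preimage:
  assumes g: "g \<in> carrier G" and N: "submodule N R B"
  shows "submodule {x \<in> carrier M. act M g x \<in> N} R B"
proof (rule B.submoduleI)
  note ND = B.submoduleD[OF N]
  show "{x \<in> carrier M. act M g x \<in> N} \<subseteq> carrier B" by auto
  show "\<zero>\<^bsub>B\<^esub> \<in> {x \<in> carrier M. act M g x \<in> N}" using ND(2) g by simp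
  show "x \<oplus>\<^bsub>B\<^esub> y \<in> {x \<in> carrier M. act M g x \<in> N}"
    if "x \<in> {x \<in> carrier M. act M g x \<in> N}" "y \<in> {x \<in> carrier M. act M g x \<in> N}" for x y
    using that ND(3) g by (simp add: act_add)
  show "a \<odot>\<^bsub>B\<^esub> x \<in> {x \<in> carrier M. act M g x \<in> N}"
    if "a \<in> carrier R" "x \<in> {x \<in> carrier M. act M g x \<in> N}" for a x
  proof -
    have "act M g (a \<odot>\<^bsub>B\<^esub> x) \<in> N"
      using act_smult[OF g, of a x] that ND(4)[of "\<sigma> g a" "act M g x"] g by simp
    moreover have "a \<odot>\<^bsub>B\<^esub> x \<in> carrier M" using B.smult_closed[of a x] that by simp
    ultimately show ?thesis by simp
  qed
qed

text \<open>The elements \<open>g (h k)\<close> and \<open>(g h) k\<close> differ by the factor \<open>\<rho>(g, h)\<close>, a unit of \<open>R\<close>, which does not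
  change a submodule.\<close>

lemma act_act_image:
  assumes g: "g \<in> carrier G" and h: "h \<in> carrier G" and K: "submodule K R B"
  shows "act M g ` act M h ` K = act M (g \<otimes>\<^bsub>G\<^esub> h) ` K"
proof
  have KC: "K \<subseteq> carrier M" using B.submoduleD(1)[OF K] by simp
  show "act M g ` act M h ` K \<subseteq> act M (g \<otimes>\<^bsub>G\<^esub> h) ` K"
  proof clarify
    fix x assume x: "x \<in> K"
    have "act M g (act M h x) = \<rho> g h \<odot>\<^bsub>B\<^esub> act M (g \<otimes>\<^bsub>G\<^esub> h) x"
      using act_act g h x KC by blast
    moreover have "submodule (act M (g \<otimes>\<^bsub>G\<^esub> h) ` K) R B" using submodule_act[OF _ K] g h by simp
    ultimately show "act M g (act M h x) \<in> act M (g \<otimes>\<^bsub>G\<^esub> h) ` K"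
      using B.submoduleD(4) rho_closed[OF g h] x by (metis imageI)
  qed
  show "act M (g \<otimes>\<^bsub>G\<^esub> h) ` K \<subseteq> act M g ` act M h ` K"
  proof clarify
    fix x assume x: "x \<in> K"
    obtain u where u: "u \<in> carrier R" "u \<otimes>\<^bsub>R\<^esub> \<rho> g h = \<one>\<^bsub>R\<^esub>" using rho_inv[OF g h] by metis
    have c: "act M (g \<otimes>\<^bsub>G\<^esub> h) x \<in> carrier B" using g h x KC by auto
    have "u \<odot>\<^bsub>B\<^esub> act M g (act M h x) = u \<odot>\<^bsub>B\<^esub> (\<rho> g h \<odot>\<^bsub>B\<^esub> act M (g \<otimes>\<^bsub>G\<^esub> h) x)"
      using act_act[OF g h] x KC by auto
    also have "\<dots> = (u \<otimes>\<^bsub>R\<^esub> \<rho> g h) \<odot>\<^bsub>B\<^esub> act M (g \<otimes>\<^bsub>G\<^esub> h) x"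
      using B.smult_assoc[OF u(1) rho_closed[OF g h] c] by simp
    also have "\<dots> = act M (g \<otimes>\<^bsub>G\<^esub> h) x" using u(2) B.smult_one[OF c] by simp
    finally have "act M (g \<otimes>\<^bsub>G\<^esub> h) x = u \<odot>\<^bsub>B\<^esub> act M g (act M h x)" by simp
    moreover have "submodule (act M g ` act M h ` K) R B" using submodule_act K g h by simp
    ultimately show "act M (g \<otimes>\<^bsub>G\<^esub> h) x \<in> act M g ` act M h ` K"
      using B.submoduleD(4) u(1) x by (metis imageI)
  qed
qed

lemma base_submodule: "submodule N RG M \<Longrightarrow> submodule N R B"
  by (rule B.submoduleI) (use M.submoduleD[of N] in auto)

abbreviation T :: "'g set \<Rightarrow> 'm set \<Rightarrow> 'm set" where "T \<equiv> T_sum R M"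

lemma T_sumI:
  assumes "finite E" "E \<subseteq> F" "k \<in> E \<rightarrow> K"
  shows "(\<Oplus>\<^bsub>M\<^esub>g\<in>E. act M g (k g)) \<in> T F K"
  unfolding T_sum_def by (rule CollectI, intro exI conjI, rule refl) (fact assms)+

lemma T_sumE:
  assumes "x \<in> T F K"
  obtains E k where "finite E" "E \<subseteq> F" "k \<in> E \<rightarrow> K" "x = (\<Oplus>\<^bsub>M\<^esub>g\<in>E. act M g (k g))"
  using assms unfolding T_sum_def by (elim CollectE exE conjE)

lemma T_least_additive:
  assumes F: "F \<subseteq> carrier G" and K: "K \<subseteq> carrier M"
    and zero: "\<zero>\<^bsub>M\<^esub> \<in> N" and add: "\<And>x y. x \<in> N \<Longrightarrow> y \<in> N \<Longrightarrow> x \<oplus>\<^bsub>M\<^esub> y \<in> N"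
    and sub: "\<And>g. g \<in> F \<Longrightarrow> act M g ` K \<subseteq> N"
  shows "T F K \<subseteq> N"
proof
  fix x assume "x \<in> T F K"
  then obtain E k where E: "finite E" "E \<subseteq> F" "k \<in> E \<rightarrow> K" and x: "x = (\<Oplus>\<^bsub>M\<^esub>g\<in>E. act M g (k g))"
    by (rule T_sumE)
  have "(\<Oplus>\<^bsub>M\<^esub>g\<in>E. act M g (k g)) \<in> N"
    using E
  proof (induction E rule: finite_induct)
    case empty
    then show ?case using zero by simp
  next
    case (insert g E)
    have c: "(\<lambda>g. act M g (k g)) \<in> E \<rightarrow> carrier M" using insert.prems F K by (auto simp: Pi_def subset_iff)
    have cg: "act M g (k g) \<in> carrier M" using insert.prems F K by (auto simp: subset_iff)
    have "act M g (k g) \<in> N" using sub[of g] insert.prems by auto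
    moreover have "(\<Oplus>\<^bsub>M\<^esub>g\<in>E. act M g (k g)) \<in> N" using insert by auto
    ultimately show ?case
      using M.M.finsum_insert[OF insert.hyps c cg] add by simp
  qed
  then show "x \<in> N" by (simp add: x)
qed

text \<open>With \<open>T_superset\<close> and \<open>T_submodule\<close> this describes \<open>T_F K\<close> as the least submodule that contains
  \<open>g K\<close> for all \<open>g\<close> in \<open>F\<close>.\<close>

lemma T_least:
  assumes F: "F \<subseteq> carrier G" and K: "K \<subseteq> carrier M" and N: "submodule N R B"
    and sub: "\<And>g. g \<in> F \<Longrightarrow> act M g ` K \<subseteq> N"
  shows "T F K \<subseteq> N"
  using B.submoduleD(2,3)[OF N] by (intro T_least_additive[OF F K _ _ sub]) simp_all

lemma T_superset:
  assumes F: "F \<subseteq> carrier G" and K: "K \<subseteq> carrier M" and g: "g \<in> F"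
  shows "act M g ` K \<subseteq> T F K"
proof clarify
  fix x assume x: "x \<in> K"
  have c: "act M g x \<in> carrier M" using F K g x by (simp add: subset_iff)
  have "(\<Oplus>\<^bsub>M\<^esub>h\<in>{g}. act M h x) = act M g x \<oplus>\<^bsub>M\<^esub> (\<Oplus>\<^bsub>M\<^esub>h\<in>{}. act M h x)"
    by (rule M.M.finsum_insert) (simp_all add: c)
  also have "\<dots> = act M g x" using c by (simp only: M.M.finsum_empty M.M.r_zero)
  finally have eq: "(\<Oplus>\<^bsub>M\<^esub>h\<in>{g}. act M h x) = act M g x" .
  have "(\<Oplus>\<^bsub>M\<^esub>h\<in>{g}. act M h x) \<in> T F K"
    by (rule T_sumI) (use g x in auto)
  then show "act M g x \<in> T F K" by (simp only: eq)
qed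

lemma T_submodule:
  assumes F: "F \<subseteq> carrier G" and K: "submodule K R B"
  shows "submodule (T F K) R B"
proof (rule B.submoduleI)
  note KD = B.submoduleD[OF K, simplified]
  have KC: "K \<subseteq> carrier M" by (rule KD(1))
  have c: "(\<lambda>g. act M g (k g)) \<in> E \<rightarrow> carrier M" if "E \<subseteq> F" "k \<in> E \<rightarrow> K" for E k
    using that F KC by (auto simp: Pi_def subset_iff)
  show "T F K \<subseteq> carrier B"
    using F KC by (intro T_least B.submodule_carrier) auto
  show "\<zero>\<^bsub>B\<^esub> \<in> T F K"
    using T_sumI[of "{}"] by simp
  show "x \<oplus>\<^bsub>B\<^esub> y \<in> T F K" if xy: "x \<in> T F K" "y \<in> T F K" for x y
  proof -
    obtain E k where E: "finite E" "E \<subseteq> F" "k \<in> E \<rightarrow> K" and x: "x = (\<Oplus>\<^bsub>M\<^esub>g\<in>E. act M g (k g))"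
      by (rule T_sumE[OF xy(1)])
    obtain E' k' where E': "finite E'" "E' \<subseteq> F" "k' \<in> E' \<rightarrow> K" and y: "y = (\<Oplus>\<^bsub>M\<^esub>g\<in>E'. act M g (k' g))"
      by (rule T_sumE[OF xy(2)])
    define l where "l E k g = (if g \<in> E then k g else \<zero>\<^bsub>M\<^esub>)" for E :: "'g set" and k g
    have lK: "l E k \<in> E \<union> E' \<rightarrow> K" "l E' k' \<in> E \<union> E' \<rightarrow> K" using E E' KD(2) by (auto simp: l_def)
    have EF: "E \<union> E' \<subseteq> F" using E E' by simp
    have x': "x = (\<Oplus>\<^bsub>M\<^esub>g\<in>E \<union> E'. act M g (l E k g))"
      unfolding x using E E' F c[OF EF lK(1)] by (intro M.M.add.finprod_mono_neutral_cong_left) (auto simp: l_def subset_iff)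
    have y': "y = (\<Oplus>\<^bsub>M\<^esub>g\<in>E \<union> E'. act M g (l E' k' g))"
      unfolding y using E E' F c[OF EF lK(2)] by (intro M.M.add.finprod_mono_neutral_cong_left) (auto simp: l_def subset_iff)
    have "x \<oplus>\<^bsub>M\<^esub> y = (\<Oplus>\<^bsub>M\<^esub>g\<in>E \<union> E'. act M g (l E k g) \<oplus>\<^bsub>M\<^esub> act M g (l E' k' g))"
      unfolding x' y' using c[OF EF lK(1)] c[OF EF lK(2)] by (rule M.M.finsum_addf[symmetric])
    also have "\<dots> = (\<Oplus>\<^bsub>M\<^esub>g\<in>E \<union> E'. act M g (l E k g \<oplus>\<^bsub>M\<^esub> l E' k' g))"
    proof (rule M.M.finsum_cong'[OF refl])
      fix g assume "g \<in> E \<union> E'"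
      then have "g \<in> carrier G" "l E k g \<in> carrier M" "l E' k' g \<in> carrier M"
        using EF F lK KC by (auto simp: Pi_def subset_iff)
      then show "act M g (l E k g) \<oplus>\<^bsub>M\<^esub> act M g (l E' k' g) = act M g (l E k g \<oplus>\<^bsub>M\<^esub> l E' k' g)"
        by (simp add: act_add)
    qed (use c[OF EF, of "\<lambda>g. l E k g \<oplus>\<^bsub>M\<^esub> l E' k' g"] lK KD(3) in \<open>auto simp: Pi_def\<close>)
    also have "\<dots> \<in> T F K"
      using E(1) E'(1) EF lK KD(3) by (intro T_sumI) (auto simp: Pi_def)
    finally show ?thesis by simp
  qed
  show "a \<odot>\<^bsub>B\<^esub> x \<in> T F K" if a: "a \<in> carrier R" and x: "x \<in> T F K" for a x
  proof -
    obtain E k where E: "finite E" "E \<subseteq> F" "k \<in> E \<rightarrow> K" and x: "x = (\<Oplus>\<^bsub>M\<^esub>g\<in>E. act M g (k g))"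
      by (rule T_sumE[OF x])
    have "a \<odot>\<^bsub>B\<^esub> (\<Oplus>\<^bsub>M\<^esub>g\<in>E. act M g (k g)) \<in> {(\<Oplus>\<^bsub>M\<^esub>g\<in>E. act M g (k' g)) | k'. k' \<in> E \<rightarrow> K}"
      using E
    proof (induction E rule: finite_induct)
      case empty
      have "a \<odot>\<^bsub>B\<^esub> \<zero>\<^bsub>M\<^esub> = \<zero>\<^bsub>M\<^esub>" using B.smult_zero_right[OF a] by simp
      then show ?case by auto
    next
      case (insert g E)
      then obtain k' where k': "k' \<in> E \<rightarrow> K" "a \<odot>\<^bsub>B\<^esub> (\<Oplus>\<^bsub>M\<^esub>g\<in>E. act M g (k g)) = (\<Oplus>\<^bsub>M\<^esub>g\<in>E. act M g (k' g))"
        by auto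
      have g: "g \<in> carrier G" "k g \<in> K" "E \<subseteq> F" "k \<in> E \<rightarrow> K" using insert.prems F by auto
      then have "act M g (k g) \<in> act M g ` K" by simp
      then have "a \<odot>\<^bsub>B\<^esub> act M g (k g) \<in> act M g ` K"
        using B.submoduleD(4)[OF submodule_act[OF g(1) K] a] by blast
      then obtain m where m: "m \<in> K" "a \<odot>\<^bsub>B\<^esub> act M g (k g) = act M g m" by blast
      have ce: "(\<lambda>g. act M g (k g)) \<in> E \<rightarrow> carrier M" "(\<lambda>g. act M g (k' g)) \<in> E \<rightarrow> carrier M"
        using c[OF g(3,4)] c[OF g(3) k'(1)] .
      have cg: "act M g (k g) \<in> carrier M" "act M g m \<in> carrier M" using g m KC by auto
      have "a \<odot>\<^bsub>B\<^esub> (\<Oplus>\<^bsub>M\<^esub>g\<in>insert g E. act M g (k g))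
        = a \<odot>\<^bsub>B\<^esub> (act M g (k g) \<oplus>\<^bsub>M\<^esub> (\<Oplus>\<^bsub>M\<^esub>g\<in>E. act M g (k g)))"
        using M.M.finsum_insert[OF insert.hyps ce(1) cg(1)] by simp
      also have "\<dots> = a \<odot>\<^bsub>B\<^esub> act M g (k g) \<oplus>\<^bsub>M\<^esub> a \<odot>\<^bsub>B\<^esub> (\<Oplus>\<^bsub>M\<^esub>g\<in>E. act M g (k g))"
        using B.smult_r_distr[OF a, of "act M g (k g)" "\<Oplus>\<^bsub>M\<^esub>g\<in>E. act M g (k g)"] cg(1) M.M.finsum_closed[OF ce(1)] by simp
      also have "\<dots> = act M g m \<oplus>\<^bsub>M\<^esub> (\<Oplus>\<^bsub>M\<^esub>g\<in>E. act M g (k' g))" using m(2) k'(2) by simp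
      also have "(\<Oplus>\<^bsub>M\<^esub>g\<in>E. act M g (k' g)) = (\<Oplus>\<^bsub>M\<^esub>h\<in>E. act M h ((k'(g := m)) h))"
        using insert.hyps ce(2) by (intro M.M.finsum_cong'[OF refl]) (auto simp: Pi_def)
      also have "act M g m \<oplus>\<^bsub>M\<^esub> \<dots> = (\<Oplus>\<^bsub>M\<^esub>h\<in>insert g E. act M h ((k'(g := m)) h))"
        using insert.hyps cg(2) ce(2) by (subst M.M.finsum_insert) (auto simp: Pi_def)
      finally show ?case using k'(1) m(1) insert.hyps
        by (intro CollectI exI[of _ "k'(g := m)"]) (auto simp: Pi_def)
    qed
    then obtain k' where "k' \<in> E \<rightarrow> K" "a \<odot>\<^bsub>B\<^esub> x = (\<Oplus>\<^bsub>M\<^esub>g\<in>E. act M g (k' g))" unfolding x by blast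
    then show ?thesis using T_sumI[OF E(1,2)] by simp
  qed
qed

lemma T_mono: "F \<subseteq> F' \<Longrightarrow> K \<subseteq> K' \<Longrightarrow> T F K \<subseteq> T F' K'"
proof
  fix x assume "F \<subseteq> F'" "K \<subseteq> K'" "x \<in> T F K"
  moreover from \<open>x \<in> T F K\<close> obtain E k where "finite E" "E \<subseteq> F" "k \<in> E \<rightarrow> K"
    and "x = (\<Oplus>\<^bsub>M\<^esub>g\<in>E. act M g (k g))" by (rule T_sumE)
  ultimately show "x \<in> T F' K'" using T_sumI[of E F' k K'] by auto
qed

lemma T_empty: "T {} K = {\<zero>\<^bsub>M\<^esub>}"
  unfolding T_sum_def by auto

lemma T_Un:
  assumes F: "F \<subseteq> carrier G" "F' \<subseteq> carrier G" and K: "submodule K R B"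
  shows "T (F \<union> F') K = T F K <+>\<^bsub>B\<^esub> T F' K"
proof
  have KC: "K \<subseteq> carrier M" using B.submoduleD(1)[OF K] by simp
  note T = T_submodule[OF F(1) K] T_submodule[OF F(2) K]
  show "T (F \<union> F') K \<subseteq> T F K <+>\<^bsub>B\<^esub> T F' K"
  proof (rule T_least[OF _ KC B.submodule_add[OF T]])
    show "act M g ` K \<subseteq> T F K <+>\<^bsub>B\<^esub> T F' K" if "g \<in> F \<union> F'" for g
      using that T_superset[OF F(1) KC, of g] T_superset[OF F(2) KC, of g] B.set_add_upper[OF T] by blast
  qed (use F in simp)
  show "T F K <+>\<^bsub>B\<^esub> T F' K \<subseteq> T (F \<union> F') K"
    using F T_mono by (intro B.set_add_least T_submodule K) auto
qed

lemma T_singleton: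
  assumes g: "g \<in> carrier G" and K: "submodule K R B"
  shows "T {g} K = act M g ` K"
  using assms B.submoduleD(1)[OF K] submodule_act[OF g K]
  by (intro subset_antisym T_least T_superset) auto

lemma act_T:
  assumes g: "g \<in> carrier G" and F: "F \<subseteq> carrier G" and K: "submodule K R B"
  shows "act M g ` T F K = T (g <#\<^bsub>G\<^esub> F) K"
proof
  have KC: "K \<subseteq> carrier M" using B.submoduleD(1)[OF K] by simp
  have gF: "g <#\<^bsub>G\<^esub> F \<subseteq> carrier G" using g F by (auto simp: l_coset_def)
  note T = T_submodule[OF gF K]
  have "T F K \<subseteq> {x \<in> carrier M. act M g x \<in> T (g <#\<^bsub>G\<^esub> F) K}"
  proof (rule T_least[OF F KC submodule_act_preimage[OF g T]])
    fix h assume h: "h \<in> F"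
    have "act M (g \<otimes>\<^bsub>G\<^esub> h) ` K \<subseteq> T (g <#\<^bsub>G\<^esub> F) K"
      using h by (intro T_superset gF KC) (auto simp: l_coset_def)
    then show "act M h ` K \<subseteq> {x \<in> carrier M. act M g x \<in> T (g <#\<^bsub>G\<^esub> F) K}"
      using act_act_image[OF g _ K, of h] h F KC by auto
  qed
  then show "act M g ` T F K \<subseteq> T (g <#\<^bsub>G\<^esub> F) K" by blast
  show "T (g <#\<^bsub>G\<^esub> F) K \<subseteq> act M g ` T F K"
  proof (rule T_least[OF gF KC submodule_act[OF g T_submodule[OF F K]]])
    fix x assume "x \<in> g <#\<^bsub>G\<^esub> F"
    then obtain h where h: "h \<in> F" "x = g \<otimes>\<^bsub>G\<^esub> h" by (auto simp: l_coset_def)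
    then show "act M x ` K \<subseteq> act M g ` T F K"
      using act_act_image[OF g _ K, of h] T_superset[OF F KC h(1)] F by auto
  qed
qed

lemma T_T:
  assumes F: "F \<subseteq> carrier G" and E: "E \<subseteq> carrier G" and K: "submodule K R B"
  shows "T F (T E K) \<subseteq> T (F <#>\<^bsub>G\<^esub> E) K"
proof (rule T_least[OF F])
  have FE: "F <#>\<^bsub>G\<^esub> E \<subseteq> carrier G" using F E by (auto simp: set_mult_def)
  show "T E K \<subseteq> carrier M" using B.submoduleD(1)[OF T_submodule[OF E K]] by simp
  show "submodule (T (F <#>\<^bsub>G\<^esub> E) K) R B" by (rule T_submodule[OF FE K])
  show "act M g ` T E K \<subseteq> T (F <#>\<^bsub>G\<^esub> E) K" if "g \<in> F" for g
    using act_T[of g E K] that F E K T_mono[of "g <#\<^bsub>G\<^esub> E" "F <#>\<^bsub>G\<^esub> E" K K]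
    by (auto simp: l_coset_def set_mult_def)
qed

end

context crossed_system
begin

lemma T_image_hom:
  assumes M: "left_module RG M" and N: "left_module RG N" and f: "f \<in> mod_hom RG M N"
    and F: "F \<subseteq> carrier G" and K: "submodule K R (base M)"
  shows "f ` T_sum R M F K = T_sum R N F (f ` K)"
proof -
  interpret M: crossed_module R G \<sigma> \<rho> M
    using M by (simp add: crossed_module_def crossed_system_axioms lmodule_def)
  interpret N: crossed_module R G \<sigma> \<rho> N
    using N by (simp add: crossed_module_def crossed_system_axioms lmodule_def)
  interpret f: left_module_hom R "base M" "base N" f
    by unfold_locales (rule base_hom[OF f])
  have KC: "K \<subseteq> carrier M" using M.B.submoduleD(1)[OF K] by simp
  have fK: "submodule (f ` K) R (base N)" by (rule f.submodule_image[OF K])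
  have fKC: "f ` K \<subseteq> carrier N" using N.B.submoduleD(1)[OF fK] by simp
  show ?thesis
  proof
    have "M.T F K \<subseteq> {x \<in> carrier (base M). f x \<in> N.T F (f ` K)}"
    proof (rule M.T_least[OF F KC f.submodule_preimage[OF N.T_submodule[OF F fK]]])
      fix g assume g: "g \<in> F"
      show "act M g ` K \<subseteq> {x \<in> carrier (base M). f x \<in> N.T F (f ` K)}"
      proof clarify
        fix x assume x: "x \<in> K"
        have "f (act M g x) = act N g (f x)" using hom_act[OF f, of g x] g F x KC by (simp add: subset_iff)
        then show "act M g x \<in> carrier (base M) \<and> f (act M g x) \<in> N.T F (f ` K)"
          using N.T_superset[OF F fKC g] x g F KC by auto
      qed
    qed
    then show "f ` M.T F K \<subseteq> N.T F (f ` K)" by blast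
    show "N.T F (f ` K) \<subseteq> f ` M.T F K"
    proof (rule N.T_least[OF F fKC f.submodule_image[OF M.T_submodule[OF F K]]])
      fix g assume g: "g \<in> F"
      show "act N g ` f ` K \<subseteq> f ` M.T F K"
      proof clarify
        fix x assume x: "x \<in> K"
        have "act N g (f x) = f (act M g x)" using hom_act[OF f, of g x] g F x KC by (simp add: subset_iff)
        then show "act N g (f x) \<in> f ` M.T F K" using M.T_superset[OF F KC g] x by auto
      qed
    qed
  qed
qed

end

locale entropy_setting = crossed_system R G \<sigma> \<rho> + length_on_modules R L
  for R :: "('r, 'c) ring_scheme" and G :: "('g, 'd) monoid_scheme"
    and \<sigma> :: "'g \<Rightarrow> 'r \<Rightarrow> 'r" and \<rho> :: "'g \<Rightarrow> 'g \<Rightarrow> 'r"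
    and L :: "('r, 'm) module \<Rightarrow> ennreal" +
  assumes compat: "compatible R G \<sigma> L" and amen: "amenable G"

locale entropy_module = entropy_setting R G \<sigma> \<rho> L + crossed_module R G \<sigma> \<rho> M
  for R :: "('r, 'c) ring_scheme" and G :: "('g, 'd) monoid_scheme"
    and \<sigma> :: "'g \<Rightarrow> 'r \<Rightarrow> 'r" and \<rho> :: "'g \<Rightarrow> 'g \<Rightarrow> 'r"
    and L :: "('r, 'm) module \<Rightarrow> ennreal" and M :: "('g \<Rightarrow> 'r, 'm) module"
begin

text \<open>The map \<open>k \<mapsto> g k\<close> is \<open>R\<close>-linear from \<open>K\<close> to the restriction of \<open>g K\<close> along \<open>\<sigma> g\<close>,
  because \<open>g r = \<sigma>(g)(r) g\<close>.\<close>

lemma len_act: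
  assumes g: "g \<in> carrier G" and K: "submodule K R B"
  shows "len B (act M g ` K) = len B K"
proof -
  have KC: "K \<subseteq> carrier M" using B.submoduleD(1)[OF K] by simp
  let ?A = "sub_mod B (act M g ` K)"
  let ?P = "restrict_scalars (\<sigma> g) ?A"
  have A: "left_module R ?A" by (rule B.left_module_sub_mod[OF submodule_act[OF g K]])
  have P: "left_module R ?P" by (rule left_module_restrict_scalars[OF R.ring_axioms A sigma_hom[OF g]])
  have "act M g \<in> mod_hom R (sub_mod B K) ?P"
    using act_smult[OF g] act_add[OF g] KC by (auto simp: mod_hom_def subset_iff)
  moreover have "bij_betw (act M g) (carrier (sub_mod B K)) (carrier ?P)"
    using inj_on_subset[OF act_inj[OF g] KC] by (simp add: bij_betw_def)
  ultimately have "mod_isomorphic R (sub_mod B K) ?P" unfolding mod_isomorphic_def by blast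
  moreover have "invariant_on R (R_Mod R) L" using length_L by (simp add: length_function_def)
  moreover have "sub_mod B K \<in> R_Mod R" "?P \<in> R_Mod R"
    using B.left_module_sub_mod[OF K] P by (simp_all add: R_Mod_def)
  ultimately have "L (sub_mod B K) = L ?P" unfolding invariant_on_def by blast
  also have "\<dots> = L ?A"
    using compat g A unfolding compatible_def R_Mod_def by blast
  finally show ?thesis by simp
qed

lemma fin_len_act:
  "g \<in> carrier G \<Longrightarrow> fin_len B K \<Longrightarrow> fin_len B (act M g ` K)"
  using len_act submodule_act by (simp add: fin_len_def)

lemma rlen_act:
  "g \<in> carrier G \<Longrightarrow> submodule K R B \<Longrightarrow> rlen B (act M g ` K) = rlen B K"
  using len_act by (simp add: rlen_def)

lemma fin_len_T:
  assumes "finite F" "F \<subseteq> carrier G" and K: "fin_len B K"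
  shows "fin_len B (T F K)"
  using assms(1,2)
proof (induction F rule: finite_induct)
  case empty
  then show ?case using fin_len_zero[OF left_module_base] by (simp add: T_empty)
next
  case (insert g F)
  then have "T (insert g F) K = act M g ` K <+>\<^bsub>B\<^esub> T F K"
    using T_Un[of "{g}" F K] T_singleton[of g K] fin_lenD[OF K] by simp
  then show ?case
    using fin_len_add[OF left_module_base fin_len_act[of g, OF _ K]] insert by simp
qed

lemma rlen_T_le:
  assumes "finite F" "F \<subseteq> carrier G" and K: "fin_len B K"
  shows "rlen B (T F K) \<le> card F * rlen B K"
  using assms(1,2)
proof (induction F rule: finite_induct)
  case empty
  then show ?case using rlen_zero[OF left_module_base] by (simp add: T_empty)
next
  case (insert g F)
  then have "T (insert g F) K = act M g ` K <+>\<^bsub>B\<^esub> T F K"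
    using T_Un[of "{g}" F K] T_singleton[of g K] fin_lenD[OF K] by simp
  then have "rlen B (T (insert g F) K) \<le> rlen B (act M g ` K) + rlen B (T F K)"
    using rlen_add_le[OF left_module_base fin_len_act[of g, OF _ K] fin_len_T[OF _ _ K]] insert by simp
  also have "\<dots> \<le> rlen B K + card F * rlen B K"
    using insert rlen_act[of g K] fin_lenD[OF K] by simp
  finally show ?case using insert by (simp add: algebra_simps)
qed

text \<open>Each translate of \<open>K\<close> exceeds that of \<open>K'\<close> by the same length, and the increments of sums are at
  most the sums of the increments.\<close>

lemma rlen_T_increment:
  assumes "finite F" "F \<subseteq> carrier G" and K: "fin_len B K" and K': "submodule K' R B" "K' \<subseteq> K"
  shows "rlen B (T F K) \<le> rlen B (T F K') + card F * (rlen B K - rlen B K')"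
  using assms(1,2)
proof (induction F rule: finite_induct)
  case empty
  then show ?case by (simp add: T_empty)
next
  case (insert g F)
  have g: "g \<in> carrier G" and F: "F \<subseteq> carrier G" using insert.prems by auto
  have eq: "T (insert g F) H = act M g ` H <+>\<^bsub>B\<^esub> T F H" if "submodule H R B" for H
    using T_Un[of "{g}" F H] T_singleton[of g H] that g F by simp
  have "rlen B (T (insert g F) K) - rlen B (T (insert g F) K')
      \<le> (rlen B (act M g ` K) - rlen B (act M g ` K')) + (rlen B (T F K) - rlen B (T F K'))"
    unfolding eq[OF fin_lenD[OF K]] eq[OF K'(1)]
    using submodule_act[OF g K'(1)] fin_len_act[OF g K] T_submodule[OF F K'(1)] fin_len_T[OF insert.hyps(1) F K]
      T_mono[of F F K' K] K'(2)
    by (intro rlen_add_increment[OF left_module_base]) auto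
  also have "\<dots> \<le> (rlen B K - rlen B K') + card F * (rlen B K - rlen B K')"
    using insert.IH[OF F] rlen_act[OF g fin_lenD[OF K]] rlen_act[OF g K'(1)] by simp
  finally show ?case using insert.hyps by (simp add: algebra_simps)
qed

end

section \<open>Submodular functions on finite subsets of a group\<close>

text \<open>Adding an element \<open>a\<close> to \<open>F\<close> raises \<open>h F\<close> by no more than it raises the values at the smaller
  sets \<open>S i \<inter> F\<close> with \<open>a \<in> S i\<close>, and there are \<open>k\<close> of these. This is Shearer's inequality.\<close>

lemma submodular_exact_cover:
  fixes h :: "'a set \<Rightarrow> real" and S :: "'i \<Rightarrow> 'a set"
  assumes "finite F" "finite I" and zero: "h {} = 0"
    and "\<And>A B. A \<subseteq> F \<Longrightarrow> B \<subseteq> F \<Longrightarrow> h (A \<union> B) + h (A \<inter> B) \<le> h A + h B"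
    and "\<And>a. a \<in> F \<Longrightarrow> card {i \<in> I. a \<in> S i} = k"
  shows "k * h F \<le> (\<Sum>i\<in>I. h (S i \<inter> F))"
  using assms(1,4,5)
proof (induction F rule: finite_induct)
  case empty
  then show ?case by (simp add: zero)
next
  case (insert a F)
  let ?c = "h (insert a F) - h F"
  have sub: "h (A \<union> B) + h (A \<inter> B) \<le> h A + h B" if "A \<subseteq> insert a F" "B \<subseteq> insert a F" for A B
    using insert.prems(1) that by blast
  have IH: "k * h F \<le> (\<Sum>i\<in>I. h (S i \<inter> F))"
    using insert.prems by (intro insert.IH) (auto simp: subset_insertI2)
  have step: "h (S i \<inter> F) + (if a \<in> S i then ?c else 0) \<le> h (S i \<inter> insert a F)" for i
  proof (cases "a \<in> S i")
    case True
    have "h ((S i \<inter> insert a F) \<union> F) + h ((S i \<inter> insert a F) \<inter> F) \<le> h (S i \<inter> insert a F) + h F"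
      by (rule sub) auto
    moreover have "(S i \<inter> insert a F) \<union> F = insert a F" "(S i \<inter> insert a F) \<inter> F = S i \<inter> F"
      using True by auto
    ultimately have "h (insert a F) + h (S i \<inter> F) \<le> h (S i \<inter> insert a F) + h F" by (simp only:)
    then show ?thesis using True by simp
  qed simp
  have "k * ?c = (\<Sum>i\<in>I. if a \<in> S i then ?c else 0)"
    using insert.prems(2)[of a] \<open>finite I\<close> by (simp add: sum.If_cases Int_def)
  then have "k * h (insert a F) = k * h F + (\<Sum>i\<in>I. if a \<in> S i then ?c else 0)"
    by (simp add: algebra_simps)
  also have "\<dots> \<le> (\<Sum>i\<in>I. h (S i \<inter> F)) + (\<Sum>i\<in>I. if a \<in> S i then ?c else 0)"
    using IH by simp
  also have "\<dots> = (\<Sum>i\<in>I. h (S i \<inter> F) + (if a \<in> S i then ?c else 0))"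
    by (simp add: sum.distrib)
  also have "\<dots> \<le> (\<Sum>i\<in>I. h (S i \<inter> insert a F))"
    by (rule sum_mono) (rule step)
  finally show ?case .
qed

text \<open>This is the product \<open>F E\<^sup>-\<^sup>1\<close>, see \<open>meeting_eq\<close>.\<close>

definition (in group) meeting :: "'a set \<Rightarrow> 'a set \<Rightarrow> 'a set" where
  "meeting E F = {x \<in> carrier G. (x <# E) \<inter> F \<noteq> {}}"

context group
begin

lemma meeting_eq:
  assumes "E \<subseteq> carrier G" "F \<subseteq> carrier G"
  shows "meeting E F = (\<lambda>(f, e). f \<otimes> inv e) ` (F \<times> E)"
proof
  show "meeting E F \<subseteq> (\<lambda>(f, e). f \<otimes> inv e) ` (F \<times> E)"
  proof
    fix x assume "x \<in> meeting E F"
    then obtain e where x: "x \<in> carrier G" "e \<in> E" "x \<otimes> e \<in> F"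
      by (auto simp: meeting_def l_coset_def)
    then have "x = (x \<otimes> e) \<otimes> inv e" using assms by (simp add: subset_iff m_assoc)
    then show "x \<in> (\<lambda>(f, e). f \<otimes> inv e) ` (F \<times> E)" using x by (intro image_eqI[of _ _ "(x \<otimes> e, e)"]) auto
  qed
  show "(\<lambda>(f, e). f \<otimes> inv e) ` (F \<times> E) \<subseteq> meeting E F"
  proof clarify
    fix f e assume fe: "f \<in> F" "e \<in> E"
    then have c: "f \<in> carrier G" "e \<in> carrier G" using assms by auto
    then have "(f \<otimes> inv e) \<otimes> e = f" by (simp add: m_assoc)
    then show "f \<otimes> inv e \<in> meeting E F"
      using fe c by (auto simp: meeting_def l_coset_def intro!: bexI[of _ e])
  qed
qed

lemma finite_meeting:
  "finite E \<Longrightarrow> finite F \<Longrightarrow> E \<subseteq> carrier G \<Longrightarrow> F \<subseteq> carrier G \<Longrightarrow> finite (meeting E F)"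
  by (simp add: meeting_eq)

lemma card_translates_through:
  assumes E: "finite E" "E \<subseteq> carrier G" and F: "F \<subseteq> carrier G" and a: "a \<in> F"
  shows "card {x \<in> meeting E F. a \<in> x <# E} = card E"
proof -
  have ac: "a \<in> carrier G" using a F by auto
  have "{x \<in> meeting E F. a \<in> x <# E} = (\<lambda>e. a \<otimes> inv e) ` E"
  proof
    show "{x \<in> meeting E F. a \<in> x <# E} \<subseteq> (\<lambda>e. a \<otimes> inv e) ` E"
    proof
      fix x assume "x \<in> {x \<in> meeting E F. a \<in> x <# E}"
      then obtain e where x: "x \<in> carrier G" "e \<in> E" "a = x \<otimes> e" by (auto simp: meeting_def l_coset_def)
      then have "x = a \<otimes> inv e" using E by (simp add: subset_iff m_assoc)
      then show "x \<in> (\<lambda>e. a \<otimes> inv e) ` E" using x by auto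
    qed
    show "(\<lambda>e. a \<otimes> inv e) ` E \<subseteq> {x \<in> meeting E F. a \<in> x <# E}"
    proof clarify
      fix e assume e: "e \<in> E"
      then have c: "e \<in> carrier G" using E by auto
      then have "a = (a \<otimes> inv e) \<otimes> e" using ac by (simp add: m_assoc)
      then have "a \<in> (a \<otimes> inv e) <# E" using e unfolding l_coset_def by blast
      then show "a \<otimes> inv e \<in> meeting E F \<and> a \<in> (a \<otimes> inv e) <# E"
        using a ac c by (auto simp: meeting_def)
    qed
  qed
  moreover have "inj_on (\<lambda>e. a \<otimes> inv e) E"
  proof (rule inj_onI)
    fix x y assume xy: "x \<in> E" "y \<in> E" "a \<otimes> inv x = a \<otimes> inv y"
    then have "x \<in> carrier G" "y \<in> carrier G" using E by auto
    then show "x = y" using xy ac by (metis inv_closed inv_inv l_cancel)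
  qed
  ultimately show ?thesis by (simp add: card_image)
qed

text \<open>For a fixed \<open>e \<in> E\<close> the map \<open>x \<mapsto> x e\<close> injects the \<open>x\<close> with \<open>x E \<subseteq> F\<close> into \<open>F\<close>; the other translates
  that meet \<open>F\<close> belong to the boundary.\<close>

lemma card_meeting_le:
  assumes E: "finite E" "E \<subseteq> carrier G" "E \<noteq> {}" and F: "finite F" "F \<subseteq> carrier G"
  shows "card (meeting E F) \<le> card F + card (boundary G E F)"
proof -
  obtain e where e: "e \<in> E" using E by blast
  then have ec: "e \<in> carrier G" using E by auto
  let ?I = "{x \<in> carrier G. x <# E \<subseteq> F}"
  have inj: "inj_on (\<lambda>x. x \<otimes> e) ?I" using ec by (auto intro!: inj_onI)
  have im: "(\<lambda>x. x \<otimes> e) ` ?I \<subseteq> F" using e by (auto simp: l_coset_def)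
  have I: "finite ?I" "card ?I \<le> card F"
    using inj_on_finite[OF inj im F(1)] card_inj_on_le[OF inj im F(1)] by auto
  have "boundary G E F \<subseteq> meeting E F" by (auto simp: boundary_def meeting_def)
  then have b: "finite (boundary G E F)"
    using finite_meeting[OF E(1) F(1) E(2) F(2)] finite_subset by blast
  have "meeting E F \<subseteq> ?I \<union> boundary G E F"
    by (auto simp: boundary_def meeting_def)
  then have "card (meeting E F) \<le> card (?I \<union> boundary G E F)"
    using I b by (intro card_mono) auto
  also have "\<dots> \<le> card ?I + card (boundary G E F)" by (rule card_Un_le)
  finally show ?thesis using I by simp
qed

lemma set_mult_eq_meeting:
  assumes "E \<subseteq> carrier G" "F \<subseteq> carrier G"
  shows "F <#> E = meeting (m_inv G ` E) F"
proof -
  have "m_inv G ` E \<subseteq> carrier G" using assms by auto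
  then have "meeting (m_inv G ` E) F = (\<lambda>(f, e). f \<otimes> inv e) ` (F \<times> m_inv G ` E)"
    using meeting_eq assms by blast
  also have "\<dots> = (\<lambda>(f, e). f \<otimes> e) ` (F \<times> E)"
    using assms by (force simp: image_iff subset_iff)
  finally show ?thesis by (auto simp: set_mult_def)
qed

text \<open>Points are added to \<open>S\<close> greedily. A point \<open>f\<close> is refused only if \<open>f E\<close> meets \<open>s E\<close> for some \<open>s \<in> S\<close>,
  that is, if \<open>f \<in> s E E\<^sup>-\<^sup>1\<close>, and each \<open>s\<close> accounts for at most \<open>(card E)\<^sup>2\<close> such points.\<close>

lemma packing:
  assumes E: "finite E" "E \<subseteq> carrier G" "E \<noteq> {}" and F: "finite F" "F \<subseteq> carrier G"
  obtains S where "S \<subseteq> F" "\<And>x y. x \<in> S \<Longrightarrow> y \<in> S \<Longrightarrow> x \<noteq> y \<Longrightarrow> (x <# E) \<inter> (y <# E) = {}"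
    "card F \<le> card S * (card E * card E)"
proof -
  define N where "N s = (\<lambda>(e, e'). s \<otimes> e \<otimes> inv e') ` (E \<times> E)" for s
  have "\<exists>S\<subseteq>F. (\<forall>x\<in>S. \<forall>y\<in>S. x \<noteq> y \<longrightarrow> (x <# E) \<inter> (y <# E) = {}) \<and> F \<subseteq> (\<Union>s\<in>S. N s)"
    using F
  proof (induction F rule: finite_induct)
    case empty
    then show ?case by auto
  next
    case (insert f F)
    then obtain S where S: "S \<subseteq> F" "\<forall>x\<in>S. \<forall>y\<in>S. x \<noteq> y \<longrightarrow> (x <# E) \<inter> (y <# E) = {}" "F \<subseteq> (\<Union>s\<in>S. N s)"
      by auto
    show ?case
    proof (cases "f \<in> (\<Union>s\<in>S. N s)")
      case True
      then show ?thesis using S by (intro exI[of _ S]) auto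
    next
      case False
      have fc: "f \<in> carrier G" using insert.prems by simp
      have dis: "(f <# E) \<inter> (s <# E) = {}" if s: "s \<in> S" for s
      proof (rule ccontr)
        assume "(f <# E) \<inter> (s <# E) \<noteq> {}"
        then obtain e e' where e: "e \<in> E" "e' \<in> E" "f \<otimes> e = s \<otimes> e'" by (auto simp: l_coset_def)
        then have "e \<in> carrier G" "e' \<in> carrier G" "s \<in> carrier G" using E s S insert.prems by auto
        then have "f = s \<otimes> e' \<otimes> inv e" using e(3) fc by (metis inv_solve_right' m_closed)
        then have "f \<in> N s" unfolding N_def using e by (intro image_eqI[of _ _ "(e', e)"]) auto
        then show False using False s by blast
      qed
      obtain e where e: "e \<in> E" using E by blast
      then have "e \<in> carrier G" using E by auto
      then have "f = f \<otimes> e \<otimes> inv e" using fc by (simp add: m_assoc)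
      then have f: "f \<in> N f" unfolding N_def using e by (intro image_eqI[of _ _ "(e, e)"]) auto
      show ?thesis
      proof (intro exI[of _ "insert f S"] conjI)
        show "\<forall>x\<in>insert f S. \<forall>y\<in>insert f S. x \<noteq> y \<longrightarrow> (x <# E) \<inter> (y <# E) = {}"
          using S(2) dis by (metis Int_commute insert_iff)
      qed (use S(1,3) f in auto)
    qed
  qed
  then obtain S where S: "S \<subseteq> F" "\<forall>x\<in>S. \<forall>y\<in>S. x \<noteq> y \<longrightarrow> (x <# E) \<inter> (y <# E) = {}" "F \<subseteq> (\<Union>s\<in>S. N s)"
    by blast
  have fS: "finite S" using S(1) F finite_subset by auto
  have fN: "finite (N s)" for s using E by (auto simp: N_def)
  have "card F \<le> card (\<Union>s\<in>S. N s)" using S(3) fS fN by (intro card_mono) auto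
  also have "\<dots> \<le> (\<Sum>s\<in>S. card (N s))" using fS by (rule card_UN_le)
  also have "\<dots> \<le> (\<Sum>s\<in>S. card E * card E)"
  proof (rule sum_mono)
    fix s
    show "card (N s) \<le> card E * card E"
      unfolding N_def card_cartesian_product[symmetric] using E by (intro card_image_le) simp
  qed
  finally have "card F \<le> card S * (card E * card E)" by simp
  then show ?thesis using that S by blast
qed

text \<open>Along a Folner sequence the number of translates of \<open>E\<close> that meet \<open>F n\<close> is asymptotically
  at most \<open>card (F n)\<close>.\<close>

lemma folner_meeting_ratio:
  assumes "folner_sequence G F" and E: "finite E" "E \<subseteq> carrier G" "E \<noteq> {}"
  shows "card (meeting E (F n)) / card (F n) \<le> 1 + card (boundary G E (F n)) / card (F n)"
    and "(\<lambda>n. real (card (boundary G E (F n))) / real (card (F n))) \<longlonglongrightarrow> 0"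
proof -
  have F: "finite (F n)" "F n \<subseteq> carrier G" "F n \<noteq> {}" using assms(1) by (auto simp: folner_sequence_def)
  then have c: "card (F n) > 0" by (simp add: card_gt_0_iff)
  have "real (card (meeting E (F n))) \<le> real (card (F n)) + real (card (boundary G E (F n)))"
    using card_meeting_le[OF E F(1,2)] by linarith
  then show "card (meeting E (F n)) / card (F n) \<le> 1 + card (boundary G E (F n)) / card (F n)"
    using c by (simp add: field_simps)
  show "(\<lambda>n. real (card (boundary G E (F n))) / real (card (F n))) \<longlonglongrightarrow> 0"
    using assms by (simp add: folner_sequence_def)
qed

end

section \<open>The entropy at a submodule is an infimum\<close>

context entropy_setting
begin

text \<open>For \<open>K\<close> of finite length this is the entropy at \<open>K\<close>, by \<open>ent_at_eq\<close> below.\<close>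

definition ent_real :: "('g \<Rightarrow> 'r, 'm) module \<Rightarrow> 'm set \<Rightarrow> real" where
  "ent_real M K = (INF E\<in>{E. finite E \<and> E \<subseteq> carrier G \<and> E \<noteq> {}}. rlen (base M) (T_sum R M E K) / card E)"

lemma ent_real_le:
  assumes "finite E" "E \<subseteq> carrier G" "E \<noteq> {}"
  shows "ent_real M K \<le> rlen (base M) (T_sum R M E K) / card E"
  unfolding ent_real_def using assms by (intro cINF_lower bdd_belowI[of _ 0]) auto

lemma ent_real_le_mult:
  assumes "finite E" "E \<subseteq> carrier G" "E \<noteq> {}"
  shows "card E * ent_real M K \<le> rlen (base M) (T_sum R M E K)"
  using ent_real_le[OF assms, of M K] assms by (simp add: field_simps card_gt_0_iff)

lemma ent_real_greatest:
  fixes c :: real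
  assumes "\<And>E. finite E \<Longrightarrow> E \<subseteq> carrier G \<Longrightarrow> E \<noteq> {} \<Longrightarrow> card E * c \<le> rlen (base M) (T_sum R M E K)"
  shows "c \<le> ent_real M K"
  unfolding ent_real_def
proof (rule cINF_greatest)
  show "{E. finite E \<and> E \<subseteq> carrier G \<and> E \<noteq> {}} \<noteq> {}" using G.one_closed by (auto intro: exI[of _ "{\<one>\<^bsub>G\<^esub>}"])
  fix E assume "E \<in> {E. finite E \<and> E \<subseteq> carrier G \<and> E \<noteq> {}}"
  then have E: "finite E" "E \<subseteq> carrier G" "E \<noteq> {}" by auto
  then show "c \<le> rlen (base M) (T_sum R M E K) / card E"
    using assms[OF E] by (simp add: field_simps card_gt_0_iff)
qed

lemma ent_real_nonneg: "0 \<le> ent_real M K"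
  by (rule ent_real_greatest) simp

end

context entropy_module
begin

lemma rlen_T_translate:
  assumes "g \<in> carrier G" "F \<subseteq> carrier G" "submodule K R B"
  shows "rlen B (T (g <#\<^bsub>G\<^esub> F) K) = rlen B (T F K)"
  using rlen_act[OF assms(1) T_submodule[OF assms(2,3)]] act_T[OF assms] by simp

lemma rlen_T_mono:
  assumes "finite F" "F \<subseteq> carrier G" "fin_len B K" "submodule K' R B" "F' \<subseteq> F" "K' \<subseteq> K"
  shows "rlen B (T F' K') \<le> rlen B (T F K)"
  using assms T_submodule[of F' K'] T_mono[of F' F K' K]
  by (intro rlen_mono[OF left_module_base] fin_len_T) auto

text \<open>Shearer's inequality for \<open>S \<mapsto> L((T_S K + W) / W)\<close> and the intersections of \<open>F\<close> with the
  translates of \<open>E\<close>, which cover each point of \<open>F\<close> exactly \<open>card E\<close> times.\<close>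

lemma shearer_T:
  assumes E: "finite E" "E \<subseteq> carrier G" and F: "finite F" "F \<subseteq> carrier G"
    and K: "fin_len B K" and W: "fin_len B W"
  shows "card E * (rlen B (T F K <+>\<^bsub>B\<^esub> W) - rlen B W)
    \<le> (\<Sum>x\<in>meeting E F. rlen B (T ((x <#\<^bsub>G\<^esub> E) \<inter> F) K <+>\<^bsub>B\<^esub> W) - rlen B W)"
proof (rule submodular_exact_cover[where h = "\<lambda>S. rlen B (T S K <+>\<^bsub>B\<^esub> W) - rlen B W"])
  show "finite F" "finite (meeting E F)" using F E finite_meeting by auto
  have W': "submodule W R B" by (rule fin_lenD[OF W])
  have "{\<zero>\<^bsub>B\<^esub>} <+>\<^bsub>B\<^esub> W = W"
    using B.set_add_upper(2)[OF B.submodule_zero W'] B.set_add_least[OF W', of "{\<zero>\<^bsub>B\<^esub>}" W]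
      B.submoduleD(2)[OF W'] by auto
  then show "rlen B (T {} K <+>\<^bsub>B\<^esub> W) - rlen B W = 0" by (simp add: T_empty)
  show "card {x \<in> meeting E F. a \<in> x <#\<^bsub>G\<^esub> E} = card E" if "a \<in> F" for a
    using card_translates_through[OF E F(2) that] .
  show "(rlen B (T (S \<union> S') K <+>\<^bsub>B\<^esub> W) - rlen B W) + (rlen B (T (S \<inter> S') K <+>\<^bsub>B\<^esub> W) - rlen B W)
      \<le> (rlen B (T S K <+>\<^bsub>B\<^esub> W) - rlen B W) + (rlen B (T S' K <+>\<^bsub>B\<^esub> W) - rlen B W)"
    if S: "S \<subseteq> F" "S' \<subseteq> F" for S S'
  proof -
    have c: "finite S" "finite S'" "S \<subseteq> carrier G" "S' \<subseteq> carrier G" "S \<inter> S' \<subseteq> carrier G" "S \<union> S' \<subseteq> carrier G"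
      using S F finite_subset by auto
    note T1 = T_submodule[OF c(3) fin_lenD[OF K]] and T2 = T_submodule[OF c(4) fin_lenD[OF K]]
      and T3 = T_submodule[OF c(5) fin_lenD[OF K]] and T4 = T_submodule[OF c(6) fin_lenD[OF K]]
    let ?S = "T S K <+>\<^bsub>B\<^esub> W" and ?S' = "T S' K <+>\<^bsub>B\<^esub> W"
    have f: "fin_len B ?S" "fin_len B ?S'"
      using c by (auto intro!: fin_len_add[OF left_module_base] fin_len_T K W)
    note U1 = B.set_add_upper[OF T1 W'] and U2 = B.set_add_upper[OF T2 W']
      and U = B.set_add_upper[OF fin_lenD[OF f(1)] fin_lenD[OF f(2)]]
    have sub: "submodule (?S <+>\<^bsub>B\<^esub> ?S') R B" by (rule B.submodule_add) (rule fin_lenD[OF f(1)], rule fin_lenD[OF f(2)])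
    have "T (S \<union> S') K \<subseteq> ?S <+>\<^bsub>B\<^esub> ?S'"
      unfolding T_Un[OF c(3,4) fin_lenD[OF K]] by (rule B.set_add_mono) (fact U1 U2)+
    then have D: "T (S \<union> S') K <+>\<^bsub>B\<^esub> W \<subseteq> ?S <+>\<^bsub>B\<^esub> ?S'"
      using U1(2) U(1) by (intro B.set_add_least[OF sub]) auto
    have C: "T (S \<inter> S') K <+>\<^bsub>B\<^esub> W \<subseteq> ?S \<inter> ?S'"
      by (intro Int_greatest B.set_add_mono T_mono) auto
    have "rlen B (T (S \<union> S') K <+>\<^bsub>B\<^esub> W) + rlen B (T (S \<inter> S') K <+>\<^bsub>B\<^esub> W) \<le> rlen B ?S + rlen B ?S'"
      by (rule rlen_submodular[OF left_module_base f B.submodule_add[OF T3 W'] C B.submodule_add[OF T4 W'] D])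
    then show ?thesis by simp
  qed
qed

lemma set_add_zero: "submodule A R B \<Longrightarrow> A <+>\<^bsub>B\<^esub> {\<zero>\<^bsub>B\<^esub>} = A"
  using B.set_add_upper(1)[OF _ B.submodule_zero, of A] B.set_add_least[of A A "{\<zero>\<^bsub>B\<^esub>}"]
    B.submoduleD(2)[of A] by auto

lemma rlen_T_covering:
  assumes E: "finite E" "E \<subseteq> carrier G" and F: "finite F" "F \<subseteq> carrier G" and K: "fin_len B K"
  shows "card E * rlen B (T F K) \<le> card (meeting E F) * rlen B (T E K)"
proof -
  have add0: "rlen B (T S K <+>\<^bsub>B\<^esub> {\<zero>\<^bsub>B\<^esub>}) - rlen B {\<zero>\<^bsub>B\<^esub>} = rlen B (T S K)" if "S \<subseteq> carrier G" for S
    using set_add_zero[OF T_submodule[OF that fin_lenD[OF K]]] rlen_zero[OF left_module_base] by simp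
  have "card E * rlen B (T F K) \<le> (\<Sum>x\<in>meeting E F. rlen B (T ((x <#\<^bsub>G\<^esub> E) \<inter> F) K <+>\<^bsub>B\<^esub> {\<zero>\<^bsub>B\<^esub>}) - rlen B {\<zero>\<^bsub>B\<^esub>})"
    using shearer_T[OF E F K fin_len_zero[OF left_module_base]] unfolding add0[OF F(2)] .
  also have "\<dots> \<le> (\<Sum>x\<in>meeting E F. rlen B (T E K))"
  proof (rule sum_mono)
    fix x assume "x \<in> meeting E F"
    then have x: "x \<in> carrier G" by (simp add: meeting_def)
    have xE: "finite (x <#\<^bsub>G\<^esub> E)" "x <#\<^bsub>G\<^esub> E \<subseteq> carrier G" using x E by (auto simp: l_coset_def)
    have "rlen B (T ((x <#\<^bsub>G\<^esub> E) \<inter> F) K) \<le> rlen B (T (x <#\<^bsub>G\<^esub> E) K)"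
      using xE K by (intro rlen_T_mono) (auto simp: fin_lenD)
    also have "\<dots> = rlen B (T E K)" by (rule rlen_T_translate[OF x E(2) fin_lenD[OF K]])
    finally have le: "rlen B (T ((x <#\<^bsub>G\<^esub> E) \<inter> F) K) \<le> rlen B (T E K)" .
    have sub: "(x <#\<^bsub>G\<^esub> E) \<inter> F \<subseteq> carrier G" using F by auto
    show "rlen B (T ((x <#\<^bsub>G\<^esub> E) \<inter> F) K <+>\<^bsub>B\<^esub> {\<zero>\<^bsub>B\<^esub>}) - rlen B {\<zero>\<^bsub>B\<^esub>} \<le> rlen B (T E K)"
      using add0[OF sub] le by simp
  qed
  finally show ?thesis by simp
qed

text \<open>No term is below the infimum. Conversely, for each \<open>E\<close> the terms are at most \<open>L(T_E K) / card E\<close>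
  times the ratio of the number of translates of \<open>E\<close> that meet \<open>F n\<close> to \<open>card (F n)\<close>, and this ratio is
  at most \<open>1\<close> plus a null sequence.\<close>

lemma folner_limit:
  assumes fol: "folner_sequence G F" and K: "fin_len B K"
  shows "(\<lambda>n. rlen B (T (F n) K) / card (F n)) \<longlonglongrightarrow> ent_real M K"
proof (rule order_tendstoI)
  have F: "finite (F n)" "F n \<subseteq> carrier G" "F n \<noteq> {}" for n using fol by (auto simp: folner_sequence_def)
  fix a
  show "\<forall>\<^sub>F n in sequentially. a < rlen B (T (F n) K) / card (F n)" if "a < ent_real M K"
    using that ent_real_le[OF F] by (intro always_eventually) (auto intro: less_le_trans)
  show "\<forall>\<^sub>F n in sequentially. rlen B (T (F n) K) / card (F n) < a" if less: "ent_real M K < a"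
  proof -
    let ?I = "{E. finite E \<and> E \<subseteq> carrier G \<and> E \<noteq> {}}"
    have "{\<one>\<^bsub>G\<^esub>} \<in> ?I" by simp
    then have "?I \<noteq> {}" by blast
    moreover have "bdd_below ((\<lambda>E. rlen B (T E K) / card E) ` ?I)"
      by (intro bdd_belowI[of _ 0]) auto
    ultimately have "ent_real M K < a \<longleftrightarrow> (\<exists>E\<in>?I. rlen B (T E K) / card E < a)"
      unfolding ent_real_def by (rule cINF_less_iff)
    then obtain E where E: "finite E" "E \<subseteq> carrier G" "E \<noteq> {}" and q: "rlen B (T E K) / card E < a"
      using less by blast
    let ?b = "\<lambda>n. real (card (boundary G E (F n))) / real (card (F n))"
    have "(\<lambda>n. (1 + ?b n) * (rlen B (T E K) / card E)) \<longlonglongrightarrow> (1 + 0) * (rlen B (T E K) / card E)"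
      using folner_meeting_ratio(2)[OF fol E] by (intro tendsto_intros)
    then have "\<forall>\<^sub>F n in sequentially. (1 + ?b n) * (rlen B (T E K) / card E) < a"
      using q by (intro order_tendstoD(2)) auto
    moreover have "rlen B (T (F n) K) / card (F n) \<le> (1 + ?b n) * (rlen B (T E K) / card E)" for n
    proof -
      have c: "card E > 0" "card (F n) > 0" using E F by (auto simp: card_gt_0_iff)
      have "rlen B (T (F n) K) / card (F n) \<le> (card (meeting E (F n)) / card (F n)) * (rlen B (T E K) / card E)"
        using rlen_T_covering[OF E(1,2) F(1,2)[of n] K] c by (simp add: field_simps)
      also have "\<dots> \<le> (1 + ?b n) * (rlen B (T E K) / card E)"
        using folner_meeting_ratio(1)[OF fol E] by (intro mult_right_mono) auto
      finally show ?thesis .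
    qed
    ultimately show ?thesis by (auto elim!: eventually_mono intro: le_less_trans)
  qed
qed

lemma ent_at_eq:
  assumes K: "fin_len B K"
  shows "ent_at R G L M K = ennreal (ent_real M K)"
  unfolding ent_at_def
proof (rule the_equality)
  have lim: "(\<lambda>n. len B (T (F n) K) / of_nat (card (F n))) \<longlonglongrightarrow> ennreal (ent_real M K)"
    if fol: "folner_sequence G F" for F
  proof -
    have "len B (T (F n) K) / of_nat (card (F n)) = ennreal (rlen B (T (F n) K) / card (F n))" for n
    proof -
      have F: "finite (F n)" "F n \<subseteq> carrier G" "F n \<noteq> {}" using fol by (auto simp: folner_sequence_def)
      then have "0 < real (card (F n))" by (simp add: card_gt_0_iff)
      then show ?thesis
        using ennreal_rlen[OF fin_len_T[OF F(1,2) K]]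
        by (simp add: ennreal_of_nat_eq_real_of_nat flip: divide_ennreal)
    qed
    then show ?thesis using tendsto_ennrealI[OF folner_limit[OF fol K]] by simp
  qed
  then show "\<forall>F. folner_sequence G F \<longrightarrow> (\<lambda>n. len B (T (F n) K) / of_nat (card (F n))) \<longlonglongrightarrow> ennreal (ent_real M K)"
    by blast
  fix l assume l: "\<forall>F. folner_sequence G F \<longrightarrow> (\<lambda>n. len B (T (F n) K) / of_nat (card (F n))) \<longlonglongrightarrow> l"
  obtain F where "folner_sequence G F" using amen by (auto simp: amenable_def)
  then show "l = ennreal (ent_real M K)" using l lim LIMSEQ_unique by blast
qed

lemma Fin_L_iff: "K \<in> Fin_L R G L M \<longleftrightarrow> fin_len B K"
  by (simp add: Fin_L_def fin_len_def)

lemma ent_eq: "ent R G L M = (SUP K\<in>{K. fin_len B K}. ennreal (ent_real M K))"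
proof -
  have "Fin_L R G L M = {K. fin_len B K}" using Fin_L_iff by auto
  then show ?thesis unfolding ent_def using ent_at_eq by (intro SUP_cong) auto
qed

lemma ent_real_le_ent: "fin_len B K \<Longrightarrow> ennreal (ent_real M K) \<le> ent R G L M"
  unfolding ent_eq by (rule SUP_upper) simp

lemma ent_real_le_rlen:
  assumes K: "fin_len B K"
  shows "ent_real M K \<le> rlen B K"
proof -
  have KC: "K \<subseteq> carrier M" using B.submoduleD(1)[OF fin_lenD[OF K]] by simp
  have "act M \<one>\<^bsub>G\<^esub> ` K = K" using KC by (force simp: image_iff subset_iff)
  then have "T {\<one>\<^bsub>G\<^esub>} K = K" using T_singleton[of "\<one>\<^bsub>G\<^esub>" K] fin_lenD[OF K] by simp
  then show ?thesis using ent_real_le[of "{\<one>\<^bsub>G\<^esub>}" M K] by simp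
qed

lemma ent_real_increment:
  assumes K: "fin_len B K" and K': "submodule K' R B" "K' \<subseteq> K"
  shows "ent_real M K \<le> ent_real M K' + (rlen B K - rlen B K')"
proof -
  have "ent_real M K - (rlen B K - rlen B K') \<le> ent_real M K'"
  proof (rule ent_real_greatest)
    fix E assume E: "finite E" "E \<subseteq> carrier G" "E \<noteq> {}"
    show "card E * (ent_real M K - (rlen B K - rlen B K')) \<le> rlen B (T E K')"
      using ent_real_le_mult[OF E, of M K] rlen_T_increment[OF E(1,2) K K'] by (simp add: algebra_simps)
  qed
  then show ?thesis by simp
qed

lemma ent_real_mono:
  assumes K: "fin_len B K" and K': "submodule K' R B" "K' \<subseteq> K"
  shows "ent_real M K' \<le> ent_real M K"
proof (rule ent_real_greatest)
  fix E assume E: "finite E" "E \<subseteq> carrier G" "E \<noteq> {}"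
  then show "card E * ent_real M K' \<le> rlen B (T E K)"
    using ent_real_le_mult[OF E, of M K'] rlen_T_mono[OF E(1,2) K K'(1) subset_refl K'(2)] by simp
qed

text \<open>The submodule \<open>T_F (T_E K)\<close> lies in \<open>T_(F E) K\<close>, and along a Folner sequence \<open>F E\<close> is not much
  larger than \<open>F\<close>.\<close>

lemma ent_real_T_le:
  assumes E: "finite E" "E \<subseteq> carrier G" and K: "fin_len B K"
  shows "ent_real M (T E K) \<le> ent_real M K"
proof -
  \<comment> \<open>with \<open>\<one>\<close> in the second factor the product set contains \<open>F n\<close>\<close>
  define E1 where "E1 = insert \<one>\<^bsub>G\<^esub> E"
  define E' where "E' = m_inv G ` E1"
  have E1: "finite E1" "E1 \<subseteq> carrier G" using E by (auto simp: E1_def)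
  have E': "finite E'" "E' \<subseteq> carrier G" "E' \<noteq> {}" using E1 by (auto simp: E'_def E1_def)
  obtain F where fol: "folner_sequence G F" using amen by (auto simp: amenable_def)
  let ?b = "\<lambda>n. real (card (boundary G E' (F n))) / real (card (F n))"
  have step: "ent_real M (T E K) \<le> rlen B (T (F n) K) / card (F n) + ?b n * rlen B K" for n
  proof -
    have F: "finite (F n)" "F n \<subseteq> carrier G" "F n \<noteq> {}" using fol by (auto simp: folner_sequence_def)
    let ?D = "(F n <#>\<^bsub>G\<^esub> E1) - F n"
    have sub: "F n \<subseteq> F n <#>\<^bsub>G\<^esub> E1"
    proof
      fix x assume x: "x \<in> F n"
      then have "x = x \<otimes>\<^bsub>G\<^esub> \<one>\<^bsub>G\<^esub>" using F by auto
      then show "x \<in> F n <#>\<^bsub>G\<^esub> E1" using x unfolding set_mult_def E1_def by blast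
    qed
    have eq: "F n <#>\<^bsub>G\<^esub> E1 = meeting E' (F n)"
      using set_mult_eq_meeting[OF E1(2) F(2)] by (simp add: E'_def)
    have fin: "finite (F n <#>\<^bsub>G\<^esub> E1)" unfolding eq using finite_meeting E' F by simp
    have car: "F n <#>\<^bsub>G\<^esub> E1 \<subseteq> carrier G" unfolding eq by (auto simp: meeting_def)
    have "card ?D = card (F n <#>\<^bsub>G\<^esub> E1) - card (F n)" using sub F(1) by (simp add: card_Diff_subset)
    then have D: "card ?D \<le> card (boundary G E' (F n))"
      using card_meeting_le[OF E' F(1,2)] unfolding eq by simp
    have TE: "fin_len B (T E K)" "fin_len B (T E1 K)" using E E1 K fin_len_T by auto
    have "T (F n) (T E K) \<subseteq> T (F n) (T E1 K)" using T_mono[of E E1 K K] by (intro T_mono) (auto simp: E1_def)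
    also have "\<dots> \<subseteq> T (F n <#>\<^bsub>G\<^esub> E1) K" by (rule T_T[OF F(2) E1(2) fin_lenD[OF K]])
    finally have "rlen B (T (F n) (T E K)) \<le> rlen B (T (F n <#>\<^bsub>G\<^esub> E1) K)"
      using fin_len_T[OF F(1,2) TE(1)] fin_len_T[OF fin car K]
      by (intro rlen_mono[OF left_module_base]) (auto simp: fin_lenD)
    also have "F n <#>\<^bsub>G\<^esub> E1 = F n \<union> ?D" using sub by auto
    also have "rlen B (T (F n \<union> ?D) K) \<le> rlen B (T (F n) K) + rlen B (T ?D K)"
    proof -
      have "?D \<subseteq> carrier G" using car by auto
      then show ?thesis
        using F fin K by (subst T_Un) (auto intro!: rlen_add_le[OF left_module_base] fin_len_T fin_lenD)
    qed
    also have "rlen B (T ?D K) \<le> card ?D * rlen B K"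
      using fin car by (intro rlen_T_le K) auto
    also have "\<dots> \<le> card (boundary G E' (F n)) * rlen B K"
      using D by (intro mult_right_mono) auto
    finally have "card (F n) * ent_real M (T E K) \<le> rlen B (T (F n) K) + card (boundary G E' (F n)) * rlen B K"
      using ent_real_le_mult[OF F, of M "T E K"] by simp
    moreover have "0 < real (card (F n))" using F by (simp add: card_gt_0_iff)
    ultimately show ?thesis by (simp add: field_simps)
  qed
  have "(\<lambda>n. rlen B (T (F n) K) / card (F n) + ?b n * rlen B K) \<longlonglongrightarrow> ent_real M K + 0 * rlen B K"
    using folner_limit[OF fol K] folner_meeting_ratio(2)[OF fol E'] by (intro tendsto_intros)
  then show ?thesis using step by (intro LIMSEQ_le_const) auto
qed

end

section \<open>Entropy is a length function\<close>

context entropy_setting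
begin

lemma entropy_moduleI: "left_module RG M \<Longrightarrow> entropy_module R G \<sigma> \<rho> L M"
  by (simp add: entropy_module_def crossed_module_def lmodule_def entropy_setting_axioms crossed_system_axioms)

lemma base_left_module: "left_module RG M \<Longrightarrow> left_module R (base M)"
  by (rule left_module_restrict_scalars[OF R.ring_axioms _ cp_monom_hom])

lemma base_left_module_hom:
  "left_module RG M \<Longrightarrow> left_module RG N \<Longrightarrow> f \<in> mod_hom RG M N \<Longrightarrow> left_module_hom R (base M) (base N) f"
  by (simp add: left_module_hom_def left_module_hom_axioms_def lmodule_def base_left_module base_hom)

lemma lFin_iff:
  fixes M :: "('g \<Rightarrow> 'r, 'm) module"
  shows "M \<in> lFin_L R G \<sigma> \<rho> L \<longleftrightarrow>
    left_module RG M \<and> (\<forall>K. fg_submodule K R (base M) \<longrightarrow> fin_len (base M) K)"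
  using lmodule.fg_submodule_submodule[of R "base M"] base_left_module[of M]
  by (auto simp: lFin_L_def R_Mod_def fin_len_def lmodule_def)

text \<open>Preimages of the generators of \<open>K\<close> generate \<open>K'\<close>.\<close>

lemma fg_submodule_lift:
  fixes B C :: "('g \<Rightarrow> 'r, 'm) module"
  assumes B: "left_module RG B" and C: "left_module RG C" and g: "g \<in> mod_hom RG B C"
    and surj: "g ` carrier B = carrier C" and K: "fg_submodule K R (base C)"
  obtains K' where "fg_submodule K' R (base B)" "K = g ` K'"
proof -
  interpret g: left_module_hom R "base B" "base C" g by (rule base_left_module_hom[OF B C g])
  obtain S where S: "finite S" "S \<subseteq> carrier C" "K = mod_span R (base C) S"
    using K by (auto simp: fg_submodule_def)
  obtain S' where S': "S' \<subseteq> carrier B" "finite S'" "S = g ` S'"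
    using finite_subset_image[OF S(1)] S(2) surj by metis
  have "K = g ` mod_span R (base B) S'" using g.span_image[of S'] S S' by simp
  moreover have "fg_submodule (mod_span R (base B) S') R (base B)"
    using S' by (auto simp: fg_submodule_def)
  ultimately show ?thesis using that by blast
qed

lemma lFin_sub:
  fixes A B :: "('g \<Rightarrow> 'r, 'm) module"
  assumes B: "B \<in> lFin_L R G \<sigma> \<rho> L" and A: "left_module RG A"
    and f: "f \<in> mod_hom RG A B" "inj_on f (carrier A)"
  shows "A \<in> lFin_L R G \<sigma> \<rho> L"
proof -
  have B': "left_module RG B" using B by (simp add: lFin_iff)
  interpret f: left_module_hom R "base A" "base B" f by (rule base_left_module_hom[OF A B' f(1)])
  have "fin_len (base A) K" if fg: "fg_submodule K R (base A)" for K
  proof -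
    obtain S where S: "finite S" "S \<subseteq> carrier A" "K = mod_span R (base A) S"
      using fg by (auto simp: fg_submodule_def)
    have K: "submodule K R (base A)" using f.V.fg_submodule_submodule[OF fg] .
    then have "inj_on f K" using f.V.submoduleD(1) f(2) by (auto intro: inj_on_subset)
    have "f ` K = mod_span R (base B) (f ` S)" using f.span_image[of S] S by simp
    moreover have "f ` S \<subseteq> carrier (base B)" "finite (f ` S)" using S f.closed by auto
    ultimately have "fg_submodule (f ` K) R (base B)" unfolding fg_submodule_def by blast
    then have "fin_len (base B) (f ` K)" using B by (simp add: lFin_iff)
    then show ?thesis
      using len_image_inj[OF base_left_module[OF A] base_left_module[OF B'] base_hom[OF f(1)] K \<open>inj_on f K\<close>] K
      by (simp add: fin_len_def)
  qed
  then show ?thesis using A by (simp add: lFin_iff)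
qed

lemma lFin_quot:
  fixes B C :: "('g \<Rightarrow> 'r, 'm) module"
  assumes B: "B \<in> lFin_L R G \<sigma> \<rho> L" and C: "left_module RG C"
    and g: "g \<in> mod_hom RG B C" and surj: "g ` carrier B = carrier C"
  shows "C \<in> lFin_L R G \<sigma> \<rho> L"
proof -
  have B': "left_module RG B" using B by (simp add: lFin_iff)
  have "fin_len (base C) K" if K: "fg_submodule K R (base C)" for K
  proof -
    obtain K' where K': "fg_submodule K' R (base B)" "K = g ` K'"
      by (rule fg_submodule_lift[OF B' C g surj K])
    then show ?thesis
      using fin_len_image[OF base_left_module[OF B'] base_left_module[OF C] base_hom[OF g]] B
      by (simp add: lFin_iff)
  qed
  then show ?thesis using C by (simp add: lFin_iff)
qed

lemma fin_len_image_inj_iff: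
  fixes A B :: "('g \<Rightarrow> 'r, 'm) module"
  assumes A: "left_module RG A" and B: "left_module RG B"
    and f: "f \<in> mod_hom RG A B" "inj_on f (carrier A)" and K: "submodule K R (base A)"
  shows "fin_len (base B) (f ` K) \<longleftrightarrow> fin_len (base A) K" "rlen (base B) (f ` K) = rlen (base A) K"
proof -
  interpret f: left_module_hom R "base A" "base B" f by (rule base_left_module_hom[OF A B f(1)])
  have "inj_on f K" using f.V.submoduleD(1)[OF K] f(2) by (auto intro: inj_on_subset)
  then have eq: "len (base B) (f ` K) = len (base A) K"
    using len_image_inj[OF base_left_module[OF A] base_left_module[OF B] base_hom[OF f(1)] K] by simp
  then show "fin_len (base B) (f ` K) \<longleftrightarrow> fin_len (base A) K"
    using K f.submodule_image[OF K] by (simp add: fin_len_def)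
  show "rlen (base B) (f ` K) = rlen (base A) K" using eq by (simp add: rlen_def)
qed

lemma ent_real_image_inj:
  fixes A B :: "('g \<Rightarrow> 'r, 'm) module"
  assumes A: "left_module RG A" and B: "left_module RG B"
    and f: "f \<in> mod_hom RG A B" "inj_on f (carrier A)" and K: "submodule K R (base A)"
  shows "ent_real B (f ` K) = ent_real A K"
proof -
  interpret A: entropy_module R G \<sigma> \<rho> L A by (rule entropy_moduleI[OF A])
  show ?thesis
    unfolding ent_real_def
  proof (rule INF_cong[OF refl])
    fix E assume "E \<in> {E. finite E \<and> E \<subseteq> carrier G \<and> E \<noteq> {}}"
    then have E: "E \<subseteq> carrier G" by simp
    show "rlen (base B) (T_sum R B E (f ` K)) / card E = rlen (base A) (T_sum R A E K) / card E"
      using fin_len_image_inj_iff(2)[OF A B f A.T_submodule[OF E K]] T_image_hom[OF A B f(1) E K] by simp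
  qed
qed

lemma submodule_in_image:
  fixes A B :: "('g \<Rightarrow> 'r, 'm) module"
  assumes A: "left_module RG A" and B: "left_module RG B"
    and f: "f \<in> mod_hom RG A B" and K: "submodule K R (base B)" "K \<subseteq> f ` carrier A"
  obtains K' where "submodule K' R (base A)" "f ` K' = K"
proof -
  interpret f: left_module_hom R "base A" "base B" f by (rule base_left_module_hom[OF A B f])
  have "f ` {x \<in> carrier A. f x \<in> K} = K" using K(2) by auto
  then show ?thesis using that f.submodule_preimage[OF K(1)] by simp
qed

lemma ent_le_image_inj:
  fixes A B :: "('g \<Rightarrow> 'r, 'm) module"
  assumes A: "left_module RG A" and B: "left_module RG B"
    and f: "f \<in> mod_hom RG A B" "inj_on f (carrier A)"
  shows "ent R G L A \<le> ent R G L B"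
proof -
  interpret A: entropy_module R G \<sigma> \<rho> L A by (rule entropy_moduleI[OF A])
  interpret B: entropy_module R G \<sigma> \<rho> L B by (rule entropy_moduleI[OF B])
  show ?thesis
    unfolding A.ent_eq
  proof (rule SUP_least)
    fix K assume "K \<in> {K. fin_len (base A) K}"
    then have K: "fin_len (base A) K" by simp
    show "ennreal (ent_real A K) \<le> ent R G L B"
      using B.ent_real_le_ent[of "f ` K"] fin_len_image_inj_iff(1)[OF A B f fin_lenD[OF K]] K
        ent_real_image_inj[OF A B f fin_lenD[OF K]] by simp
  qed
qed

lemma ent_iso:
  fixes A B :: "('g \<Rightarrow> 'r, 'm) module"
  assumes A: "left_module RG A" and B: "left_module RG B" and iso: "mod_isomorphic RG A B"
  shows "ent R G L A = ent R G L B"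
proof (rule antisym)
  obtain f where f: "f \<in> mod_hom RG A B" "inj_on f (carrier A)" "f ` carrier A = carrier B"
    using iso by (auto simp: mod_isomorphic_def bij_betw_def)
  interpret A: entropy_module R G \<sigma> \<rho> L A by (rule entropy_moduleI[OF A])
  interpret B: entropy_module R G \<sigma> \<rho> L B by (rule entropy_moduleI[OF B])
  show "ent R G L A \<le> ent R G L B" by (rule ent_le_image_inj[OF A B f(1,2)])
  show "ent R G L B \<le> ent R G L A"
    unfolding B.ent_eq
  proof (rule SUP_least)
    fix K assume "K \<in> {K. fin_len (base B) K}"
    then have K: "fin_len (base B) K" by simp
    have "K \<subseteq> f ` carrier A" using B.B.submoduleD(1)[OF fin_lenD[OF K]] f(3) by simp
    then obtain K' where K': "submodule K' R (base A)" "f ` K' = K"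
      by (rule submodule_in_image[OF A B f(1) fin_lenD[OF K]])
    show "ennreal (ent_real B K) \<le> ent R G L A"
      using A.ent_real_le_ent[of K'] fin_len_image_inj_iff(1)[OF A B f(1,2) K'(1)] K K'(2)
        ent_real_image_inj[OF A B f(1,2) K'(1)] by simp
  qed
qed

lemma ent_zero_module:
  fixes M :: "('g \<Rightarrow> 'r, 'm) module"
  assumes M: "left_module RG M" and zero: "carrier M = {\<zero>\<^bsub>M\<^esub>}"
  shows "ent R G L M = 0"
proof -
  interpret M: entropy_module R G \<sigma> \<rho> L M by (rule entropy_moduleI[OF M])
  have "ennreal (ent_real M K) \<le> 0" if K: "fin_len (base M) K" for K
  proof -
    have "K = {\<zero>\<^bsub>base M\<^esub>}"
      using M.B.submoduleD(1,2)[OF fin_lenD[OF K]] zero by auto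
    then have "ent_real M K \<le> 0"
      using M.ent_real_le_rlen[OF K] rlen_zero[OF M.left_module_base] by simp
    then show ?thesis by (simp add: ennreal_neg)
  qed
  then have "ent R G L M \<le> 0" unfolding M.ent_eq by (intro SUP_least) simp
  then show ?thesis by simp
qed

subsection \<open>Additivity\<close>

text \<open>The part of \<open>T_E K\<close> in the kernel of \<open>g\<close> contains \<open>f (T_E K1)\<close>, and its image under \<open>g\<close> is
  \<open>T_E (g K)\<close>, which contains \<open>T_E K2\<close>.\<close>

lemma ent_real_superadditive:
  fixes A B C :: "('g \<Rightarrow> 'r, 'm) module"
  assumes A: "left_module RG A" and B: "left_module RG B" and C: "left_module RG C"
    and f: "f \<in> mod_hom RG A B" "inj_on f (carrier A)" and g: "g \<in> mod_hom RG B C"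
    and gf: "\<And>x. x \<in> carrier A \<Longrightarrow> g (f x) = \<zero>\<^bsub>C\<^esub>"
    and K: "fin_len (base B) K" and K1: "submodule K1 R (base A)" "f ` K1 \<subseteq> K"
    and K2: "submodule K2 R (base C)" "K2 \<subseteq> g ` K"
  shows "ent_real A K1 + ent_real C K2 \<le> ent_real B K"
proof (rule ent_real_greatest)
  interpret A: entropy_module R G \<sigma> \<rho> L A by (rule entropy_moduleI[OF A])
  interpret B: entropy_module R G \<sigma> \<rho> L B by (rule entropy_moduleI[OF B])
  interpret C: entropy_module R G \<sigma> \<rho> L C by (rule entropy_moduleI[OF C])
  interpret f: left_module_hom R "base A" "base B" f by (rule base_left_module_hom[OF A B f(1)])
  interpret g: left_module_hom R "base B" "base C" g by (rule base_left_module_hom[OF B C g])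
  fix E assume E: "finite E" "E \<subseteq> carrier G" "E \<noteq> {}"
  let ?N = "{x \<in> B.T E K. g x = \<zero>\<^bsub>base C\<^esub>}"
  have TK: "fin_len (base B) (B.T E K)" by (rule B.fin_len_T[OF E(1,2) K])
  have TA: "submodule (A.T E K1) R (base A)" by (rule A.T_submodule[OF E(2) K1(1)])
  have N: "?N = B.T E K \<inter> {x \<in> carrier (base B). g x = \<zero>\<^bsub>base C\<^esub>}"
    using B.B.submoduleD(1)[OF fin_lenD[OF TK]] by auto
  have Nf: "fin_len (base B) ?N"
    unfolding N by (rule fin_len_Int[OF B.left_module_base TK g.submodule_kernel])
  have "f ` A.T E K1 = B.T E (f ` K1)" by (rule T_image_hom[OF A B f(1) E(2) K1(1)])
  also have "\<dots> \<subseteq> B.T E K" by (rule B.T_mono[OF subset_refl K1(2)])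
  finally have "f ` A.T E K1 \<subseteq> ?N" using gf A.B.submoduleD(1)[OF TA] by auto
  then have "rlen (base B) (f ` A.T E K1) \<le> rlen (base B) ?N"
    using f.submodule_image[OF TA] Nf by (intro rlen_mono[OF B.left_module_base])
  then have 1: "rlen (base A) (A.T E K1) \<le> rlen (base B) ?N"
    using fin_len_image_inj_iff(2)[OF A B f TA] by simp
  have gT: "g ` B.T E K = C.T E (g ` K)" by (rule T_image_hom[OF B C g E(2) fin_lenD[OF K]])
  have gK: "fin_len (base C) (g ` K)"
    by (rule fin_len_image[OF B.left_module_base C.left_module_base base_hom[OF g] K])
  have 2: "rlen (base C) (C.T E K2) \<le> rlen (base C) (g ` B.T E K)"
    unfolding gT by (rule C.rlen_T_mono[OF E(1,2) gK K2(1) subset_refl K2(2)])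
  have 3: "rlen (base B) (B.T E K) = rlen (base B) ?N + rlen (base C) (g ` B.T E K)"
    by (rule rlen_exact[OF B.left_module_base C.left_module_base base_hom[OF g] TK])
  show "card E * (ent_real A K1 + ent_real C K2) \<le> rlen (base B) (B.T E K)"
    using 1 2 3 ent_real_le_mult[OF E, of A K1] ent_real_le_mult[OF E, of C K2]
    by (simp add: distrib_left)
qed

text \<open>Let \<open>K1\<close> be the part of \<open>T_E K\<close> in the kernel, and let \<open>W = T_F K1\<close>. For a translate \<open>x E\<close>
  inside \<open>F\<close> the submodule \<open>x K1\<close> lies in \<open>W\<close>, so that \<open>T_{x E} K\<close> contributes to \<open>(T_F K + W) / W\<close>
  at most \<open>L(T_E K) - L(K1) = L(T_E (g K))\<close>. Shearer's inequality adds these contributions up; the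
  translates that leave \<open>F\<close> are negligible. That \<open>\<one> \<in> E\<close> ensures \<open>x \<in> F\<close>.\<close>

lemma ent_real_subadditive:
  fixes B C :: "('g \<Rightarrow> 'r, 'm) module"
  assumes B: "left_module RG B" and C: "left_module RG C" and g: "g \<in> mod_hom RG B C"
    and K: "fin_len (base B) K" and E: "finite E" "E \<subseteq> carrier G" "\<one>\<^bsub>G\<^esub> \<in> E"
  defines "K1 \<equiv> {x \<in> T_sum R B E K. g x = \<zero>\<^bsub>C\<^esub>}"
  shows "fin_len (base B) K1"
    and "ent_real B K \<le> ent_real B K1 + rlen (base C) (T_sum R C E (g ` K)) / card E"
proof -
  interpret B: entropy_module R G \<sigma> \<rho> L B by (rule entropy_moduleI[OF B])
  interpret C: entropy_module R G \<sigma> \<rho> L C by (rule entropy_moduleI[OF C])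
  interpret g: left_module_hom R "base B" "base C" g by (rule base_left_module_hom[OF B C g])
  have E0: "E \<noteq> {}" using E(3) by auto
  have cE: "0 < real (card E)" using E E0 by (simp add: card_gt_0_iff)
  let ?p = "rlen (base B) (B.T E K)" and ?q = "rlen (base C) (C.T E (g ` K))"
  have TE: "fin_len (base B) (B.T E K)" by (rule B.fin_len_T[OF E(1,2) K])
  have "K1 = B.T E K \<inter> {x \<in> carrier (base B). g x = \<zero>\<^bsub>base C\<^esub>}"
    using B.B.submoduleD(1)[OF fin_lenD[OF TE]] by (auto simp: K1_def)
  then show K1: "fin_len (base B) K1"
    using fin_len_Int[OF B.left_module_base TE g.submodule_kernel] by simp
  have "?p = rlen (base B) K1 + rlen (base C) (g ` B.T E K)"
    unfolding K1_def using rlen_exact[OF B.left_module_base C.left_module_base base_hom[OF g] TE] by simp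
  then have q: "?q = ?p - rlen (base B) K1"
    using T_image_hom[OF B C g E(2) fin_lenD[OF K]] by simp
  obtain F where fol: "folner_sequence G F" using amen by (auto simp: amenable_def)
  let ?b = "\<lambda>n. real (card (boundary G E (F n))) / real (card (F n))"
  have step: "rlen (base B) (B.T (F n) K) / card (F n)
      \<le> rlen (base B) (B.T (F n) K1) / card (F n) + ((1 + ?b n) * ?q + ?b n * ?p) / card E" for n
  proof -
    have F: "finite (F n)" "F n \<subseteq> carrier G" "F n \<noteq> {}" using fol by (auto simp: folner_sequence_def)
    have cF: "0 < real (card (F n))" using F by (simp add: card_gt_0_iff)
    define W where "W = B.T (F n) K1"
    have W: "fin_len (base B) W" unfolding W_def by (rule B.fin_len_T[OF F(1,2) K1])
    have bound: "rlen (base B) (B.T ((x <#\<^bsub>G\<^esub> E) \<inter> F n) K <+>\<^bsub>base B\<^esub> W) - rlen (base B) W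
        \<le> ?q + (if x \<in> boundary G E (F n) then ?p else 0)" if x: "x \<in> meeting E (F n)" for x
    proof -
      have xc: "x \<in> carrier G" using x by (simp add: meeting_def)
      have xE: "finite (x <#\<^bsub>G\<^esub> E)" "x <#\<^bsub>G\<^esub> E \<subseteq> carrier G" using xc E by (auto simp: l_coset_def)
      let ?A = "B.T ((x <#\<^bsub>G\<^esub> E) \<inter> F n) K"
      have A: "fin_len (base B) ?A" using F by (intro B.fin_len_T K) auto
      have Ap: "rlen (base B) ?A \<le> ?p"
        using B.rlen_T_mono[OF xE K fin_lenD[OF K], of "(x <#\<^bsub>G\<^esub> E) \<inter> F n"]
          B.rlen_T_translate[OF xc E(2) fin_lenD[OF K]] by simp
      show ?thesis
      proof (cases "x \<in> boundary G E (F n)")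
        case True
        then show ?thesis
          using rlen_add_le[OF B.left_module_base A W] Ap rlen_nonneg[of "base C" "C.T E (g ` K)"]
          by (simp del: rlen_nonneg)
      next
        case False
        then have sub: "x <#\<^bsub>G\<^esub> E \<subseteq> F n" using x by (auto simp: boundary_def meeting_def)
        have "x \<otimes>\<^bsub>G\<^esub> \<one>\<^bsub>G\<^esub> \<in> x <#\<^bsub>G\<^esub> E" using E(3) unfolding l_coset_def by blast
        then have xF: "x \<in> F n" using sub xc by auto
        have "K1 \<subseteq> B.T E K" by (auto simp: K1_def)
        then have "act B x ` K1 \<subseteq> B.T (x <#\<^bsub>G\<^esub> E) K"
          using B.act_T[OF xc E(2) fin_lenD[OF K]] by auto
        moreover have "act B x ` K1 \<subseteq> W"
          unfolding W_def using B.T_superset[OF F(2) _ xF] B.B.submoduleD(1)[OF fin_lenD[OF K1]] by simp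
        ultimately have "act B x ` K1 \<subseteq> ?A \<inter> W" using sub by (simp add: Int_absorb2)
        then have "rlen (base B) (act B x ` K1) \<le> rlen (base B) (?A \<inter> W)"
          using B.submodule_act[OF xc fin_lenD[OF K1]] fin_len_Int[OF B.left_module_base A fin_lenD[OF W]]
          by (intro rlen_mono[OF B.left_module_base])
        then have "rlen (base B) K1 \<le> rlen (base B) (?A \<inter> W)"
          using B.rlen_act[OF xc fin_lenD[OF K1]] by simp
        then show ?thesis
          using rlen_modular[OF B.left_module_base A W] Ap q False by simp
      qed
    qed
    have bsub: "boundary G E (F n) \<subseteq> meeting E (F n)" by (auto simp: boundary_def meeting_def)
    have fm: "finite (meeting E (F n))" by (rule finite_meeting[OF E(1) F(1) E(2) F(2)])
    have "card E * (rlen (base B) (B.T (F n) K) - rlen (base B) W)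
      \<le> card E * (rlen (base B) (B.T (F n) K <+>\<^bsub>base B\<^esub> W) - rlen (base B) W)"
      using B.B.set_add_upper(1)[OF B.T_submodule[OF F(2) fin_lenD[OF K]] fin_lenD[OF W]]
      by (intro mult_left_mono diff_right_mono rlen_mono[OF B.left_module_base]
          B.T_submodule[OF F(2) fin_lenD[OF K]] fin_len_add[OF B.left_module_base] B.fin_len_T F K W) auto
    also have "\<dots> \<le> (\<Sum>x\<in>meeting E (F n). rlen (base B) (B.T ((x <#\<^bsub>G\<^esub> E) \<inter> F n) K <+>\<^bsub>base B\<^esub> W) - rlen (base B) W)"
      by (rule B.shearer_T[OF E(1,2) F(1,2) K W])
    also have "\<dots> \<le> (\<Sum>x\<in>meeting E (F n). ?q + (if x \<in> boundary G E (F n) then ?p else 0))"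
      by (rule sum_mono) (rule bound)
    also have "\<dots> = card (meeting E (F n)) * ?q + card (boundary G E (F n)) * ?p"
      using fm bsub by (simp add: sum.distrib sum.If_cases Int_absorb1)
    also have "\<dots> \<le> (card (F n) + card (boundary G E (F n))) * ?q + card (boundary G E (F n)) * ?p"
      using card_meeting_le[OF E(1,2) E0 F(1,2)] by (intro add_right_mono mult_right_mono) (auto simp flip: of_nat_add)
    also have "\<dots> = card (F n) * ((1 + ?b n) * ?q + ?b n * ?p)"
      using cF by (simp add: field_simps)
    finally have "card E * (rlen (base B) (B.T (F n) K) - rlen (base B) W)
      \<le> card (F n) * ((1 + ?b n) * ?q + ?b n * ?p)" .
    then have "rlen (base B) (B.T (F n) K) - rlen (base B) W
      \<le> card (F n) * (((1 + ?b n) * ?q + ?b n * ?p) / card E)"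
      using cE by (simp add: pos_le_divide_eq mult.commute)
    then have "(rlen (base B) (B.T (F n) K) - rlen (base B) W) / card (F n)
      \<le> ((1 + ?b n) * ?q + ?b n * ?p) / card E"
      using cF by (simp add: pos_divide_le_eq mult.commute)
    then show ?thesis unfolding W_def by (simp add: diff_divide_distrib)
  qed
  have "(\<lambda>n. rlen (base B) (B.T (F n) K1) / card (F n) + ((1 + ?b n) * ?q + ?b n * ?p) / card E)
      \<longlonglongrightarrow> ent_real B K1 + ((1 + 0) * ?q + 0 * ?p) / card E"
    using B.folner_limit[OF fol K1] folner_meeting_ratio(2)[OF fol E(1,2) E0] cE
    by (intro tendsto_intros) auto
  moreover have "(\<lambda>n. rlen (base B) (B.T (F n) K) / card (F n)) \<longlonglongrightarrow> ent_real B K"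
    by (rule B.folner_limit[OF fol K])
  ultimately have "ent_real B K \<le> ent_real B K1 + ((1 + 0) * ?q + 0 * ?p) / card E"
    using step by (intro LIMSEQ_le) auto
  then show "ent_real B K \<le> ent_real B K1 + ?q / card E" by simp
qed

lemma ent_additive_le:
  fixes A B C :: "('g \<Rightarrow> 'r, 'm) module"
  assumes A: "left_module RG A" and B: "left_module RG B" and C: "left_module RG C"
    and ex: "short_exact RG A f B g C"
  shows "ent R G L B \<le> ent R G L A + ent R G L C"
proof (cases "ent R G L A = \<infinity>")
  case True
  then show ?thesis by simp
next
  case False
  interpret A: entropy_module R G \<sigma> \<rho> L A by (rule entropy_moduleI[OF A])
  interpret B: entropy_module R G \<sigma> \<rho> L B by (rule entropy_moduleI[OF B])
  interpret C: entropy_module R G \<sigma> \<rho> L C by (rule entropy_moduleI[OF C])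
  have f: "f \<in> mod_hom RG A B" "inj_on f (carrier A)" and g: "g \<in> mod_hom RG B C"
    and ker: "f ` carrier A = {b \<in> carrier B. g b = \<zero>\<^bsub>C\<^esub>}"
    using ex by (auto simp: short_exact_def)
  define a where "a = enn2real (ent R G L A)"
  have a: "ent R G L A = ennreal a" "0 \<le> a" using False by (simp_all add: a_def less_top)
  show ?thesis
    unfolding B.ent_eq
  proof (rule SUP_least)
    fix K assume "K \<in> {K. fin_len (base B) K}"
    then have K: "fin_len (base B) K" by simp
    have gK: "fin_len (base C) (g ` K)"
      by (rule fin_len_image[OF B.left_module_base C.left_module_base base_hom[OF g] K])
    have one: "ent_real B K \<le> a + rlen (base C) (C.T E (g ` K)) / card E"
      if E: "finite E" "E \<subseteq> carrier G" "\<one>\<^bsub>G\<^esub> \<in> E" for E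
    proof -
      let ?K1 = "{x \<in> B.T E K. g x = \<zero>\<^bsub>C\<^esub>}"
      note sub = ent_real_subadditive[OF B C g K E]
      have "?K1 \<subseteq> f ` carrier A"
        unfolding ker using B.B.submoduleD(1)[OF fin_lenD[OF B.fin_len_T[OF E(1,2) K]]] by auto
      then obtain K' where K': "submodule K' R (base A)" "f ` K' = ?K1"
        by (rule submodule_in_image[OF A B f(1) fin_lenD[OF sub(1)]])
      have "fin_len (base A) K'" using fin_len_image_inj_iff(1)[OF A B f K'(1)] K'(2) sub(1) by simp
      then have "ennreal (ent_real A K') \<le> ennreal a" using A.ent_real_le_ent a by simp
      moreover have "ent_real B ?K1 = ent_real A K'" using ent_real_image_inj[OF A B f K'(1)] K'(2) by simp
      ultimately show ?thesis using sub(2) a(2) by (simp add: ennreal_le_iff)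
    qed
    have "ent_real B K - a \<le> ent_real C (g ` K)"
    proof (rule ent_real_greatest)
      fix E assume E: "finite E" "E \<subseteq> carrier G" "E \<noteq> {}"
      then obtain e where e: "e \<in> E" "e \<in> carrier G" by blast
      \<comment> \<open>translating \<open>E\<close> by the inverse of one of its elements puts \<open>\<one>\<close> into it\<close>
      let ?E = "inv\<^bsub>G\<^esub> e <#\<^bsub>G\<^esub> E"
      have ie: "inv\<^bsub>G\<^esub> e \<in> carrier G" using e by simp
      have eq: "?E = (\<lambda>x. inv\<^bsub>G\<^esub> e \<otimes>\<^bsub>G\<^esub> x) ` E" by (auto simp: l_coset_def)
      have "inv\<^bsub>G\<^esub> e \<otimes>\<^bsub>G\<^esub> e \<in> ?E" unfolding eq using e by blast
      then have E': "finite ?E" "?E \<subseteq> carrier G" "\<one>\<^bsub>G\<^esub> \<in> ?E" using E e ie by (auto simp: eq)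
      have "inj_on (\<lambda>x. inv\<^bsub>G\<^esub> e \<otimes>\<^bsub>G\<^esub> x) E" using E ie by (intro inj_onI) (auto simp: subset_iff)
      then have card: "card ?E = card E" unfolding eq by (rule card_image)
      have "ent_real B K - a \<le> rlen (base C) (C.T E (g ` K)) / card E"
        using one[OF E'] C.rlen_T_translate[OF ie E(2) fin_lenD[OF gK]] by (simp add: card)
      moreover have "0 < real (card E)" using E by (simp add: card_gt_0_iff)
      ultimately show "card E * (ent_real B K - a) \<le> rlen (base C) (C.T E (g ` K))"
        by (simp add: pos_le_divide_eq mult.commute)
    qed
    then have "ennreal (ent_real B K) \<le> ennreal (a + ent_real C (g ` K))" by (intro ennreal_leI) simp
    also have "\<dots> = ent R G L A + ennreal (ent_real C (g ` K))"
      using a ent_real_nonneg by simp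
    also have "\<dots> \<le> ent R G L A + ent R G L C"
      using C.ent_real_le_ent[OF gK] by (rule add_left_mono)
    finally show "ennreal (ent_real B K) \<le> ent R G L A + ent R G L C" .
  qed
qed

lemma ent_additive_ge:
  fixes A B C :: "('g \<Rightarrow> 'r, 'm) module"
  assumes A: "left_module RG A" and B: "B \<in> lFin_L R G \<sigma> \<rho> L" and C: "left_module RG C"
    and ex: "short_exact RG A f B g C"
  shows "ent R G L A + ent R G L C \<le> ent R G L B"
proof -
  have B': "left_module RG B" using B by (simp add: lFin_iff)
  interpret A: entropy_module R G \<sigma> \<rho> L A by (rule entropy_moduleI[OF A])
  interpret B: entropy_module R G \<sigma> \<rho> L B by (rule entropy_moduleI[OF B'])
  interpret C: entropy_module R G \<sigma> \<rho> L C by (rule entropy_moduleI[OF C])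
  have f: "f \<in> mod_hom RG A B" "inj_on f (carrier A)" and g: "g \<in> mod_hom RG B C"
    and surj: "g ` carrier B = carrier C" and ker: "f ` carrier A = {b \<in> carrier B. g b = \<zero>\<^bsub>C\<^esub>}"
    using ex by (auto simp: short_exact_def)
  have gf: "g (f x) = \<zero>\<^bsub>C\<^esub>" if "x \<in> carrier A" for x using ker that by auto
  have main: "ennreal (ent_real A K1) + ennreal (ent_real C K2) \<le> ent R G L B"
    if K1: "fin_len (base A) K1" and K2: "fin_len (base C) K2" for K1 K2
  proof (rule ennreal_le_epsilon)
    fix e :: real assume e: "0 < e"
    \<comment> \<open>\<open>K2\<close> need not be the image of a submodule of finite length, but a finitely generated one is\<close>
    note D = directed_fg[OF C.left_module_base fin_lenD[OF K2]]
    obtain Y where Y: "fg_submodule Y R (base C)" "Y \<subseteq> K2" "rlen (base C) K2 \<le> rlen (base C) (K2 \<inter> Y) + e"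
      using rlen_approx_directed[OF C.left_module_base K2 D(1-3) equalityD1[OF D(4)] e] by blast
    obtain K' where K': "fg_submodule K' R (base B)" "Y = g ` K'"
      by (rule fg_submodule_lift[OF B' C g surj Y(1)])
    have K'f: "fin_len (base B) K'" using B K' by (simp add: lFin_iff)
    have fK: "fin_len (base B) (f ` K1)" using fin_len_image_inj_iff(1)[OF A B' f fin_lenD[OF K1]] K1 by simp
    let ?K = "K' <+>\<^bsub>base B\<^esub> f ` K1"
    have K: "fin_len (base B) ?K" by (rule fin_len_add[OF B.left_module_base K'f fK])
    note up = B.B.set_add_upper[OF fin_lenD[OF K'f] fin_lenD[OF fK]]
    have Ysub: "submodule Y R (base C)" using C.B.fg_submodule_submodule[OF Y(1)] .
    have "ent_real A K1 + ent_real C Y \<le> ent_real B ?K"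
      using up K'(2) by (intro ent_real_superadditive[OF A B' C f g gf K fin_lenD[OF K1] _ Ysub]) auto
    moreover have "ent_real C K2 \<le> ent_real C Y + e"
      using C.ent_real_increment[OF K2 Ysub Y(2)] Y(2,3) by (simp add: Int_absorb1)
    ultimately have "ent_real A K1 + ent_real C K2 \<le> ent_real B ?K + e" by simp
    then have "ennreal (ent_real A K1 + ent_real C K2) \<le> ennreal (ent_real B ?K + e)" by (rule ennreal_leI)
    then have "ennreal (ent_real A K1) + ennreal (ent_real C K2) \<le> ennreal (ent_real B ?K) + ennreal e"
      using ent_real_nonneg e by simp
    also have "\<dots> \<le> ent R G L B + ennreal e" using B.ent_real_le_ent[OF K] by (rule add_right_mono)
    finally show "ennreal (ent_real A K1) + ennreal (ent_real C K2) \<le> ent R G L B + ennreal e" .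
  qed
  have nA: "{K. fin_len (base A) K} \<noteq> {}" and nC: "{K. fin_len (base C) K} \<noteq> {}"
    using fin_len_zero[OF A.left_module_base] fin_len_zero[OF C.left_module_base] by blast+
  have "ennreal (ent_real A K1) + ent R G L C \<le> ent R G L B" if "fin_len (base A) K1" for K1
    unfolding C.ent_eq ennreal_SUP_add_right[OF nC] using main[OF that] by (intro SUP_least) simp
  then show ?thesis
    unfolding A.ent_eq ennreal_SUP_add_left[OF nA, symmetric] by (intro SUP_least) simp
qed

subsection \<open>Upper continuity\<close>

text \<open>A submodule \<open>K\<close> of finite length meets some member of the family in all but \<open>\<epsilon>\<close> of its length,
  and this loses at most \<open>\<epsilon>\<close> of its entropy.\<close>

lemma ent_upper_continuous:
  fixes M :: "('g \<Rightarrow> 'r, 'm) module"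
  assumes M: "left_module RG M" and D: "\<D> \<noteq> {}" "\<And>Y. Y \<in> \<D> \<Longrightarrow> submodule Y RG M"
    "\<And>Y Z. Y \<in> \<D> \<Longrightarrow> Z \<in> \<D> \<Longrightarrow> \<exists>W\<in>\<D>. Y \<subseteq> W \<and> Z \<subseteq> W" and un: "\<Union>\<D> = carrier M"
  shows "ent R G L M = (SUP Y\<in>\<D>. ent R G L (sub_mod M Y))"
proof (rule antisym)
  interpret M: entropy_module R G \<sigma> \<rho> L M by (rule entropy_moduleI[OF M])
  have sub: "left_module RG (sub_mod M Y)" if "Y \<in> \<D>" for Y
    using M.M.left_module_sub_mod D(2)[OF that] by blast
  have id: "id \<in> mod_hom RG (sub_mod M Y) M" "inj_on id (carrier (sub_mod M Y))" if "Y \<in> \<D>" for Y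
    using M.M.submoduleD(1)[OF D(2)[OF that]] by (auto simp: mod_hom_def)
  show "(SUP Y\<in>\<D>. ent R G L (sub_mod M Y)) \<le> ent R G L M"
    by (rule SUP_least) (rule ent_le_image_inj[OF sub M id])
  show "ent R G L M \<le> (SUP Y\<in>\<D>. ent R G L (sub_mod M Y))"
    unfolding M.ent_eq
  proof (rule SUP_least)
    fix K assume "K \<in> {K. fin_len (base M) K}"
    then have K: "fin_len (base M) K" by simp
    have KU: "K \<subseteq> \<Union>\<D>" using M.B.submoduleD(1)[OF fin_lenD[OF K]] un by simp
    show "ennreal (ent_real M K) \<le> (SUP Y\<in>\<D>. ent R G L (sub_mod M Y))"
    proof (rule ennreal_le_epsilon)
      fix e :: real assume e: "0 < e"
      obtain Y where Y: "Y \<in> \<D>" "rlen (base M) K \<le> rlen (base M) (K \<inter> Y) + e"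
        using rlen_approx_directed[OF M.left_module_base K D(1) M.base_submodule[OF D(2)] D(3) KU e] by blast
      have YB: "submodule Y R (base M)" by (rule M.base_submodule[OF D(2)[OF Y(1)]])
      have KY: "fin_len (base M) (K \<inter> Y)" by (rule fin_len_Int[OF M.left_module_base K YB])
      have "K \<inter> Y \<subseteq> id ` carrier (sub_mod M Y)" by simp
      then obtain K' where K': "submodule K' R (base (sub_mod M Y))" "id ` K' = K \<inter> Y"
        by (rule submodule_in_image[OF sub[OF Y(1)] M id(1)[OF Y(1)] fin_lenD[OF KY]])
      interpret Y: entropy_module R G \<sigma> \<rho> L "sub_mod M Y" by (rule entropy_moduleI[OF sub[OF Y(1)]])
      have "fin_len (base (sub_mod M Y)) K'"
        using fin_len_image_inj_iff(1)[OF sub[OF Y(1)] M id[OF Y(1)] K'(1)] K'(2) KY by simp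
      then have "ennreal (ent_real (sub_mod M Y) K') \<le> ent R G L (sub_mod M Y)" by (rule Y.ent_real_le_ent)
      also have "\<dots> \<le> (SUP Y\<in>\<D>. ent R G L (sub_mod M Y))" by (rule SUP_upper[OF Y(1)])
      finally have le: "ennreal (ent_real M (K \<inter> Y)) \<le> (SUP Y\<in>\<D>. ent R G L (sub_mod M Y))"
        using ent_real_image_inj[OF sub[OF Y(1)] M id[OF Y(1)] K'(1)] K'(2) by simp
      have "ent_real M K \<le> ent_real M (K \<inter> Y) + e"
        using M.ent_real_increment[OF K fin_lenD[OF KY]] Y(2) by simp
      then have "ennreal (ent_real M K) \<le> ennreal (ent_real M (K \<inter> Y) + e)" by (rule ennreal_leI)
      also have "\<dots> = ennreal (ent_real M (K \<inter> Y)) + ennreal e" using e ent_real_nonneg by simp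
      also have "\<dots> \<le> (SUP Y\<in>\<D>. ent R G L (sub_mod M Y)) + ennreal e" using le by (rule add_right_mono)
      finally show "ennreal (ent_real M K) \<le> (SUP Y\<in>\<D>. ent R G L (sub_mod M Y)) + ennreal e" .
    qed
  qed
qed

theorem length_function_ent: "length_function RG (lFin_L R G \<sigma> \<rho> L) (ent R G L)"
  unfolding length_function_def
proof (intro conjI)
  let ?C = "lFin_L R G \<sigma> \<rho> L"
  have lm: "left_module RG M" if "M \<in> ?C" for M using that by (simp add: lFin_iff)
  show "?C \<subseteq> R_Mod RG" by (auto simp: R_Mod_def lm)
  show "sub_quot_closed RG ?C"
    unfolding sub_quot_closed_def
  proof (intro conjI ballI impI)
    show "A \<in> ?C" if "B \<in> ?C" "A \<in> R_Mod RG" "f \<in> mod_hom RG A B" "inj_on f (carrier A)" for A B f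
      using lFin_sub[OF that(1) _ that(3,4)] that(2) by (simp add: R_Mod_def)
    show "C \<in> ?C" if "B \<in> ?C" "C \<in> R_Mod RG" "g \<in> mod_hom RG B C" "g ` carrier B = carrier C" for B C g
      using lFin_quot[OF that(1) _ that(3,4)] that(2) by (simp add: R_Mod_def)
  qed
  show "invariant_on RG ?C (ent R G L)"
    unfolding invariant_on_def
  proof (intro ballI impI)
    show "ent R G L M = ent R G L N" if "M \<in> ?C" "N \<in> ?C" "mod_isomorphic RG M N" for M N
      by (rule ent_iso[OF lm[OF that(1)] lm[OF that(2)] that(3)])
  qed
  show "additive_on RG ?C (ent R G L)"
    unfolding additive_on_def
  proof (intro conjI ballI allI impI)
    show "ent R G L Z = 0" if "Z \<in> ?C" "carrier Z = {\<zero>\<^bsub>Z\<^esub>}" for Z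
      by (rule ent_zero_module[OF lm[OF that(1)] that(2)])
    show "ent R G L B = ent R G L A + ent R G L C"
      if "A \<in> ?C" "B \<in> ?C" "C \<in> ?C" "short_exact RG A f B g C" for A B C f g
      using ent_additive_le[OF lm[OF that(1)] lm[OF that(2)] lm[OF that(3)] that(4)]
        ent_additive_ge[OF lm[OF that(1)] that(2) lm[OF that(3)] that(4)] by (rule antisym)
  qed
  show "upper_continuous_on RG ?C (ent R G L)"
    unfolding upper_continuous_on_def
  proof (intro ballI allI impI, elim conjE)
    fix M \<D>
    assume "M \<in> ?C" and D: "\<D> \<noteq> {}" "\<forall>Y\<in>\<D>. submodule Y RG M"
      "\<forall>Y\<in>\<D>. \<forall>Z\<in>\<D>. \<exists>W\<in>\<D>. Y \<subseteq> W \<and> Z \<subseteq> W" "\<Union>\<D> = carrier M"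
    show "ent R G L M = (SUP Y\<in>\<D>. ent R G L (sub_mod M Y))"
      using D(2,3) by (intro ent_upper_continuous[OF lm[OF \<open>M \<in> ?C\<close>] D(1) _ _ D(4)]) auto
  qed
qed

end

section \<open>Tensor products\<close>

text \<open>A copy of \<open>S \<otimes> K\<close> carries a balanced map \<open>E\<close>, the image of \<open>(s, k) \<mapsto> s \<otimes> k\<close>, that is
  \<open>S\<close>-linear in its first argument, whose values generate, and through which every balanced map
  into \<open>K\<close> factors.\<close>

lemma tensor_balanced_map:
  fixes S :: "('s, 'd) ring_scheme" and R :: "('r, 'c) ring_scheme" and K :: "('r, 'k) module"
    and T :: "('s, 'n) module" and \<iota> :: "'r \<Rightarrow> 's"
  assumes \<iota>: "\<And>r. r \<in> carrier R \<Longrightarrow> \<iota> r \<in> carrier S" and K: "left_module R K" and T: "left_module S T"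
    and iso: "mod_isomorphic S T (tensor S \<iota> R K)"
  obtains E :: "'s \<Rightarrow> 'k \<Rightarrow> 'n" where
    "\<And>s k. s \<in> carrier S \<Longrightarrow> k \<in> carrier K \<Longrightarrow> E s k \<in> carrier T"
    "\<And>s t k. s \<in> carrier S \<Longrightarrow> t \<in> carrier S \<Longrightarrow> k \<in> carrier K \<Longrightarrow> E (s \<oplus>\<^bsub>S\<^esub> t) k = E s k \<oplus>\<^bsub>T\<^esub> E t k"
    "\<And>s k l. s \<in> carrier S \<Longrightarrow> k \<in> carrier K \<Longrightarrow> l \<in> carrier K \<Longrightarrow> E s (k \<oplus>\<^bsub>K\<^esub> l) = E s k \<oplus>\<^bsub>T\<^esub> E s l"
    "\<And>s r k. s \<in> carrier S \<Longrightarrow> r \<in> carrier R \<Longrightarrow> k \<in> carrier K \<Longrightarrow> E (s \<otimes>\<^bsub>S\<^esub> \<iota> r) k = E s (r \<odot>\<^bsub>K\<^esub> k)"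
    "\<And>s t k. s \<in> carrier S \<Longrightarrow> t \<in> carrier S \<Longrightarrow> k \<in> carrier K \<Longrightarrow> t \<odot>\<^bsub>T\<^esub> E s k = E (t \<otimes>\<^bsub>S\<^esub> s) k"
    "\<And>H. \<lbrakk>\<And>s k. s \<in> carrier S \<Longrightarrow> k \<in> carrier K \<Longrightarrow> E s k \<in> H; \<zero>\<^bsub>T\<^esub> \<in> H;
       \<And>x y. x \<in> H \<Longrightarrow> y \<in> H \<Longrightarrow> x \<ominus>\<^bsub>T\<^esub> y \<in> H\<rbrakk> \<Longrightarrow> carrier T \<subseteq> H"
    "\<And>\<beta>. \<lbrakk>\<And>s k. s \<in> carrier S \<Longrightarrow> k \<in> carrier K \<Longrightarrow> \<beta> s k \<in> carrier K;
       \<And>s t k. s \<in> carrier S \<Longrightarrow> t \<in> carrier S \<Longrightarrow> k \<in> carrier K \<Longrightarrow> \<beta> (s \<oplus>\<^bsub>S\<^esub> t) k = \<beta> s k \<oplus>\<^bsub>K\<^esub> \<beta> t k;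
       \<And>s k l. s \<in> carrier S \<Longrightarrow> k \<in> carrier K \<Longrightarrow> l \<in> carrier K \<Longrightarrow> \<beta> s (k \<oplus>\<^bsub>K\<^esub> l) = \<beta> s k \<oplus>\<^bsub>K\<^esub> \<beta> s l;
       \<And>s r k. s \<in> carrier S \<Longrightarrow> r \<in> carrier R \<Longrightarrow> k \<in> carrier K \<Longrightarrow> \<beta> (s \<otimes>\<^bsub>S\<^esub> \<iota> r) k = \<beta> s (r \<odot>\<^bsub>K\<^esub> k)\<rbrakk>
      \<Longrightarrow> \<exists>c \<in> carrier T \<rightarrow> carrier K. (\<forall>x\<in>carrier T. \<forall>y\<in>carrier T. c (x \<oplus>\<^bsub>T\<^esub> y) = c x \<oplus>\<^bsub>K\<^esub> c y) \<and>
        (\<forall>s\<in>carrier S. \<forall>k\<in>carrier K. c (E s k) = \<beta> s k)"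
proof -
  interpret K: left_module R K by fact
  interpret T: lmodule S T using T by (simp add: lmodule_def)
  define A where "A = free_Abelian_group (carrier S \<times> carrier K)"
  define rels where "rels = tensor_relations S \<iota> R K"
  define N where "N = generate A rels"
  define q where "q x = N #>\<^bsub>A\<^esub> x" for x
  interpret A: comm_group A unfolding A_def by (rule abelian_free_Abelian_group)
  have A_mult: "x \<otimes>\<^bsub>A\<^esub> y = x + y" and A_one: "\<one>\<^bsub>A\<^esub> = 0" for x y by (simp_all add: A_def)
  have A_inv: "inv\<^bsub>A\<^esub> x = - x" if "x \<in> carrier A" for x using that by (simp add: A_def)
  have frag: "frag_of (s, k) \<in> carrier A" if "s \<in> carrier S" "k \<in> carrier K" for s k
    using that by (simp add: A_def)
  have A_diff: "x - y \<in> carrier A" if "x \<in> carrier A" "y \<in> carrier A" for x y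
    using A.m_closed[OF that(1) A.inv_closed[OF that(2)]] A_inv[OF that(2)] by (simp add: A_mult)
  have rels_add_left: "frag_of (s \<oplus>\<^bsub>S\<^esub> t, k) - frag_of (s, k) - frag_of (t, k) \<in> rels"
    if "s \<in> carrier S" "t \<in> carrier S" "k \<in> carrier K" for s t k
    unfolding rels_def tensor_relations_def using that by blast
  have rels_add_right: "frag_of (s, k \<oplus>\<^bsub>K\<^esub> l) - frag_of (s, k) - frag_of (s, l) \<in> rels"
    if "s \<in> carrier S" "k \<in> carrier K" "l \<in> carrier K" for s k l
    unfolding rels_def tensor_relations_def using that by blast
  have rels_balanced: "frag_of (s \<otimes>\<^bsub>S\<^esub> \<iota> r, k) - frag_of (s, r \<odot>\<^bsub>K\<^esub> k) \<in> rels"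
    if "s \<in> carrier S" "r \<in> carrier R" "k \<in> carrier K" for s r k
    unfolding rels_def tensor_relations_def using that by blast
  have rels_cases: "P x" if x: "x \<in> rels"
    and 1: "\<And>s t k. s \<in> carrier S \<Longrightarrow> t \<in> carrier S \<Longrightarrow> k \<in> carrier K \<Longrightarrow>
      P (frag_of (s \<oplus>\<^bsub>S\<^esub> t, k) - frag_of (s, k) - frag_of (t, k))"
    and 2: "\<And>s k l. s \<in> carrier S \<Longrightarrow> k \<in> carrier K \<Longrightarrow> l \<in> carrier K \<Longrightarrow>
      P (frag_of (s, k \<oplus>\<^bsub>K\<^esub> l) - frag_of (s, k) - frag_of (s, l))"
    and 3: "\<And>s r k. s \<in> carrier S \<Longrightarrow> r \<in> carrier R \<Longrightarrow> k \<in> carrier K \<Longrightarrow>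
      P (frag_of (s \<otimes>\<^bsub>S\<^esub> \<iota> r, k) - frag_of (s, r \<odot>\<^bsub>K\<^esub> k))" for P x
    using x unfolding rels_def tensor_relations_def by (auto intro: 1 2 3)
  have rels_sub: "rels \<subseteq> carrier A"
  proof
    show "x \<in> carrier A" if "x \<in> rels" for x
      using that by (rule rels_cases) (auto intro!: A_diff frag \<iota>)
  qed
  have N: "subgroup N A" unfolding N_def by (rule A.generate_is_subgroup[OF rels_sub])
  have Nc: "N \<subseteq> carrier A" using subgroup.subset[OF N] .
  have N_add: "x + y \<in> N" if "x \<in> N" "y \<in> N" for x y
    using subgroup.m_closed[OF N that] by (simp add: A_mult)
  have N_zero: "0 \<in> N" using subgroup.one_closed[OF N] by (simp add: A_one)
  have N_neg: "- x \<in> N" if "x \<in> N" for x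
    using subgroup.m_inv_closed[OF N that] A_inv[of x] that Nc by auto
  have q_eq: "q x = (\<lambda>n. n + x) ` N" for x
    unfolding q_def r_coset_def by (auto simp: A_mult)
  have q_cong: "q x = q y \<longleftrightarrow> x - y \<in> N" for x y
  proof
    assume "q x = q y"
    moreover have "x \<in> q x" unfolding q_eq using N_zero by (intro image_eqI[of _ _ 0]) auto
    ultimately obtain n where "n \<in> N" "x = n + y" unfolding q_eq by blast
    then show "x - y \<in> N" by simp
  next
    assume xy: "x - y \<in> N"
    show "q x = q y"
    proof (intro subset_antisym subsetI)
      fix z assume "z \<in> q x"
      then obtain n where n: "n \<in> N" "z = n + x" unfolding q_eq by blast
      then have "z = (n + (x - y)) + y" by simp
      then show "z \<in> q y" unfolding q_eq using N_add[OF n(1) xy] by (intro image_eqI[of _ _ "n + (x - y)"]) auto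
    next
      fix z assume "z \<in> q y"
      then obtain n where n: "n \<in> N" "z = n + y" unfolding q_eq by blast
      then have "z = (n + - (x - y)) + x" by simp
      then show "z \<in> q x" unfolding q_eq using N_add[OF n(1) N_neg[OF xy]] by (intro image_eqI[of _ _ "n + - (x - y)"]) auto
    qed
  qed
  define Q where "Q = tensor S \<iota> R K"
  have carrier_Q: "carrier Q = q ` carrier A"
    unfolding Q_def tensor_def Let_def
    by (auto simp: FactGroup_def RCOSETS_def q_def N_def rels_def A_def)
  have add_Q: "q x \<oplus>\<^bsub>Q\<^esub> q y = q (x + y)" if "x \<in> carrier A" "y \<in> carrier A" for x y
  proof -
    have "q x \<oplus>\<^bsub>Q\<^esub> q y = q x <#>\<^bsub>A\<^esub> q y"
      unfolding Q_def tensor_def Let_def by (simp add: FactGroup_def A_def)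
    also have "\<dots> = q (x + y)"
    proof (intro subset_antisym subsetI)
      fix z assume "z \<in> q x <#>\<^bsub>A\<^esub> q y"
      then obtain n n' where n: "n \<in> N" "n' \<in> N" "z = (n + x) + (n' + y)"
        unfolding set_mult_def q_eq by (auto simp: A_mult)
      then have "z = (n + n') + (x + y)" by (simp add: algebra_simps)
      then show "z \<in> q (x + y)" unfolding q_eq using N_add[OF n(1,2)] by blast
    next
      fix z assume "z \<in> q (x + y)"
      then obtain n where n: "n \<in> N" "z = n + (x + y)" unfolding q_eq by blast
      then have "z = (n + x) \<otimes>\<^bsub>A\<^esub> (0 + y)" by (simp add: algebra_simps A_mult)
      then show "z \<in> q x <#>\<^bsub>A\<^esub> q y" unfolding set_mult_def q_eq using n(1) N_zero by blast
    qed
    finally show ?thesis .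
  qed
  define ext where "ext s = frag_extend (\<lambda>(t, k). frag_of (s \<otimes>\<^bsub>S\<^esub> t, k :: 'k))" for s
  have ext_of: "ext s (frag_of (t, k)) = frag_of (s \<otimes>\<^bsub>S\<^esub> t, k)" for s t k
    by (simp add: ext_def)
  have ext_add: "ext s (x + y) = ext s x + ext s y" and ext_diff: "ext s (x - y) = ext s x - ext s y"
    and ext_neg: "ext s (- x) = - ext s x" and ext_zero: "ext s 0 = 0" for s x y
    by (simp_all add: ext_def frag_extend_add frag_extend_diff frag_extend_minus)
  have rels_ext: "ext s x \<in> rels" if s: "s \<in> carrier S" and x: "x \<in> rels" for s x
    using x
  proof (rule rels_cases)
    fix a b k assume x: "a \<in> carrier S" "b \<in> carrier S" "k \<in> carrier K"
    show "ext s (frag_of (a \<oplus>\<^bsub>S\<^esub> b, k) - frag_of (a, k) - frag_of (b, k)) \<in> rels"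
      using rels_add_left[of "s \<otimes>\<^bsub>S\<^esub> a" "s \<otimes>\<^bsub>S\<^esub> b" k] x s by (simp add: ext_diff ext_of T.R.r_distr)
  next
    fix a k l assume x: "a \<in> carrier S" "k \<in> carrier K" "l \<in> carrier K"
    show "ext s (frag_of (a, k \<oplus>\<^bsub>K\<^esub> l) - frag_of (a, k) - frag_of (a, l)) \<in> rels"
      using rels_add_right[of "s \<otimes>\<^bsub>S\<^esub> a" k l] x s by (simp add: ext_diff ext_of)
  next
    fix a r k assume x: "a \<in> carrier S" "r \<in> carrier R" "k \<in> carrier K"
    show "ext s (frag_of (a \<otimes>\<^bsub>S\<^esub> \<iota> r, k) - frag_of (a, r \<odot>\<^bsub>K\<^esub> k)) \<in> rels"
      using rels_balanced[of "s \<otimes>\<^bsub>S\<^esub> a" r k] x s \<iota> by (simp add: ext_diff ext_of T.R.m_assoc)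
  qed
  have N_ext: "ext s x \<in> N" if s: "s \<in> carrier S" and x: "x \<in> N" for s x
    using x unfolding N_def
  proof (induction x rule: generate.induct)
    case one
    show ?case using N_zero by (simp add: A_one ext_zero flip: N_def)
  next
    case (incl h)
    then show ?case using rels_ext[OF s] by (intro generate.incl)
  next
    case (inv h)
    have "ext s (inv\<^bsub>A\<^esub> h) = - ext s h" using A_inv[of h] inv rels_sub by (auto simp: ext_neg)
    moreover have "ext s h \<in> N" unfolding N_def using rels_ext[OF s inv] by (rule generate.incl)
    ultimately show ?case using N_neg by (simp flip: N_def)
  next
    case (eng h1 h2)
    then show ?case using N_add by (simp add: A_mult ext_add flip: N_def)
  qed
  have smult_Q: "s \<odot>\<^bsub>Q\<^esub> q x = q (ext s x)" if s: "s \<in> carrier S" for s x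
  proof -
    have "s \<odot>\<^bsub>Q\<^esub> q x = N <#>\<^bsub>A\<^esub> (ext s ` q x)"
      unfolding Q_def tensor_def Let_def by (simp add: A_def N_def rels_def ext_def)
    also have "\<dots> = q (ext s x)"
    proof (intro subset_antisym subsetI)
      fix z assume "z \<in> N <#>\<^bsub>A\<^esub> (ext s ` q x)"
      then obtain n n' where n: "n \<in> N" "n' \<in> N" "z = n + ext s (n' + x)"
        unfolding set_mult_def q_eq by (auto simp: A_mult)
      then have "z = (n + ext s n') + ext s x" by (simp add: ext_add algebra_simps)
      then show "z \<in> q (ext s x)" unfolding q_eq using N_add[OF n(1) N_ext[OF s n(2)]] by blast
    next
      fix z assume "z \<in> q (ext s x)"
      then obtain n where n: "n \<in> N" "z = n + ext s x" unfolding q_eq by blast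
      then have "z = n \<otimes>\<^bsub>A\<^esub> ext s (0 + x)" by (simp add: A_mult)
      then show "z \<in> N <#>\<^bsub>A\<^esub> (ext s ` q x)" unfolding set_mult_def q_eq using n(1) N_zero by blast
    qed
    finally show ?thesis .
  qed
  obtain \<psi> where \<psi>: "\<psi> \<in> mod_hom S T Q" "bij_betw \<psi> (carrier T) (carrier Q)"
    using iso by (auto simp: mod_isomorphic_def Q_def)
  have \<psi>_add: "\<psi> (x \<oplus>\<^bsub>T\<^esub> y) = \<psi> x \<oplus>\<^bsub>Q\<^esub> \<psi> y" if "x \<in> carrier T" "y \<in> carrier T" for x y
    using \<psi>(1) that by (simp add: mod_hom_def)
  have \<psi>_smult: "\<psi> (s \<odot>\<^bsub>T\<^esub> x) = s \<odot>\<^bsub>Q\<^esub> \<psi> x" if "s \<in> carrier S" "x \<in> carrier T" for s x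
    using \<psi>(1) that by (simp add: mod_hom_def)
  have \<psi>_inj: "x = y" if "\<psi> x = \<psi> y" "x \<in> carrier T" "y \<in> carrier T" for x y
    using \<psi>(2) that by (auto simp: bij_betw_def dest: inj_onD)
  define \<phi> where "\<phi> a = inv_into (carrier T) \<psi> (q a)" for a
  have \<phi>: "\<phi> a \<in> carrier T" "\<psi> (\<phi> a) = q a" if "a \<in> carrier A" for a
  proof -
    have "q a \<in> carrier Q" unfolding carrier_Q using that by (rule imageI)
    then have "q a \<in> \<psi> ` carrier T" using \<psi>(2) by (simp add: bij_betw_def)
    then show "\<phi> a \<in> carrier T" "\<psi> (\<phi> a) = q a"
      unfolding \<phi>_def by (rule inv_into_into, rule f_inv_into_f)
  qed
  have \<phi>_add: "\<phi> (a + b) = \<phi> a \<oplus>\<^bsub>T\<^esub> \<phi> b" if ab: "a \<in> carrier A" "b \<in> carrier A" for a b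
  proof (rule \<psi>_inj)
    have "a + b \<in> carrier A" using A.m_closed[OF ab] by (simp add: A_mult)
    then show "\<psi> (\<phi> (a + b)) = \<psi> (\<phi> a \<oplus>\<^bsub>T\<^esub> \<phi> b)" "\<phi> (a + b) \<in> carrier T"
      using ab by (simp_all add: \<phi> \<psi>_add add_Q)
  qed (use \<phi> ab in simp)
  have \<phi>_cong: "\<phi> a = \<phi> b" if "a - b \<in> N" for a b
    using q_cong[of a b] that by (simp add: \<phi>_def)
  have \<phi>_surj: "\<exists>a\<in>carrier A. x = \<phi> a" if x: "x \<in> carrier T" for x
  proof -
    have "\<psi> x \<in> carrier Q" by (rule bij_betwE[OF \<psi>(2), rule_format, OF x])
    then obtain a where a: "a \<in> carrier A" "\<psi> x = q a" unfolding carrier_Q by blast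
    then have "x = \<phi> a" using \<psi>_inj[of x "\<phi> a"] \<phi>[OF a(1)] x by simp
    then show ?thesis using a(1) by blast
  qed
  have \<phi>_zero: "\<phi> 0 = \<zero>\<^bsub>T\<^esub>"
  proof -
    have "0 \<in> carrier A" using A.one_closed by (simp add: A_one)
    then have "\<phi> 0 = \<phi> 0 \<oplus>\<^bsub>T\<^esub> \<phi> 0" "\<phi> 0 \<in> carrier T" using \<phi>_add[of 0 0] \<phi> by auto
    then show ?thesis by (metis T.M.add.l_cancel_one)
  qed
  have \<phi>_diff: "\<phi> (a - b) = \<phi> a \<ominus>\<^bsub>T\<^esub> \<phi> b" if ab: "a \<in> carrier A" "b \<in> carrier A" for a b
  proof -
    have "\<phi> (a - b) \<oplus>\<^bsub>T\<^esub> \<phi> b = \<phi> a" using \<phi>_add[OF A_diff[OF ab] ab(2)] by simp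
    then have "\<phi> a \<ominus>\<^bsub>T\<^esub> \<phi> b = \<phi> (a - b) \<oplus>\<^bsub>T\<^esub> \<phi> b \<oplus>\<^bsub>T\<^esub> \<ominus>\<^bsub>T\<^esub> \<phi> b" by (simp add: T.M.minus_eq)
    then show ?thesis using \<phi>(1)[OF A_diff[OF ab]] \<phi>(1)[OF ab(2)] by (simp add: T.M.a_assoc T.M.r_neg)
  qed
  have rels_N: "x \<in> N" if "x \<in> rels" for x unfolding N_def using that by (rule generate.incl)
  define E where "E s k = \<phi> (frag_of (s, k))" for s k
  show ?thesis
  proof (rule that[of E])
    show E_closed: "E s k \<in> carrier T" if "s \<in> carrier S" "k \<in> carrier K" for s k
      unfolding E_def by (rule \<phi>(1)[OF frag[OF that]])
    show "E (s \<oplus>\<^bsub>S\<^esub> t) k = E s k \<oplus>\<^bsub>T\<^esub> E t k" if "s \<in> carrier S" "t \<in> carrier S" "k \<in> carrier K" for s t k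
    proof -
      have "frag_of (s \<oplus>\<^bsub>S\<^esub> t, k) - frag_of (s, k) - frag_of (t, k) \<in> rels"
        by (rule rels_add_left[OF that])
      then have "\<phi> (frag_of (s \<oplus>\<^bsub>S\<^esub> t, k)) = \<phi> (frag_of (s, k) + frag_of (t, k))"
        by (intro \<phi>_cong) (auto simp: diff_diff_add dest: rels_N)
      then show ?thesis unfolding E_def using \<phi>_add frag that by simp
    qed
    show "E s (k \<oplus>\<^bsub>K\<^esub> l) = E s k \<oplus>\<^bsub>T\<^esub> E s l" if "s \<in> carrier S" "k \<in> carrier K" "l \<in> carrier K" for s k l
    proof -
      have "frag_of (s, k \<oplus>\<^bsub>K\<^esub> l) - frag_of (s, k) - frag_of (s, l) \<in> rels"
        by (rule rels_add_right[OF that])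
      then have "\<phi> (frag_of (s, k \<oplus>\<^bsub>K\<^esub> l)) = \<phi> (frag_of (s, k) + frag_of (s, l))"
        by (intro \<phi>_cong) (auto simp: diff_diff_add dest: rels_N)
      then show ?thesis unfolding E_def using \<phi>_add frag that by simp
    qed
    show "E (s \<otimes>\<^bsub>S\<^esub> \<iota> r) k = E s (r \<odot>\<^bsub>K\<^esub> k)" if "s \<in> carrier S" "r \<in> carrier R" "k \<in> carrier K" for s r k
    proof -
      have "frag_of (s \<otimes>\<^bsub>S\<^esub> \<iota> r, k) - frag_of (s, r \<odot>\<^bsub>K\<^esub> k) \<in> rels"
        by (rule rels_balanced[OF that])
      then show ?thesis unfolding E_def by (intro \<phi>_cong rels_N)
    qed
    show "t \<odot>\<^bsub>T\<^esub> E s k = E (t \<otimes>\<^bsub>S\<^esub> s) k" if "s \<in> carrier S" "t \<in> carrier S" "k \<in> carrier K" for s t k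
    proof (rule \<psi>_inj)
      show "\<psi> (t \<odot>\<^bsub>T\<^esub> E s k) = \<psi> (E (t \<otimes>\<^bsub>S\<^esub> s) k)"
        using that \<psi>_smult[of t "E s k"] E_closed[of s k] \<phi>(2)[OF frag] smult_Q
        by (simp add: E_def ext_of)
    qed (use that E_closed in auto)
    show "carrier T \<subseteq> H" if H: "\<And>s k. s \<in> carrier S \<Longrightarrow> k \<in> carrier K \<Longrightarrow> E s k \<in> H" "\<zero>\<^bsub>T\<^esub> \<in> H"
      "\<And>x y. x \<in> H \<Longrightarrow> y \<in> H \<Longrightarrow> x \<ominus>\<^bsub>T\<^esub> y \<in> H" for H
    proof
      fix x assume "x \<in> carrier T"
      then obtain a where a: "a \<in> carrier A" "x = \<phi> a" using \<phi>_surj by blast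
      have "a \<in> carrier A \<and> \<phi> a \<in> H"
      proof (rule free_Abelian_group_induct[of a "carrier S \<times> carrier K"])
        show "Poly_Mapping.keys a \<subseteq> carrier S \<times> carrier K" using a(1) by (simp add: A_def)
        show "0 \<in> carrier A \<and> \<phi> 0 \<in> H" using H(2) \<phi>_zero A.one_closed by (simp add: A_one)
        show "b - c \<in> carrier A \<and> \<phi> (b - c) \<in> H"
          if "b \<in> carrier A \<and> \<phi> b \<in> H" "c \<in> carrier A \<and> \<phi> c \<in> H" for b c
          using that A_diff \<phi>_diff H(3) by simp
        show "frag_of p \<in> carrier A \<and> \<phi> (frag_of p) \<in> H" if "p \<in> carrier S \<times> carrier K" for p
          using that frag H(1) by (auto simp: E_def)
      qed
      then show "x \<in> H" using a(2) by simp
    qed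
    show "\<exists>c \<in> carrier T \<rightarrow> carrier K. (\<forall>x\<in>carrier T. \<forall>y\<in>carrier T. c (x \<oplus>\<^bsub>T\<^esub> y) = c x \<oplus>\<^bsub>K\<^esub> c y) \<and>
        (\<forall>s\<in>carrier S. \<forall>k\<in>carrier K. c (E s k) = \<beta> s k)"
      if \<beta>: "\<And>s k. s \<in> carrier S \<Longrightarrow> k \<in> carrier K \<Longrightarrow> \<beta> s k \<in> carrier K"
       "\<And>s t k. s \<in> carrier S \<Longrightarrow> t \<in> carrier S \<Longrightarrow> k \<in> carrier K \<Longrightarrow> \<beta> (s \<oplus>\<^bsub>S\<^esub> t) k = \<beta> s k \<oplus>\<^bsub>K\<^esub> \<beta> t k"
       "\<And>s k l. s \<in> carrier S \<Longrightarrow> k \<in> carrier K \<Longrightarrow> l \<in> carrier K \<Longrightarrow> \<beta> s (k \<oplus>\<^bsub>K\<^esub> l) = \<beta> s k \<oplus>\<^bsub>K\<^esub> \<beta> s l"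
       "\<And>s r k. s \<in> carrier S \<Longrightarrow> r \<in> carrier R \<Longrightarrow> k \<in> carrier K \<Longrightarrow> \<beta> (s \<otimes>\<^bsub>S\<^esub> \<iota> r) k = \<beta> s (r \<odot>\<^bsub>K\<^esub> k)" for \<beta>
    proof -
      have img: "(\<lambda>(s, k). \<beta> s k) ` (carrier S \<times> carrier K) \<subseteq> carrier (add_monoid K)" using \<beta>(1) by auto
      obtain h where h: "h \<in> hom A (add_monoid K)"
        "\<And>p. p \<in> carrier S \<times> carrier K \<Longrightarrow> h (frag_of p) = (\<lambda>(s, k). \<beta> s k) p"
        using comm_group.free_Abelian_group_universal[OF K.M.a_comm_group img] unfolding A_def by metis
      have h_closed: "h a \<in> carrier K" if "a \<in> carrier A" for a using hom_in_carrier[OF h(1) that] by simp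
      have h_add: "h (a + b) = h a \<oplus>\<^bsub>K\<^esub> h b" if "a \<in> carrier A" "b \<in> carrier A" for a b
        using hom_mult[OF h(1) that] by (simp add: A_mult)
      have h_of: "h (frag_of (s, k)) = \<beta> s k" if "s \<in> carrier S" "k \<in> carrier K" for s k
        using h(2)[of "(s, k)"] that by simp
      have h_diff: "h (a - b) \<oplus>\<^bsub>K\<^esub> h b = h a" if "a \<in> carrier A" "b \<in> carrier A" for a b
        using h_add[OF A_diff[OF that] that(2)] by simp
      have zeroI: "u = \<zero>\<^bsub>K\<^esub>" if "u \<oplus>\<^bsub>K\<^esub> v = v" "u \<in> carrier K" "v \<in> carrier K" for u v
        using that by (metis K.M.add.r_cancel_one')
      have h_zero: "h a = h b" if "a \<in> carrier A" "b \<in> carrier A" "h (a - b) = \<zero>\<^bsub>K\<^esub>" for a b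
        using h_diff[OF that(1,2)] that h_closed by simp
      have h_zero': "h (a - b) = \<zero>\<^bsub>K\<^esub>" if "a \<in> carrier A" "b \<in> carrier A" "h a = h b" for a b
        using h_diff[OF that(1,2)] that h_closed A_diff by (intro zeroI[of _ "h b"]) auto
      have h_rels: "h x = \<zero>\<^bsub>K\<^esub>" if x: "x \<in> rels" for x
        using x
      proof (rule rels_cases)
        fix s t k assume x: "s \<in> carrier S" "t \<in> carrier S" "k \<in> carrier K"
        have "frag_of (s, k) + frag_of (t, k) \<in> carrier A" using A.m_closed[OF frag frag, of s k t k] x by (simp add: A_mult)
        then show "h (frag_of (s \<oplus>\<^bsub>S\<^esub> t, k) - frag_of (s, k) - frag_of (t, k)) = \<zero>\<^bsub>K\<^esub>"
          unfolding diff_diff_add using x \<beta>(2)[OF x] by (intro h_zero') (simp_all add: h_add frag h_of)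
      next
        fix s k l assume x: "s \<in> carrier S" "k \<in> carrier K" "l \<in> carrier K"
        have "frag_of (s, k) + frag_of (s, l) \<in> carrier A" using A.m_closed[OF frag frag, of s k s l] x by (simp add: A_mult)
        then show "h (frag_of (s, k \<oplus>\<^bsub>K\<^esub> l) - frag_of (s, k) - frag_of (s, l)) = \<zero>\<^bsub>K\<^esub>"
          unfolding diff_diff_add using x \<beta>(3)[OF x] by (intro h_zero') (simp_all add: h_add frag h_of)
      next
        fix s r k assume x: "s \<in> carrier S" "r \<in> carrier R" "k \<in> carrier K"
        show "h (frag_of (s \<otimes>\<^bsub>S\<^esub> \<iota> r, k) - frag_of (s, r \<odot>\<^bsub>K\<^esub> k)) = \<zero>\<^bsub>K\<^esub>"
          using x \<iota>[OF x(2)] \<beta>(4)[OF x] by (intro h_zero') (simp_all add: frag h_of)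
      qed
      interpret h: group_hom A "add_monoid K" h
        using h(1) by (simp add: group_hom_def group_hom_axioms_def A.is_group K.M.a_group)
      have "rels \<subseteq> kernel A (add_monoid K) h" using h_rels rels_sub by (auto simp: kernel_def)
      then have "N \<subseteq> kernel A (add_monoid K) h"
        unfolding N_def by (intro A.generate_subgroup_incl h.subgroup_kernel)
      then have h_N: "h x = \<zero>\<^bsub>K\<^esub>" if "x \<in> N" for x using that by (auto simp: kernel_def)
      define c where "c x = h (SOME a. a \<in> carrier A \<and> x = \<phi> a)" for x
      have c: "c (\<phi> a) = h a" if a: "a \<in> carrier A" for a
      proof -
        let ?b = "SOME b. b \<in> carrier A \<and> \<phi> a = \<phi> b"
        have b: "?b \<in> carrier A \<and> \<phi> a = \<phi> ?b" by (rule someI[of _ a]) (use a in simp)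
        then have "q a = q ?b" using \<phi>(2)[OF a] \<phi>(2)[of ?b] by simp
        then have "h (a - ?b) = \<zero>\<^bsub>K\<^esub>" using h_N q_cong by blast
        then have "h a = h ?b" using b a by (intro h_zero) auto
        then show ?thesis by (simp add: c_def)
      qed
      show ?thesis
      proof (intro bexI[of _ c] conjI ballI)
        show "c \<in> carrier T \<rightarrow> carrier K"
        proof (rule Pi_I)
          fix x assume "x \<in> carrier T"
          then obtain a where a: "a \<in> carrier A" "x = \<phi> a" using \<phi>_surj by blast
          then show "c x \<in> carrier K" using c[OF a(1)] h_closed[OF a(1)] by simp
        qed
        show "c (x \<oplus>\<^bsub>T\<^esub> y) = c x \<oplus>\<^bsub>K\<^esub> c y" if xy: "x \<in> carrier T" "y \<in> carrier T" for x y
        proof -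
          obtain a b where ab: "a \<in> carrier A" "x = \<phi> a" "b \<in> carrier A" "y = \<phi> b"
            using \<phi>_surj xy by blast
          have "a + b \<in> carrier A" using A.m_closed ab by (simp add: A_mult)
          then show ?thesis
            using c[of "a + b"] \<phi>_add[OF ab(1,3)] h_add[OF ab(1,3)] c[OF ab(1)] c[OF ab(3)] ab(2,4) by simp
        qed
        show "c (E s k) = \<beta> s k" if "s \<in> carrier S" "k \<in> carrier K" for s k
          unfolding E_def using c[OF frag[OF that]] h_of[OF that] by simp
      qed
    qed
  qed
qed

section \<open>Induced modules\<close>

context crossed_system
begin

lemma cp_mult_base:
  assumes s: "s \<in> carrier RG" and r: "r \<in> carrier R" and x: "x \<in> carrier G"
  shows "(s \<otimes>\<^bsub>RG\<^esub> cp_monom R \<one>\<^bsub>G\<^esub> r) x = s x \<otimes>\<^bsub>R\<^esub> \<sigma> x r"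
proof -
  have sR: "s y \<in> carrier R" for y using s by (auto simp: crossed_product_def)
  have supp: "cp_supp R s \<subseteq> carrier G" using s by (simp add: crossed_product_def)
  let ?P = "{(g', h'). g' \<in> cp_supp R s \<and> h' \<in> cp_supp R (cp_monom R \<one>\<^bsub>G\<^esub> r) \<and> g' \<otimes>\<^bsub>G\<^esub> h' = x}"
  have eq: "(s \<otimes>\<^bsub>RG\<^esub> cp_monom R \<one>\<^bsub>G\<^esub> r) x =
    finsum R (\<lambda>(g', h'). s g' \<otimes>\<^bsub>R\<^esub> \<sigma> g' (cp_monom R \<one>\<^bsub>G\<^esub> r h') \<otimes>\<^bsub>R\<^esub> \<rho> g' h') ?P"
    by (simp add: crossed_product_def)
  show ?thesis
  proof (cases "r = \<zero>\<^bsub>R\<^esub> \<or> s x = \<zero>\<^bsub>R\<^esub>")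
    case True
    have "?P = {}"
    proof (rule ccontr)
      assume "?P \<noteq> {}"
      then obtain g h where gh: "g \<in> cp_supp R s" "h \<in> cp_supp R (cp_monom R \<one>\<^bsub>G\<^esub> r)" "g \<otimes>\<^bsub>G\<^esub> h = x" by blast
      then have "h = \<one>\<^bsub>G\<^esub>" "r \<noteq> \<zero>\<^bsub>R\<^esub>" by (auto simp: cp_supp_def cp_monom_def split: if_splits)
      moreover from this have "g = x" using gh supp by auto
      ultimately show False using gh(1) True by (simp add: cp_supp_def)
    qed
    then have "(s \<otimes>\<^bsub>RG\<^esub> cp_monom R \<one>\<^bsub>G\<^esub> r) x = \<zero>\<^bsub>R\<^esub>" unfolding eq by (simp only: R.finsum_empty)
    moreover have "s x \<otimes>\<^bsub>R\<^esub> \<sigma> x r = \<zero>\<^bsub>R\<^esub>" using True x r sR by auto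
    ultimately show ?thesis by simp
  next
    case False
    have "?P = {(x, \<one>\<^bsub>G\<^esub>)}"
    proof (intro subset_antisym subsetI)
      fix p assume "p \<in> ?P"
      then obtain g h where gh: "p = (g, h)" "g \<in> cp_supp R s" "h \<in> cp_supp R (cp_monom R \<one>\<^bsub>G\<^esub> r)" "g \<otimes>\<^bsub>G\<^esub> h = x" by blast
      then have "h = \<one>\<^bsub>G\<^esub>" by (auto simp: cp_supp_def cp_monom_def split: if_splits)
      moreover from this have "g = x" using gh supp by auto
      ultimately show "p \<in> {(x, \<one>\<^bsub>G\<^esub>)}" using gh(1) by simp
    qed (use False x in \<open>auto simp: cp_supp_def cp_monom_def\<close>)
    moreover have "finsum R (\<lambda>(g', h'). s g' \<otimes>\<^bsub>R\<^esub> \<sigma> g' (cp_monom R \<one>\<^bsub>G\<^esub> r h') \<otimes>\<^bsub>R\<^esub> \<rho> g' h') {(x, \<one>\<^bsub>G\<^esub>)}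
      = s x \<otimes>\<^bsub>R\<^esub> \<sigma> x r"
      using x r sR[of x] by (simp add: cp_monom_def rho_one_right)
    ultimately show ?thesis unfolding eq by simp
  qed
qed

definition sigma_inv :: "'g \<Rightarrow> 'r \<Rightarrow> 'r" where
  "sigma_inv g = inv_into (carrier R) (\<sigma> g)"

lemma sigma_inv:
  assumes g: "g \<in> carrier G"
  shows "r \<in> carrier R \<Longrightarrow> sigma_inv g r \<in> carrier R"
    "r \<in> carrier R \<Longrightarrow> \<sigma> g (sigma_inv g r) = r"
    "r \<in> carrier R \<Longrightarrow> sigma_inv g (\<sigma> g r) = r"
proof -
  have bij: "inj_on (\<sigma> g) (carrier R)" "\<sigma> g ` carrier R = carrier R"
    using sigma_aut[OF g] by (auto simp: ring_iso_def bij_betw_def)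
  show "sigma_inv g r \<in> carrier R" if "r \<in> carrier R"
    unfolding sigma_inv_def by (rule inv_into_into) (use bij(2) that in simp)
  show "\<sigma> g (sigma_inv g r) = r" if "r \<in> carrier R"
    unfolding sigma_inv_def by (rule f_inv_into_f) (use bij(2) that in simp)
  show "sigma_inv g (\<sigma> g r) = r" if "r \<in> carrier R"
    unfolding sigma_inv_def by (rule inv_into_f_f[OF bij(1) that])
qed

lemma sigma_inv_add:
  assumes g: "g \<in> carrier G" and r: "r \<in> carrier R" and s: "s \<in> carrier R"
  shows "sigma_inv g (r \<oplus>\<^bsub>R\<^esub> s) = sigma_inv g r \<oplus>\<^bsub>R\<^esub> sigma_inv g s"
proof -
  have "\<sigma> g (sigma_inv g r \<oplus>\<^bsub>R\<^esub> sigma_inv g s) = r \<oplus>\<^bsub>R\<^esub> s"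
    using ring_hom_memE(3)[OF sigma_hom[OF g]] sigma_inv[OF g] r s by simp
  then show ?thesis using sigma_inv[OF g] r s by (metis R.add.m_closed)
qed

lemma sigma_inv_mult:
  assumes g: "g \<in> carrier G" and r: "r \<in> carrier R" and s: "s \<in> carrier R"
  shows "sigma_inv g (r \<otimes>\<^bsub>R\<^esub> \<sigma> g s) = sigma_inv g r \<otimes>\<^bsub>R\<^esub> s"
proof -
  have "\<sigma> g (sigma_inv g r \<otimes>\<^bsub>R\<^esub> s) = r \<otimes>\<^bsub>R\<^esub> \<sigma> g s"
    using ring_hom_memE(2)[OF sigma_hom[OF g]] sigma_inv[OF g] r s by simp
  then show ?thesis using sigma_inv[OF g] r s by (metis R.m_closed)
qed

lemma sigma_inv_one: "g \<in> carrier G \<Longrightarrow> sigma_inv g \<one>\<^bsub>R\<^esub> = \<one>\<^bsub>R\<^esub>"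
  and sigma_inv_zero: "g \<in> carrier G \<Longrightarrow> sigma_inv g \<zero>\<^bsub>R\<^esub> = \<zero>\<^bsub>R\<^esub>"
  using sigma_inv(3)[of g "\<one>\<^bsub>R\<^esub>"] sigma_inv(3)[of g "\<zero>\<^bsub>R\<^esub>"] by simp_all

text \<open>As \<open>r g = g \<sigma>(g)\<^sup>-\<^sup>1(r)\<close>, the coefficient of \<open>s \<otimes> k\<close> at \<open>g\<close>, written as \<open>g \<otimes> k'\<close>, is
  \<open>k' = \<sigma>(g)\<^sup>-\<^sup>1(s g) k\<close>. This is balanced in \<open>s\<close> and \<open>k\<close>, hence defined on the tensor product.\<close>

lemma induced_module_coordinates:
  fixes K :: "('r, 'k) module" and T :: "('g \<Rightarrow> 'r, 'n) module"
  assumes K: "left_module R K" and ind: "is_induced_module R G \<sigma> \<rho> K T"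
  obtains \<iota> c where "\<iota> \<in> mod_hom R K (base T)"
    "carrier T \<subseteq> T_sum R T (carrier G) (\<iota> ` carrier K)"
    "\<And>g x. g \<in> carrier G \<Longrightarrow> x \<in> carrier T \<Longrightarrow> c g x \<in> carrier K"
    "\<And>g x y. g \<in> carrier G \<Longrightarrow> x \<in> carrier T \<Longrightarrow> y \<in> carrier T \<Longrightarrow> c g (x \<oplus>\<^bsub>T\<^esub> y) = c g x \<oplus>\<^bsub>K\<^esub> c g y"
    "\<And>g h k. g \<in> carrier G \<Longrightarrow> h \<in> carrier G \<Longrightarrow> k \<in> carrier K \<Longrightarrow>
      c g (act T h (\<iota> k)) = (if g = h then k else \<zero>\<^bsub>K\<^esub>)"
proof -
  have T: "left_module RG T" and iso: "mod_isomorphic RG T (tensor RG (cp_monom R \<one>\<^bsub>G\<^esub>) R K)"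
    using ind by (auto simp: is_induced_module_def)
  interpret K: lmodule R K using K by (simp add: lmodule_def)
  interpret T: crossed_module R G \<sigma> \<rho> T
    using T by (simp add: crossed_module_def crossed_system_axioms lmodule_def)
  have e: "cp_monom R \<one>\<^bsub>G\<^esub> r \<in> carrier RG" if "r \<in> carrier R" for r using that by simp
  obtain E where E_closed: "\<And>s k. s \<in> carrier RG \<Longrightarrow> k \<in> carrier K \<Longrightarrow> E s k \<in> carrier T"
    and E_add_left: "\<And>s t k. s \<in> carrier RG \<Longrightarrow> t \<in> carrier RG \<Longrightarrow> k \<in> carrier K \<Longrightarrow> E (s \<oplus>\<^bsub>RG\<^esub> t) k = E s k \<oplus>\<^bsub>T\<^esub> E t k"
    and E_add_right: "\<And>s k l. s \<in> carrier RG \<Longrightarrow> k \<in> carrier K \<Longrightarrow> l \<in> carrier K \<Longrightarrow> E s (k \<oplus>\<^bsub>K\<^esub> l) = E s k \<oplus>\<^bsub>T\<^esub> E s l"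
    and E_bal: "\<And>s r k. s \<in> carrier RG \<Longrightarrow> r \<in> carrier R \<Longrightarrow> k \<in> carrier K \<Longrightarrow> E (s \<otimes>\<^bsub>RG\<^esub> cp_monom R \<one>\<^bsub>G\<^esub> r) k = E s (r \<odot>\<^bsub>K\<^esub> k)"
    and E_smult: "\<And>s t k. s \<in> carrier RG \<Longrightarrow> t \<in> carrier RG \<Longrightarrow> k \<in> carrier K \<Longrightarrow> t \<odot>\<^bsub>T\<^esub> E s k = E (t \<otimes>\<^bsub>RG\<^esub> s) k"
    and E_gen: "\<And>H. \<lbrakk>\<And>s k. s \<in> carrier RG \<Longrightarrow> k \<in> carrier K \<Longrightarrow> E s k \<in> H; \<zero>\<^bsub>T\<^esub> \<in> H;
       \<And>x y. x \<in> H \<Longrightarrow> y \<in> H \<Longrightarrow> x \<ominus>\<^bsub>T\<^esub> y \<in> H\<rbrakk> \<Longrightarrow> carrier T \<subseteq> H"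
    and E_univ: "\<And>\<beta>. \<lbrakk>\<And>s k. s \<in> carrier RG \<Longrightarrow> k \<in> carrier K \<Longrightarrow> \<beta> s k \<in> carrier K;
       \<And>s t k. s \<in> carrier RG \<Longrightarrow> t \<in> carrier RG \<Longrightarrow> k \<in> carrier K \<Longrightarrow> \<beta> (s \<oplus>\<^bsub>RG\<^esub> t) k = \<beta> s k \<oplus>\<^bsub>K\<^esub> \<beta> t k;
       \<And>s k l. s \<in> carrier RG \<Longrightarrow> k \<in> carrier K \<Longrightarrow> l \<in> carrier K \<Longrightarrow> \<beta> s (k \<oplus>\<^bsub>K\<^esub> l) = \<beta> s k \<oplus>\<^bsub>K\<^esub> \<beta> s l;
       \<And>s r k. s \<in> carrier RG \<Longrightarrow> r \<in> carrier R \<Longrightarrow> k \<in> carrier K \<Longrightarrow> \<beta> (s \<otimes>\<^bsub>RG\<^esub> cp_monom R \<one>\<^bsub>G\<^esub> r) k = \<beta> s (r \<odot>\<^bsub>K\<^esub> k)\<rbrakk>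
      \<Longrightarrow> \<exists>c \<in> carrier T \<rightarrow> carrier K. (\<forall>x\<in>carrier T. \<forall>y\<in>carrier T. c (x \<oplus>\<^bsub>T\<^esub> y) = c x \<oplus>\<^bsub>K\<^esub> c y) \<and>
        (\<forall>s\<in>carrier RG. \<forall>k\<in>carrier K. c (E s k) = \<beta> s k)"
  proof (rule tensor_balanced_map[where \<iota> = "cp_monom R \<one>\<^bsub>G\<^esub>", OF e K T iso], goal_cases)
    case (2 E)
    show ?case by (rule that[of E]) (fact 2)+
  qed
  define \<iota> where "\<iota> k = E (cp_monom R \<one>\<^bsub>G\<^esub> \<one>\<^bsub>R\<^esub>) k" for k
  have m: "cp_monom R g r \<in> carrier RG" if "g \<in> carrier G" "r \<in> carrier R" for g r using that by simp
  have act_\<iota>: "act T g (\<iota> k) = E (cp_monom R g \<one>\<^bsub>R\<^esub>) k" if "g \<in> carrier G" "k \<in> carrier K" for g k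
    unfolding \<iota>_def using that by (simp add: E_smult cp_monom_mult rho_one_right)
  have \<iota>_closed: "\<iota> k \<in> carrier T" if "k \<in> carrier K" for k
    unfolding \<iota>_def using that by (simp add: E_closed)
  have \<iota>: "\<iota> \<in> mod_hom R K (base T)"
  proof -
    have "\<iota> (a \<odot>\<^bsub>K\<^esub> x) = cp_monom R \<one>\<^bsub>G\<^esub> a \<odot>\<^bsub>T\<^esub> \<iota> x" if "a \<in> carrier R" "x \<in> carrier K" for a x
      unfolding \<iota>_def using that E_bal[of "cp_monom R \<one>\<^bsub>G\<^esub> \<one>\<^bsub>R\<^esub>" a x]
      by (simp add: E_smult cp_monom_mult rho_one_right sigma_one)
    then show ?thesis
      using \<iota>_closed by (auto simp: mod_hom_def E_add_right \<iota>_def)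
  qed
  have \<iota>K: "submodule (\<iota> ` carrier K) R (base T)"
  proof -
    interpret \<iota>: left_module_hom R K "base T" \<iota> by unfold_locales (rule \<iota>)
    show ?thesis by (rule \<iota>.submodule_image[OF K.submodule_carrier])
  qed
  let ?H = "T.T (carrier G) (\<iota> ` carrier K)"
  have H: "submodule ?H R (base T)" by (rule T.T_submodule[OF subset_refl \<iota>K])
  note HD = T.B.submoduleD[OF H]
  have \<iota>KC: "\<iota> ` carrier K \<subseteq> carrier T" using \<iota>_closed by auto
  have E_H: "E s k \<in> ?H" if s: "s \<in> carrier RG" and k: "k \<in> carrier K" for s k
  proof -
    have mono: "E (cp_monom R g r) k \<in> ?H" if g: "g \<in> carrier G" and r: "r \<in> carrier R" for g r
    proof -
      have "E (cp_monom R g r) k = cp_monom R \<one>\<^bsub>G\<^esub> r \<odot>\<^bsub>T\<^esub> E (cp_monom R g \<one>\<^bsub>R\<^esub>) k"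
        using g r k by (simp add: E_smult flip: monom_eq_scalar_act)
      also have "\<dots> = r \<odot>\<^bsub>base T\<^esub> act T g (\<iota> k)" using act_\<iota>[OF g k] by simp
      also have "\<dots> \<in> ?H"
        using T.T_superset[OF subset_refl \<iota>KC g] k by (intro HD(4)[OF r]) blast
      finally show ?thesis .
    qed
    have "E s k \<in> ?H" if "finite F" "F \<subseteq> carrier G" "s \<in> carrier RG" "cp_supp R s \<subseteq> F" for F s
      using that
    proof (induction F arbitrary: s rule: finite_induct)
      case empty
      then have "s = cp_monom R \<one>\<^bsub>G\<^esub> \<zero>\<^bsub>R\<^esub>" by (auto simp: cp_supp_def cp_monom_def)
      then show ?case using mono[of "\<one>\<^bsub>G\<^esub>" "\<zero>\<^bsub>R\<^esub>"] by simp
    next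
      case (insert g F)
      have sR: "s x \<in> carrier R" for x using insert.prems(2) by (auto simp: crossed_product_def)
      let ?s = "s(g := \<zero>\<^bsub>R\<^esub>)"
      have supp: "cp_supp R ?s \<subseteq> F" using insert.prems(3) by (auto simp: cp_supp_def split: if_splits)
      have s': "?s \<in> carrier RG"
        using sR supp insert.hyps(1) insert.prems(1) finite_subset[OF supp] by (auto simp: crossed_product_def)
      have "s = ?s \<oplus>\<^bsub>RG\<^esub> cp_monom R g (s g)"
        using sR by (auto simp: crossed_product_def cp_monom_def)
      then have "E s k = E ?s k \<oplus>\<^bsub>T\<^esub> E (cp_monom R g (s g)) k"
        using E_add_left[OF s' m[of g "s g"] k] sR insert.prems(1) by simp
      moreover have "E ?s k \<in> ?H" using insert.IH[OF _ s' supp] insert.prems(1) by blast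
      moreover have "E (cp_monom R g (s g)) k \<in> ?H" using mono[of g "s g"] sR insert.prems(1) by simp
      ultimately show ?case using HD(3) by simp
    qed
    then show ?thesis using s by (auto simp: crossed_product_def)
  qed
  have gen: "carrier T \<subseteq> ?H"
  proof (rule E_gen[OF E_H])
    show "\<zero>\<^bsub>T\<^esub> \<in> ?H" using HD(2) by simp
    show "x \<ominus>\<^bsub>T\<^esub> y \<in> ?H" if "x \<in> ?H" "y \<in> ?H" for x y
    proof -
      have "x \<ominus>\<^bsub>base T\<^esub> y \<in> ?H" using HD(6) that .
      moreover have "x \<ominus>\<^bsub>base T\<^esub> y = x \<ominus>\<^bsub>T\<^esub> y" by (simp add: a_minus_def a_inv_def m_inv_def)
      ultimately show ?thesis by simp
    qed
  qed
  have "\<exists>c. (\<forall>x\<in>carrier T. c x \<in> carrier K) \<and> (\<forall>x\<in>carrier T. \<forall>y\<in>carrier T. c (x \<oplus>\<^bsub>T\<^esub> y) = c x \<oplus>\<^bsub>K\<^esub> c y) \<and>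
      (\<forall>h\<in>carrier G. \<forall>k\<in>carrier K. c (act T h (\<iota> k)) = (if g = h then k else \<zero>\<^bsub>K\<^esub>))"
    if g: "g \<in> carrier G" for g
  proof -
    let ?\<beta> = "\<lambda>s k. sigma_inv g (s g) \<odot>\<^bsub>K\<^esub> k"
    have sR: "s x \<in> carrier R" if "s \<in> carrier RG" for s x using that by (auto simp: crossed_product_def)
    have "\<exists>c \<in> carrier T \<rightarrow> carrier K. (\<forall>x\<in>carrier T. \<forall>y\<in>carrier T. c (x \<oplus>\<^bsub>T\<^esub> y) = c x \<oplus>\<^bsub>K\<^esub> c y) \<and>
        (\<forall>s\<in>carrier RG. \<forall>k\<in>carrier K. c (E s k) = ?\<beta> s k)"
    proof (rule E_univ)
      fix s t k l r assume "s \<in> carrier RG" and "k \<in> carrier K"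
      note s = sR[OF this(1), of g] and k = this(2)
      show "?\<beta> s k \<in> carrier K" using sigma_inv(1)[OF g s] k by simp
      show "?\<beta> (s \<oplus>\<^bsub>RG\<^esub> t) k = ?\<beta> s k \<oplus>\<^bsub>K\<^esub> ?\<beta> t k" if "t \<in> carrier RG"
      proof -
        have "(s \<oplus>\<^bsub>RG\<^esub> t) g = s g \<oplus>\<^bsub>R\<^esub> t g" by (simp add: crossed_product_def)
        then show ?thesis
          using sigma_inv(1)[OF g] sigma_inv_add[OF g s sR[OF that]] s k sR[OF that]
          by (simp add: K.smult_l_distr)
      qed
      show "?\<beta> s (k \<oplus>\<^bsub>K\<^esub> l) = ?\<beta> s k \<oplus>\<^bsub>K\<^esub> ?\<beta> s l" if "l \<in> carrier K"
        using sigma_inv(1)[OF g s] k that by (simp add: K.smult_r_distr)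
      show "?\<beta> (s \<otimes>\<^bsub>RG\<^esub> cp_monom R \<one>\<^bsub>G\<^esub> r) k = ?\<beta> s (r \<odot>\<^bsub>K\<^esub> k)" if "r \<in> carrier R"
        using cp_mult_base[OF \<open>s \<in> carrier RG\<close> that g] sigma_inv_mult[OF g s that] sigma_inv(1)[OF g s] k that
        by (simp add: K.smult_assoc)
    qed
    then obtain c where c: "c \<in> carrier T \<rightarrow> carrier K"
      "\<forall>x\<in>carrier T. \<forall>y\<in>carrier T. c (x \<oplus>\<^bsub>T\<^esub> y) = c x \<oplus>\<^bsub>K\<^esub> c y"
      "\<forall>s\<in>carrier RG. \<forall>k\<in>carrier K. c (E s k) = ?\<beta> s k" by blast
    have "c (act T h (\<iota> k)) = (if g = h then k else \<zero>\<^bsub>K\<^esub>)" if "h \<in> carrier G" "k \<in> carrier K" for h k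
    proof -
      have "c (act T h (\<iota> k)) = ?\<beta> (cp_monom R h \<one>\<^bsub>R\<^esub>) k"
        using act_\<iota>[OF that] c(3) m[OF that(1), of "\<one>\<^bsub>R\<^esub>"] that(2) by simp
      also have "\<dots> = (if g = h then k else \<zero>\<^bsub>K\<^esub>)"
        using that g by (simp add: cp_monom_def sigma_inv_one sigma_inv_zero)
      finally show ?thesis .
    qed
    then show ?thesis using c(1,2) by (intro exI[of _ c]) auto
  qed
  then have "\<exists>c. \<forall>g\<in>carrier G. (\<forall>x\<in>carrier T. c g x \<in> carrier K) \<and>
      (\<forall>x\<in>carrier T. \<forall>y\<in>carrier T. c g (x \<oplus>\<^bsub>T\<^esub> y) = c g x \<oplus>\<^bsub>K\<^esub> c g y) \<and>
      (\<forall>h\<in>carrier G. \<forall>k\<in>carrier K. c g (act T h (\<iota> k)) = (if g = h then k else \<zero>\<^bsub>K\<^esub>))"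
    by (intro bchoice) blast
  then obtain c where "\<forall>g\<in>carrier G. (\<forall>x\<in>carrier T. c g x \<in> carrier K) \<and>
      (\<forall>x\<in>carrier T. \<forall>y\<in>carrier T. c g (x \<oplus>\<^bsub>T\<^esub> y) = c g x \<oplus>\<^bsub>K\<^esub> c g y) \<and>
      (\<forall>h\<in>carrier G. \<forall>k\<in>carrier K. c g (act T h (\<iota> k)) = (if g = h then k else \<zero>\<^bsub>K\<^esub>))" ..
  then show ?thesis using that[OF \<iota> gen, of c] by simp
qed

end

text \<open>The module \<open>M\<close> is the direct sum of the translates of \<open>\<iota> K\<close>: they generate it, and \<open>c g\<close> reads off
  the component at \<open>g\<close>.\<close>

locale induced_coordinates = entropy_module R G \<sigma> \<rho> L M + K: lmodule R K
  for R :: "('r, 'c) ring_scheme" and G :: "('g, 'd) monoid_scheme"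
    and \<sigma> :: "'g \<Rightarrow> 'r \<Rightarrow> 'r" and \<rho> :: "'g \<Rightarrow> 'g \<Rightarrow> 'r"
    and L :: "('r, 'm) module \<Rightarrow> ennreal" and M :: "('g \<Rightarrow> 'r, 'm) module"
    and K :: "('r, 'm) module" +
  fixes \<iota> :: "'m \<Rightarrow> 'm" and c :: "'g \<Rightarrow> 'm \<Rightarrow> 'm"
  assumes inc_hom: "\<iota> \<in> mod_hom R K (base M)"
    and generated: "carrier M \<subseteq> T_sum R M (carrier G) (\<iota> ` carrier K)"
    and coord_closed: "g \<in> carrier G \<Longrightarrow> x \<in> carrier M \<Longrightarrow> c g x \<in> carrier K"
    and coord_add: "g \<in> carrier G \<Longrightarrow> x \<in> carrier M \<Longrightarrow> y \<in> carrier M \<Longrightarrow> c g (x \<oplus>\<^bsub>M\<^esub> y) = c g x \<oplus>\<^bsub>K\<^esub> c g y"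
    and coord_act: "g \<in> carrier G \<Longrightarrow> h \<in> carrier G \<Longrightarrow> k \<in> carrier K \<Longrightarrow>
      c g (act M h (\<iota> k)) = (if g = h then k else \<zero>\<^bsub>K\<^esub>)"
    and fin_K: "L K < \<infinity>"
begin

sublocale inc: left_module_hom R K "base_mod R G M" \<iota>
  by unfold_locales (rule inc_hom)

abbreviation K0 :: "'m set" where "K0 \<equiv> \<iota> ` carrier K"

lemma inc_closed: "k \<in> carrier K \<Longrightarrow> \<iota> k \<in> carrier M"
  using inc.closed[of k] by simp

lemma K0_sub: "K0 \<subseteq> carrier M"
  using inc_closed by auto

lemma submodule_K0: "submodule K0 R B"
  by (rule inc.submodule_image[OF K.submodule_carrier])

lemma inc_inj: "inj_on \<iota> (carrier K)"
proof (rule inj_onI)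
  fix k l assume kl: "k \<in> carrier K" "l \<in> carrier K" "\<iota> k = \<iota> l"
  have "c \<one>\<^bsub>G\<^esub> (\<iota> k) = k" if "k \<in> carrier K" for k
    using coord_act[of "\<one>\<^bsub>G\<^esub>" "\<one>\<^bsub>G\<^esub>" k] that inc_closed[OF that] by simp
  then show "k = l" using kl by metis
qed

lemma len_K0: "len B K0 = L K"
  using len_image_inj[OF K.left_module_axioms left_module_base inc_hom K.submodule_carrier inc_inj] by simp

lemma fin_len_K0: "fin_len B K0"
  using submodule_K0 len_K0 fin_K by (simp add: fin_len_def)

lemma coord_zero: "g \<in> carrier G \<Longrightarrow> c g \<zero>\<^bsub>M\<^esub> = \<zero>\<^bsub>K\<^esub>"
  using coord_add[of g "\<zero>\<^bsub>M\<^esub>" "\<zero>\<^bsub>M\<^esub>"] coord_closed[of g "\<zero>\<^bsub>M\<^esub>"] by simp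

lemma coord_sum:
  assumes "finite E" "E \<subseteq> carrier G" "k \<in> E \<rightarrow> carrier K" and h: "h \<in> carrier G"
  shows "c h (\<Oplus>\<^bsub>M\<^esub>g\<in>E. act M g (\<iota> (k g))) = (if h \<in> E then k h else \<zero>\<^bsub>K\<^esub>)"
  using assms(1-3)
proof (induction E rule: finite_induct)
  case empty
  then show ?case using coord_zero[OF h] by simp
next
  case (insert g E)
  have cl: "(\<lambda>g. act M g (\<iota> (k g))) \<in> E \<rightarrow> carrier M"
    using insert.prems inc_closed by (auto simp: Pi_def subset_iff)
  have cg: "g \<in> carrier G" "k g \<in> carrier K" "act M g (\<iota> (k g)) \<in> carrier M"
    using insert.prems inc_closed by (auto simp: Pi_def subset_iff)
  have "c h (\<Oplus>\<^bsub>M\<^esub>g\<in>insert g E. act M g (\<iota> (k g)))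
      = c h (act M g (\<iota> (k g)) \<oplus>\<^bsub>M\<^esub> (\<Oplus>\<^bsub>M\<^esub>g\<in>E. act M g (\<iota> (k g))))"
    using M.M.finsum_insert[OF insert.hyps cl cg(3)] by simp
  also have "\<dots> = c h (act M g (\<iota> (k g))) \<oplus>\<^bsub>K\<^esub> c h (\<Oplus>\<^bsub>M\<^esub>g\<in>E. act M g (\<iota> (k g)))"
    by (rule coord_add[OF h cg(3) M.M.finsum_closed[OF cl]])
  also have "\<dots> = (if h = g then k g else \<zero>\<^bsub>K\<^esub>) \<oplus>\<^bsub>K\<^esub> (if h \<in> E then k h else \<zero>\<^bsub>K\<^esub>)"
    using coord_act[OF h cg(1,2)] insert.IH insert.prems by simp
  also have "\<dots> = (if h \<in> insert g E then k h else \<zero>\<^bsub>K\<^esub>)"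
    using insert.hyps insert.prems cg(2) by (auto simp: Pi_def)
  finally show ?case .
qed

lemma T_K0_E:
  assumes F: "F \<subseteq> carrier G" and x: "x \<in> T F K0"
  obtains E k where "finite E" "E \<subseteq> F" "k \<in> E \<rightarrow> carrier K" "x = (\<Oplus>\<^bsub>M\<^esub>g\<in>E. act M g (\<iota> (k g)))"
proof -
  obtain E k where E: "finite E" "E \<subseteq> F" "k \<in> E \<rightarrow> K0" "x = (\<Oplus>\<^bsub>M\<^esub>g\<in>E. act M g (k g))"
    by (rule T_sumE[OF x])
  have k: "k g \<in> K0" if "g \<in> E" for g using E(3) that by auto
  define k' where "k' g = inv_into (carrier K) \<iota> (k g)" for g
  have k': "k' g \<in> carrier K" "\<iota> (k' g) = k g" if "g \<in> E" for g
    unfolding k'_def by (rule inv_into_into[OF k[OF that]], rule f_inv_into_f[OF k[OF that]])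
  have "k' \<in> E \<rightarrow> carrier K" using k' by auto
  moreover have "x = (\<Oplus>\<^bsub>M\<^esub>g\<in>E. act M g (\<iota> (k' g)))"
    unfolding E(4)
  proof (rule M.M.finsum_cong'[OF refl])
    show "(\<lambda>g. act M g (\<iota> (k' g))) \<in> E \<rightarrow> carrier M"
      using E(2) F by (intro Pi_I act_closed inc_closed k'(1)) auto
    show "act M g (k g) = act M g (\<iota> (k' g))" if "g \<in> E" for g using k'(2)[OF that] by simp
  qed
  ultimately show ?thesis by (rule that[OF E(1,2)])
qed

text \<open>The coordinates of an element of both submodules vanish off \<open>F\<close> and off \<open>F'\<close>.\<close>

lemma T_K0_disjoint:
  assumes F: "F \<subseteq> carrier G" "F' \<subseteq> carrier G" "F \<inter> F' = {}"
  shows "T F K0 \<inter> T F' K0 = {\<zero>\<^bsub>M\<^esub>}"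
proof
  show "T F K0 \<inter> T F' K0 \<subseteq> {\<zero>\<^bsub>M\<^esub>}"
  proof
    fix x assume x: "x \<in> T F K0 \<inter> T F' K0"
    then have xF: "x \<in> T F K0" and xF': "x \<in> T F' K0" by auto
    obtain E k where E: "finite E" "E \<subseteq> F" "k \<in> E \<rightarrow> carrier K" "x = (\<Oplus>\<^bsub>M\<^esub>g\<in>E. act M g (\<iota> (k g)))"
      by (rule T_K0_E[OF F(1) xF])
    obtain E' k' where E': "finite E'" "E' \<subseteq> F'" "k' \<in> E' \<rightarrow> carrier K" "x = (\<Oplus>\<^bsub>M\<^esub>g\<in>E'. act M g (\<iota> (k' g)))"
      by (rule T_K0_E[OF F(2) xF'])
    have EG: "E \<subseteq> carrier G" "E' \<subseteq> carrier G" using E(2) E'(2) F by auto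
    have k0: "k h = \<zero>\<^bsub>K\<^esub>" if h: "h \<in> E" for h
    proof -
      have hG: "h \<in> carrier G" using h EG by auto
      have "h \<notin> E'" using h E(2) E'(2) F(3) by auto
      then have "c h x = \<zero>\<^bsub>K\<^esub>" unfolding E'(4) using coord_sum[OF E'(1) EG(2) E'(3) hG] by simp
      moreover have "c h x = k h" unfolding E(4) using coord_sum[OF E(1) EG(1) E(3) hG] h by simp
      ultimately show ?thesis by simp
    qed
    have "x = (\<Oplus>\<^bsub>M\<^esub>g\<in>E. \<zero>\<^bsub>M\<^esub>)"
      unfolding E(4)
    proof (rule M.M.finsum_cong'[OF refl])
      show "act M g (\<iota> (k g)) = \<zero>\<^bsub>M\<^esub>" if "g \<in> E" for g
        using k0[OF that] EG(1) that inc.zero by (auto simp: subset_iff)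
    qed simp
    then show "x \<in> {\<zero>\<^bsub>M\<^esub>}" by simp
  qed
  show "{\<zero>\<^bsub>M\<^esub>} \<subseteq> T F K0 \<inter> T F' K0"
    using B.submoduleD(2)[OF T_submodule[OF F(1) submodule_K0]]
      B.submoduleD(2)[OF T_submodule[OF F(2) submodule_K0]] by simp
qed

text \<open>The submodules \<open>x H\<close> lie in the \<open>T_(x E) K0\<close>, which are independent for disjoint \<open>x E\<close>, so the modular
  law adds up their lengths.\<close>

lemma rlen_T_disjoint_translates:
  assumes E: "E \<subseteq> carrier G" and H: "fin_len B H" "H \<subseteq> T E K0"
    and "finite S" "S \<subseteq> carrier G"
    and "\<And>x y. x \<in> S \<Longrightarrow> y \<in> S \<Longrightarrow> x \<noteq> y \<Longrightarrow> (x <#\<^bsub>G\<^esub> E) \<inter> (y <#\<^bsub>G\<^esub> E) = {}"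
  shows "card S * rlen B H \<le> rlen B (T S H)"
  using assms(4-6)
proof (induction S rule: finite_induct)
  case empty
  then show ?case by simp
next
  case (insert x S)
  have x: "x \<in> carrier G" and S: "S \<subseteq> carrier G" using insert.prems(1) by auto
  have IH: "card S * rlen B H \<le> rlen B (T S H)"
    using insert.prems(2) by (intro insert.IH[OF S]) blast
  have xE: "x <#\<^bsub>G\<^esub> E \<subseteq> carrier G" and SE: "S <#>\<^bsub>G\<^esub> E \<subseteq> carrier G"
    using x S E by (auto simp: l_coset_def set_mult_def)
  have dis: "(x <#\<^bsub>G\<^esub> E) \<inter> (S <#>\<^bsub>G\<^esub> E) = {}"
  proof -
    have "S <#>\<^bsub>G\<^esub> E = (\<Union>s\<in>S. s <#\<^bsub>G\<^esub> E)" by (auto simp: set_mult_def l_coset_def)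
    then show ?thesis using insert.prems(2)[of x] insert.hyps(2) by fastforce
  qed
  have 1: "act M x ` H \<subseteq> T (x <#\<^bsub>G\<^esub> E) K0"
    unfolding act_T[OF x E submodule_K0, symmetric] by (rule image_mono[OF H(2)])
  have "T S H \<subseteq> T S (T E K0)" by (rule T_mono[OF subset_refl H(2)])
  also have "\<dots> \<subseteq> T (S <#>\<^bsub>G\<^esub> E) K0" by (rule T_T[OF S E submodule_K0])
  finally have 2: "T S H \<subseteq> T (S <#>\<^bsub>G\<^esub> E) K0" .
  have fx: "fin_len B (act M x ` H)" by (rule fin_len_act[OF x H(1)])
  have fS: "fin_len B (T S H)" by (rule fin_len_T[OF insert.hyps(1) S H(1)])
  have "act M x ` H \<inter> T S H \<subseteq> {\<zero>\<^bsub>M\<^esub>}" using 1 2 T_K0_disjoint[OF xE SE dis] by blast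
  then have "act M x ` H \<inter> T S H = {\<zero>\<^bsub>B\<^esub>}"
    using B.submoduleD(2)[OF fin_lenD[OF fx]] B.submoduleD(2)[OF fin_lenD[OF fS]] by auto
  then have "rlen B (act M x ` H \<inter> T S H) = 0" by (simp only: rlen_zero[OF left_module_base])
  then have "rlen B (act M x ` H <+>\<^bsub>B\<^esub> T S H) = rlen B H + rlen B (T S H)"
    using rlen_modular[OF left_module_base fx fS] rlen_act[OF x fin_lenD[OF H(1)]] by simp
  moreover have "T (insert x S) H = act M x ` H <+>\<^bsub>B\<^esub> T S H"
    using T_Un[of "{x}" S H] T_singleton[OF x fin_lenD[OF H(1)]] x S fin_lenD[OF H(1)] by simp
  ultimately show ?case using IH insert.hyps by (simp add: algebra_simps)
qed

lemma K0_le_T_one: "K0 \<subseteq> T {\<one>\<^bsub>G\<^esub>} K0"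
proof
  fix x assume x: "x \<in> K0"
  then have "act M \<one>\<^bsub>G\<^esub> x = x" using K0_sub by auto
  then show "x \<in> T {\<one>\<^bsub>G\<^esub>} K0" using T_superset[of "{\<one>\<^bsub>G\<^esub>}" K0 "\<one>\<^bsub>G\<^esub>"] K0_sub x by force
qed

lemma ent_real_K0: "ent_real M K0 = rlen B K0"
proof (rule antisym[OF ent_real_le_rlen[OF fin_len_K0]], rule ent_real_greatest)
  fix F assume F: "finite F" "F \<subseteq> carrier G" "F \<noteq> {}"
  have "(x <#\<^bsub>G\<^esub> {\<one>\<^bsub>G\<^esub>}) \<inter> (y <#\<^bsub>G\<^esub> {\<one>\<^bsub>G\<^esub>}) = {}" if "x \<in> F" "y \<in> F" "x \<noteq> y" for x y
    using that F(2) by (auto simp: l_coset_def subset_iff)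
  then show "card F * rlen B K0 \<le> rlen B (T F K0)"
    using rlen_T_disjoint_translates[OF _ fin_len_K0 K0_le_T_one F(1,2)] by simp
qed

text \<open>An element is a sum over finitely many group elements and so lies in a member of this family.\<close>

lemma exhaustion:
  defines "\<D> \<equiv> {T E K0 | E. finite E \<and> E \<subseteq> carrier G}"
  shows "\<D> \<noteq> {}" "\<And>Y. Y \<in> \<D> \<Longrightarrow> submodule Y R B"
    "\<And>Y Z. Y \<in> \<D> \<Longrightarrow> Z \<in> \<D> \<Longrightarrow> \<exists>W\<in>\<D>. Y \<subseteq> W \<and> Z \<subseteq> W"
    "carrier M \<subseteq> \<Union>\<D>"
proof -
  show "\<D> \<noteq> {}" unfolding \<D>_def by blast
  show "submodule Y R B" if "Y \<in> \<D>" for Y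
    using that T_submodule[OF _ submodule_K0] unfolding \<D>_def by blast
  show "\<exists>W\<in>\<D>. Y \<subseteq> W \<and> Z \<subseteq> W" if YZ: "Y \<in> \<D>" "Z \<in> \<D>" for Y Z
  proof -
    obtain E E' where E: "Y = T E K0" "Z = T E' K0" "finite E" "finite E'" "E \<subseteq> carrier G" "E' \<subseteq> carrier G"
      using YZ unfolding \<D>_def by blast
    then have "T (E \<union> E') K0 \<in> \<D>" unfolding \<D>_def by blast
    moreover have "Y \<subseteq> T (E \<union> E') K0" "Z \<subseteq> T (E \<union> E') K0" unfolding E(1,2) by (intro T_mono; simp)+
    ultimately show ?thesis by blast
  qed
  show "carrier M \<subseteq> \<Union>\<D>"
  proof
    fix x assume "x \<in> carrier M"
    then have "x \<in> T (carrier G) K0" using generated by blast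
    then obtain E k where E: "finite E" "E \<subseteq> carrier G" "k \<in> E \<rightarrow> K0" "x = (\<Oplus>\<^bsub>M\<^esub>g\<in>E. act M g (k g))"
      by (rule T_sumE)
    have "x \<in> T E K0" unfolding E(4) by (rule T_sumI[OF E(1) subset_refl E(3)])
    then show "x \<in> \<Union>\<D>" unfolding \<D>_def using E(1,2) by blast
  qed
qed

lemma finite_subset_T:
  assumes "finite S" "S \<subseteq> carrier M"
  obtains E where "finite E" "E \<subseteq> carrier G" "S \<subseteq> T E K0"
proof -
  have "\<exists>E. finite E \<and> E \<subseteq> carrier G \<and> S \<subseteq> T E K0"
    using assms
  proof (induction S rule: finite_induct)
    case empty
    then show ?case by blast
  next
    case (insert x S)
    then obtain E where E: "finite E" "E \<subseteq> carrier G" "S \<subseteq> T E K0" by auto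
    have "x \<in> \<Union>{T E K0 | E. finite E \<and> E \<subseteq> carrier G}"
      by (rule subsetD[OF exhaustion(4)]) (use insert.prems in simp)
    then obtain E' where E': "finite E'" "E' \<subseteq> carrier G" "x \<in> T E' K0" by blast
    have "T E K0 \<subseteq> T (E \<union> E') K0" "T E' K0 \<subseteq> T (E \<union> E') K0" by (intro T_mono; simp)+
    then have "insert x S \<subseteq> T (E \<union> E') K0" using E(3) E'(3) by blast
    then show ?case using E E' by (intro exI[of _ "E \<union> E'"]) simp
  qed
  then show ?thesis using that by blast
qed

lemma fg_subset_T:
  assumes "fg_submodule J R B"
  obtains E where "finite E" "E \<subseteq> carrier G" "J \<subseteq> T E K0"
proof -
  obtain S where S: "finite S" "S \<subseteq> carrier M" "J = mod_span R B S"
    using assms by (auto simp: fg_submodule_def)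
  obtain E where E: "finite E" "E \<subseteq> carrier G" "S \<subseteq> T E K0" by (rule finite_subset_T[OF S(1,2)])
  have "J \<subseteq> T E K0" unfolding S(3) by (rule B.span_least[OF T_submodule[OF E(2) submodule_K0] E(3)])
  then show ?thesis using that E(1,2) by blast
qed

lemma induced_lFin: "M \<in> lFin_L R G \<sigma> \<rho> L"
proof -
  have "fin_len B J" if J: "fg_submodule J R B" for J
  proof -
    obtain E where E: "finite E" "E \<subseteq> carrier G" "J \<subseteq> T E K0" by (rule fg_subset_T[OF J])
    show ?thesis
      by (rule fin_len_subset[OF left_module_base fin_len_T[OF E(1,2) fin_len_K0] B.fg_submodule_submodule[OF J] E(3)])
  qed
  then show ?thesis using M.left_module_axioms by (simp add: lFin_iff)
qed

text \<open>Up to \<open>\<epsilon>\<close> a submodule of finite length lies in some \<open>T_E K0\<close>, where the entropy is at most that at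
  \<open>K0\<close>, which is the length of \<open>K0\<close>.\<close>

lemma ent_induced: "ent R G L M = L K"
proof -
  have LK: "ennreal (rlen B K0) = L K" using ennreal_rlen[OF fin_len_K0] len_K0 by simp
  have "ent_real M J \<le> rlen B K0" if J: "fin_len B J" for J
  proof (rule field_le_epsilon)
    fix e :: real assume e: "0 < e"
    have JC: "J \<subseteq> carrier M" using B.submoduleD(1)[OF fin_lenD[OF J]] by simp
    obtain Y where Y: "Y \<in> {T E K0 | E. finite E \<and> E \<subseteq> carrier G}" "rlen B J \<le> rlen B (J \<inter> Y) + e"
      by (rule rlen_approx_directed[OF left_module_base J exhaustion(1) exhaustion(2) exhaustion(3)
          subset_trans[OF JC exhaustion(4)] e])
    then obtain E where E: "finite E" "E \<subseteq> carrier G" "Y = T E K0" by blast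
    have Yf: "fin_len B Y" unfolding E(3) by (rule fin_len_T[OF E(1,2) fin_len_K0])
    have JY: "submodule (J \<inter> Y) R B" by (rule B.submodule_Int[OF fin_lenD[OF J] fin_lenD[OF Yf]])
    have "ent_real M J \<le> ent_real M (J \<inter> Y) + (rlen B J - rlen B (J \<inter> Y))"
      by (rule ent_real_increment[OF J JY Int_lower1])
    also have "ent_real M (J \<inter> Y) \<le> ent_real M Y" by (rule ent_real_mono[OF Yf JY Int_lower2])
    also have "ent_real M Y \<le> ent_real M K0" unfolding E(3) by (rule ent_real_T_le[OF E(1,2) fin_len_K0])
    finally show "ent_real M J \<le> rlen B K0 + e" using Y(2) ent_real_K0 by simp
  qed
  then have "ent R G L M \<le> ennreal (rlen B K0)"
    unfolding ent_eq by (intro SUP_least ennreal_leI) simp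
  moreover have "ennreal (rlen B K0) \<le> ent R G L M"
    using ent_real_le_ent[OF fin_len_K0] ent_real_K0 by simp
  ultimately show ?thesis using LK by simp
qed

text \<open>A finite set \<open>F\<close> contains at least \<open>card F / (card E)\<^sup>2\<close> points with disjoint translates of \<open>E\<close>,
  and these carry independent copies of \<open>H\<close>.\<close>

lemma ent_real_lower_bound:
  assumes H: "fin_len B H" and E: "finite E" "E \<subseteq> carrier G" "E \<noteq> {}" and HE: "H \<subseteq> T E K0"
  shows "rlen B H / (card E * card E) \<le> ent_real M H"
proof (rule ent_real_greatest)
  fix F assume F: "finite F" "F \<subseteq> carrier G" "F \<noteq> {}"
  obtain S where S: "S \<subseteq> F" "\<And>x y. x \<in> S \<Longrightarrow> y \<in> S \<Longrightarrow> x \<noteq> y \<Longrightarrow> (x <#\<^bsub>G\<^esub> E) \<inter> (y <#\<^bsub>G\<^esub> E) = {}"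
    "card F \<le> card S * (card E * card E)"
    using packing[OF E F(1,2)] by blast
  have cE: "0 < real (card E * card E)" using E by (simp add: card_gt_0_iff)
  have fS: "finite S" "S \<subseteq> carrier G" using S(1) F finite_subset by auto
  have "real (card F) \<le> card S * real (card E * card E)"
    using S(3) by (simp flip: of_nat_mult)
  then have "card F * rlen B H \<le> card S * real (card E * card E) * rlen B H"
    by (rule mult_right_mono) simp
  then have "card F * (rlen B H / (card E * card E)) \<le> card S * rlen B H"
    using cE by (simp add: pos_divide_le_eq ac_simps)
  also have "\<dots> \<le> rlen B (T S H)" by (rule rlen_T_disjoint_translates[OF E(2) H HE fS S(2)])
  also have "\<dots> \<le> rlen B (T F H)"
    by (rule rlen_T_mono[OF F(1,2) H fin_lenD[OF H] S(1) subset_refl])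
  finally show "card F * (rlen B H / (card E * card E)) \<le> rlen B (T F H)" .
qed

text \<open>If the entropy vanishes, \<open>ent_real_lower_bound\<close> shows that every finitely generated submodule has
  length zero, and the length of \<open>N\<close> is the supremum of theirs. Conversely, the entropy at a
  submodule is at most its length.\<close>

lemma ent_submodule_zero_iff:
  assumes N: "submodule N RG M"
  shows "ent R G L (sub_mod M N) = 0 \<longleftrightarrow> L (base (sub_mod M N)) = 0"
proof -
  let ?P = "sub_mod M N"
  have P: "left_module RG ?P" by (rule M.left_module_sub_mod[OF N])
  have NM: "N \<subseteq> carrier M" by (rule M.submoduleD(1)[OF N])
  have id: "id \<in> mod_hom RG ?P M" "inj_on id (carrier ?P)" using NM by (auto simp: mod_hom_def)
  interpret P: entropy_module R G \<sigma> \<rho> L ?P by (rule entropy_moduleI[OF P])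
  have P_lFin: "?P \<in> lFin_L R G \<sigma> \<rho> L" by (rule lFin_sub[OF induced_lFin P id])
  have all: "len (base ?P) (carrier (base ?P)) = L (base ?P)"
    by (simp add: restrict_scalars_def)
  show ?thesis
  proof
    assume 0: "L (base ?P) = 0"
    have "ennreal (ent_real ?P J) \<le> 0" if J: "fin_len (base ?P) J" for J
    proof -
      have "len (base ?P) J \<le> L (base ?P)"
        using len_mono[OF P.left_module_base fin_lenD[OF J] P.B.submodule_carrier P.B.submoduleD(1)[OF fin_lenD[OF J]]]
        unfolding all .
      then have "rlen (base ?P) J = 0" using 0 by (simp add: rlen_def)
      then show ?thesis using P.ent_real_le_rlen[OF J] by (simp add: ennreal_neg)
    qed
    then have "ent R G L ?P \<le> 0" unfolding P.ent_eq by (intro SUP_least) simp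
    then show "ent R G L ?P = 0" by simp
  next
    assume 0: "ent R G L ?P = 0"
    have "len (base ?P) H = 0" if H: "fg_submodule H R (base ?P)" for H
    proof -
      have Hf: "fin_len (base ?P) H" using P_lFin H by (simp add: lFin_iff)
      have Hs: "submodule H R (base ?P)" by (rule fin_lenD[OF Hf])
      obtain S where S: "finite S" "S \<subseteq> N" "H = mod_span R (base ?P) S"
        using H by (auto simp: fg_submodule_def)
      obtain E0 where E0: "finite E0" "E0 \<subseteq> carrier G" "S \<subseteq> T E0 K0"
        using finite_subset_T[OF S(1)] S(2) NM by blast
      let ?E = "insert \<one>\<^bsub>G\<^esub> E0"
      have E: "finite ?E" "?E \<subseteq> carrier G" "?E \<noteq> {}" using E0 by auto
      have SE: "S \<subseteq> T ?E K0" using E0(3) T_mono[of E0 ?E K0 K0] by auto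
      interpret id: left_module_hom R "base ?P" B id by (rule base_left_module_hom[OF P M.left_module_axioms id(1)])
      have "id ` H = mod_span R B S" unfolding S(3) using id.span_image[of S] S(2) by simp
      then have HE: "H \<subseteq> T ?E K0"
        using B.span_least[OF T_submodule[OF E(2) submodule_K0] SE] by simp
      have HB: "fin_len B H" using fin_len_image_inj_iff(1)[OF P M.left_module_axioms id Hs] Hf by simp
      have eq: "ent_real M H = ent_real ?P H" "rlen B H = rlen (base ?P) H"
        using ent_real_image_inj[OF P M.left_module_axioms id Hs]
          fin_len_image_inj_iff(2)[OF P M.left_module_axioms id Hs] by simp_all
      have "ennreal (ent_real ?P H) \<le> 0" using P.ent_real_le_ent[OF Hf] 0 by simp
      then have "ent_real ?P H \<le> 0" using ent_real_nonneg[of ?P H] by (simp add: ennreal_eq_0_iff)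
      then have "rlen B H / (card ?E * card ?E) \<le> 0"
        using ent_real_lower_bound[OF HB E HE] eq(1) by simp
      moreover have "0 < real (card ?E * card ?E)" using E by (simp add: card_gt_0_iff)
      ultimately have "rlen B H \<le> 0" by (simp only: pos_divide_le_eq mult_zero_left)
      then have "rlen (base ?P) H = 0" using eq(2) rlen_nonneg[of "base ?P" H] by simp
      then show ?thesis using ennreal_rlen[OF Hf] by simp
    qed
    then have "(SUP H\<in>{H. fg_submodule H R (base ?P) \<and> H \<subseteq> carrier (base ?P)}. len (base ?P) H) \<le> 0"
      by (intro SUP_least) simp
    then have "len (base ?P) (carrier (base ?P)) \<le> 0"
      using len_fg[OF P.left_module_base P.B.submodule_carrier] by simp
    then show "L (base ?P) = 0" unfolding all by simp
  qed
qed

end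

context entropy_setting
begin

lemma induced_module_has_coordinates:
  fixes K :: "('r, 'm) module" and T :: "('g \<Rightarrow> 'r, 'm) module"
  assumes K: "left_module R K" "L K < \<infinity>" and ind: "is_induced_module R G \<sigma> \<rho> K T"
  obtains \<iota> c where "induced_coordinates R G \<sigma> \<rho> L T K \<iota> c"
proof (rule induced_module_coordinates[OF K(1) ind], goal_cases)
  case (1 \<iota> c)
  have T: "left_module RG T" using ind by (simp add: is_induced_module_def)
  have "induced_coordinates R G \<sigma> \<rho> L T K \<iota> c"
    using entropy_moduleI[OF T] K 1
    by (simp add: induced_coordinates_def induced_coordinates_axioms_def lmodule_def)
  then show ?case by (rule that)
qed

end

theorem theoremB:
  fixes R :: "('r, 'c) ring_scheme" and G :: "('g, 'd) monoid_scheme"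
    and \<sigma> :: "'g \<Rightarrow> 'r \<Rightarrow> 'r" and \<rho> :: "'g \<Rightarrow> 'g \<Rightarrow> 'r"
    and L :: "('r, 'm) module \<Rightarrow> ennreal"
  assumes "ring R"
    and "fin_gen_group G" and "amenable G"
    and "crossed_system R G \<sigma> \<rho>"
    and "length_function R (R_Mod R) L"
    and "compatible R G \<sigma> L"
  shows "length_function (crossed_product R G \<sigma> \<rho>) (lFin_L R G \<sigma> \<rho> L) (ent R G L)
    \<and> (\<forall>K\<in>R_Mod R. L K < \<infinity> \<longrightarrow>
           (\<forall>T :: ('g \<Rightarrow> 'r, 'm) module. is_induced_module R G \<sigma> \<rho> K T \<longrightarrow>
              T \<in> lFin_L R G \<sigma> \<rho> L \<and> ent R G L T = L K))
    \<and> (\<forall>K\<in>R_Mod R. L K < \<infinity> \<longrightarrow>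
           (\<forall>T :: ('g \<Rightarrow> 'r, 'm) module. is_induced_module R G \<sigma> \<rho> K T \<longrightarrow>
              (\<forall>N. submodule N (crossed_product R G \<sigma> \<rho>) T \<longrightarrow>
                 (ent R G L (sub_mod T N) = 0 \<longleftrightarrow> L (base_mod R G (sub_mod T N)) = 0))))"
proof -
  interpret entropy_setting R G \<sigma> \<rho> L
    using assms
    by (simp add: entropy_setting_def entropy_setting_axioms_def length_on_modules_def length_on_modules_axioms_def)
  show ?thesis
  proof (intro conjI ballI allI impI)
    show "length_function RG (lFin_L R G \<sigma> \<rho> L) (ent R G L)" by (rule length_function_ent)
  next
    fix K :: "('r, 'm) module" and T :: "('g \<Rightarrow> 'r, 'm) module"
    assume K: "K \<in> R_Mod R" "L K < \<infinity>" and T: "is_induced_module R G \<sigma> \<rho> K T"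
    have K': "left_module R K" using K(1) by (simp add: R_Mod_def)
    obtain \<iota> c where ic: "induced_coordinates R G \<sigma> \<rho> L T K \<iota> c"
      by (rule induced_module_has_coordinates[OF K' K(2) T])
    show "T \<in> lFin_L R G \<sigma> \<rho> L" by (rule induced_coordinates.induced_lFin[OF ic])
    show "ent R G L T = L K" by (rule induced_coordinates.ent_induced[OF ic])
    show "ent R G L (sub_mod T N) = 0 \<longleftrightarrow> L (base (sub_mod T N)) = 0" if "submodule N RG T" for N
      by (rule induced_coordinates.ent_submodule_zero_iff[OF ic that])
  qed
qed

end
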